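(* Let the underlying single-particle process satisfy the Karlin–McGregor assumptions (KM1)–(KM4), and consider $n$ particles started at $x_1\le\cdots\le x_n$ and run up to time $T$. Fix a coalescence pattern (ghost set $\mathcal G$, heir set $\mathcal H$, role set $\mathcal R=\mathcal H\cup\mathcal G$) and a sign vector $\varepsilon\in\{+1,-1\}^{\mathcal G}$. For every $\varepsilon$-admissible set $A\subseteq\mathbb R^{\mathcal R}$, $$\mathbb P_{\mathrm{int}}(\text{final positions}\in A)=\sum_{\pi\in\Pi_A}\operatorname{sgn}_\varepsilon(\pi)\,\mathbb P(\mathbf X_T\in A_\pi),$$ where $\mathbb P_{\mathrm{int}}$ is the law of the coalescing system with ghosts, $\mathbb P$ is the law of the $n$ non-interacting particles, $\Pi_A$ is the set of $\varepsilon$-candidate bijections for the pattern and $\varepsilon$, and $A_\pi=\{(y_{\pi(I_1)},\dots,y_{\pi(I_n)}):(y_f)_{f\in\mathcal R}\in A\}$.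
   Context: Non-interacting system: $\Omega$ is the probability space, with law $\mathbb P$, of $n$ trajectories $(X^1_t,\dots,X^n_t)_{0\le t\le T}$ with real-valued, linearly ordered states and initial positions $x_1\le\dots\le x_n$; $\mathbf X_T=(X^1_T,\dots,X^n_T)$. Karlin–McGregor assumptions: (KM1) the $n$-particle system is strong Markov: for any stopping time $\tau$ of its joint filtration, the post-$\tau$ system is conditionally independent of the pre-$\tau$ system given the state at $\tau$; (KM2) the particles are independent and all follow the same Markov process, differing only in initial position; (KM3) adjacent particles cannot change their relative order without first occupying the same state; (KM4) for particles $I<J$ the first meeting time $\tau_{I,J}=\inf\{t:X^I_t=X^J_t\}$ is a stopping time. Labels: actors $\mathcal A=\{I_1,\dots,I_n\}$, $I_j=[j,j+1)$ (particle $j$); junctions $\mathcal J=\{2,\dots,n\}$. Label order $\triangleleft$: $[a,b)\triangleleft g$ iff $b\le g$; $g\triangleleft[a,b)$ iff $g\le a$; $[a,b)\triangleleft[a',b')$ iff $b\le a'$; $g\triangleleft g'$ iff $g<g'$. Coalescence pattern: $\mathcal G\subseteq\mathcal J$; $\mathcal H$ is the set of maximal half-open integer intervals in $[1,n+1)$ with no junction of $\mathcal J\setminus\mathcal G$ in the interior; $\mathcal R=\mathcal H\cup\mathcal G$ (so $|\mathcal R|=n$); $\mathrm{heir}(g)$ is the heir whose interior contains $g\in\mathcal G$. Coalescing system: fix a priority order on the particles and run the $n$ trajectories of $\Omega$. Initially every particle $j$ is active and carries the interval $I_j$. At the first instant at which two active particles, carrying $[a,g)$ and $[g,c)$, occupy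 a common state (possibly at time $0$), the higher-priority one stays active, carries $[a,c)$ and continues along its own trajectory; the lower-priority one becomes the ghost labelled by the junction $g$, continuing along its own trajectory without further interaction. Repeat with the active particles. Meetings of three or more active particles at one instant are resolved as a sequence of binary collisions in priority order. At time $T$ the junctions of the created ghosts form the realized ghost set; the position $y_H$ of an heir $H$ is the time-$T$ position of the active particle carrying $H$, and $y_g$ is the time-$T$ position of the particle that became ghost $g$. $\mathbb P_{\mathrm{int}}$ is the resulting law (pushforward of $\mathbb P$; it does not depend on the priority order). The event "final positions $\in A$" means that the realized pattern is the fixed one and $(y_f)_{f\in\mathcal R}\in A$. $\varepsilon$-admissible set: a measurable $A\subseteq\mathbb R^{\mathcal R}$ such that every $(y_f)\in A$ satisfies, for each $g\in\mathcal G$, $y_g\le y_{\mathrm{heir}(g)}$ if $\varepsilon_g=+1$ and $y_{\mathrm{heir}(g)}<y_g$ if $\varepsilon_g=-1$; and $y_H\le y_{H'}$ whenever $H\triangleleft H'$ are heirs. $\varepsilon$-candidate: a bijection $\pi:\mathcal A\to\mathcal R$ such that for every $g\in\mathcal G$: $g\triangleleft\pi^{-1}(g)$ if $\varepsilon_g=+1$, and $\pi^{-1}(g)\triangleleft g$ if $\varepsilon_g=-1$. Ghost-adjusted sign: let $\triangleleft_\varepsilon$ be the total (not necessarily transitive) relation on $\mathcal R$ agreeing with $\triangleleft$ on $\triangleleft$-comparable pairs, and for $H=\mathrm{heir}(g)$ given by $g\triangleleft_\varepsilon H$ if $\varepsilon_g=-1$, $H\triangleleft_\varepsilon g$ if $\varepsilon_g=+1$.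 Then $\operatorname{sgn}_\varepsilon(\pi)=(-1)^{N(\pi)}$ with $N(\pi)=\#\{I\triangleleft I':\pi(I')\triangleleft_\varepsilon\pi(I)\}$. *)

theory Defs
  imports "HOL-Probability.Probability"
begin

section \<open>The non-interacting system\<close>

text \<open>
  Particles are numbered \<open>1, \<dots>, n\<close>; \<open>X j t \<omega>\<close> is the position of particle \<open>j\<close> at time
  \<open>t \<in> {0..T}\<close>.  Random times take values in \<^typ>\<open>ereal\<close>, and \<open>\<infinity>\<close> stands for "not before \<open>T\<close>".
\<close>

definition path_space :: "real \<Rightarrow> (real \<Rightarrow> real) measure" where
  "path_space T = (\<Pi>\<^sub>M t\<in>{0..T}. borel)"

definition path :: "real \<Rightarrow> (nat \<Rightarrow> real \<Rightarrow> 'w \<Rightarrow> real) \<Rightarrow> nat \<Rightarrow> 'w \<Rightarrow> real \<Rightarrow> real" where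
  "path T X j \<omega> = (\<lambda>t\<in>{0..T}. X j t \<omega>)"

definition joint_filtration ::
    "'w measure \<Rightarrow> nat \<Rightarrow> real \<Rightarrow> (nat \<Rightarrow> real \<Rightarrow> 'w \<Rightarrow> real) \<Rightarrow> ereal \<Rightarrow> 'w measure" where
  "joint_filtration M n T X t = sigma (space M)
     {X j s -` B \<inter> space M | j s B. j \<in> {1..n} \<and> s \<in> {0..T} \<and> ereal s \<le> t \<and> B \<in> sets borel}"

lemma filtration_joint_filtration: "filtration (space M) (joint_filtration M n T X)"
proof
  show "space (joint_filtration M n T X t) = space M" for t
    unfolding joint_filtration_def by (rule space_measure_of) auto
  show "sets (joint_filtration M n T X t) \<subseteq> sets (joint_filtration M n T X t')"
    if "t \<le> t'" for t t'
    unfolding joint_filtration_def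
    using that by (subst (1 2) sets_measure_of) (auto intro!: sigma_sets_mono' intro: order_trans)
qed

text \<open>
  The single-particle Markov process is given by the laws \<open>Q s x\<close> of its trajectory when started
  at time \<open>s\<close> in the state \<open>x\<close>.  To keep one path space for all \<open>s\<close>, such a trajectory is extended
  to \<open>[0, T]\<close> by the constant value \<open>x\<close> on \<open>[0, s]\<close>.  No time-homogeneity is required.
\<close>

definition path_laws :: "real \<Rightarrow> (real \<Rightarrow> real \<Rightarrow> (real \<Rightarrow> real) measure) \<Rightarrow> bool" where
  "path_laws T Q \<longleftrightarrow>
     (\<lambda>(s, x). Q s x) \<in> borel \<Otimes>\<^sub>M borel \<rightarrow>\<^sub>M prob_algebra (path_space T) \<and>
     (\<forall>s\<in>{0..T}. \<forall>x. \<forall>t\<in>{0..s}. AE w in Q s x. w t = x)"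

text \<open>The law of \<open>n\<close> independent such particles, started at time \<open>s\<close> in the states \<open>z 1, \<dots>, z n\<close>.\<close>

definition system_law ::
    "nat \<Rightarrow> (real \<Rightarrow> real \<Rightarrow> (real \<Rightarrow> real) measure) \<Rightarrow> real \<Rightarrow> (nat \<Rightarrow> real) \<Rightarrow>
      (nat \<Rightarrow> real \<Rightarrow> real) measure" where
  "system_law n Q s z = (\<Pi>\<^sub>M j\<in>{1..n}. Q s (z j))"

text \<open>The system after time \<open>s\<close>, again extended to \<open>[0, s]\<close> by its state at time \<open>s\<close>.\<close>

definition post_system ::
    "nat \<Rightarrow> real \<Rightarrow> (nat \<Rightarrow> real \<Rightarrow> 'w \<Rightarrow> real) \<Rightarrow> real \<Rightarrow> 'w \<Rightarrow> nat \<Rightarrow> real \<Rightarrow> real" where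
  "post_system n T X s \<omega> = (\<lambda>j\<in>{1..n}. \<lambda>t\<in>{0..T}. X j (max t s) \<omega>)"

text \<open>
  (KM1) On \<open>{\<tau> \<le> T}\<close> the conditional law of the post-\<open>\<tau>\<close> system given the \<open>\<sigma>\<close>-algebra of the
  pre-\<open>\<tau>\<close> system is the law of the \<open>n\<close>-particle system restarted at time \<open>\<tau>\<close> from the state at \<open>\<tau>\<close>.
  It thus depends on the past through \<open>\<tau>\<close> and the state at \<open>\<tau>\<close> only, which is the conditional
  independence of the post- and the pre-\<open>\<tau>\<close> system given that state.
\<close>

definition KM1 ::
    "'w measure \<Rightarrow> nat \<Rightarrow> real \<Rightarrow> (real \<Rightarrow> real \<Rightarrow> (real \<Rightarrow> real) measure) \<Rightarrow>
      (nat \<Rightarrow> real \<Rightarrow> 'w \<Rightarrow> real) \<Rightarrow> bool" where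
  "KM1 M n T Q X \<longleftrightarrow>
     (\<forall>\<tau>. stopping_time (joint_filtration M n T X) \<tau> \<and> (\<forall>\<omega>\<in>space M. 0 \<le> \<tau> \<omega>) \<longrightarrow>
        (\<forall>j\<in>{1..n}. (\<lambda>\<omega>. X j (real_of_ereal (\<tau> \<omega>)) \<omega>) \<in> borel_measurable
           (restrict_space (filtration.pre_sigma (space M) (joint_filtration M n T X) \<tau>)
              {\<omega>\<in>space M. \<tau> \<omega> \<le> ereal T})) \<and>
        (\<forall>E\<in>sets (filtration.pre_sigma (space M) (joint_filtration M n T X) \<tau>).
         \<forall>B\<in>sets (\<Pi>\<^sub>M j\<in>{1..n}. path_space T).
           emeasure M {\<omega>\<in>E. \<tau> \<omega> \<le> ereal T \<and> post_system n T X (real_of_ereal (\<tau> \<omega>)) \<omega> \<in> B} =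
           (\<integral>\<^sup>+\<omega>\<in>{\<omega>\<in>E. \<tau> \<omega> \<le> ereal T}.
              emeasure (system_law n Q (real_of_ereal (\<tau> \<omega>))
                (\<lambda>j. X j (real_of_ereal (\<tau> \<omega>)) \<omega>)) B \<partial>M)))"

definition KM2 ::
    "'w measure \<Rightarrow> nat \<Rightarrow> real \<Rightarrow> (real \<Rightarrow> real \<Rightarrow> (real \<Rightarrow> real) measure) \<Rightarrow>
      (nat \<Rightarrow> real) \<Rightarrow> (nat \<Rightarrow> real \<Rightarrow> 'w \<Rightarrow> real) \<Rightarrow> bool" where
  "KM2 M n T Q x X \<longleftrightarrow>
     prob_space.indep_vars M (\<lambda>_. path_space T) (path T X) {1..n} \<and>
     (\<forall>j\<in>{1..n}. distr M (path_space T) (path T X j) = Q 0 (x j))"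

text \<open>
  (KM3) is imposed on every pair of particles, viewed as a two-particle system: after a coalescence,
  any two particles may become neighbours among the active ones.
\<close>

definition KM3 :: "'w measure \<Rightarrow> nat \<Rightarrow> real \<Rightarrow> (nat \<Rightarrow> real \<Rightarrow> 'w \<Rightarrow> real) \<Rightarrow> bool" where
  "KM3 M n T X \<longleftrightarrow>
     (\<forall>i\<in>{1..n}. \<forall>j\<in>{1..n}. AE \<omega> in M.
        \<forall>s t. 0 \<le> s \<and> s \<le> t \<and> t \<le> T \<and> X i s \<omega> < X j s \<omega> \<and> X j t \<omega> < X i t \<omega> \<longrightarrow>
          (\<exists>u\<in>{s..t}. X i u \<omega> = X j u \<omega>))"

definition first_meeting ::
    "real \<Rightarrow> (nat \<Rightarrow> real \<Rightarrow> 'w \<Rightarrow> real) \<Rightarrow> 'w \<Rightarrow> nat \<Rightarrow> nat \<Rightarrow> ereal" where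
  "first_meeting T X \<omega> i j = Inf {ereal t | t. t \<in> {0..T} \<and> X i t \<omega> = X j t \<omega>}"

text \<open>
  (KM4) The second clause says that the infimum is a minimum, that is, that there is a first instant
  at which the two particles meet (automatic for right-continuous trajectories).
\<close>

definition KM4 :: "'w measure \<Rightarrow> nat \<Rightarrow> real \<Rightarrow> (nat \<Rightarrow> real \<Rightarrow> 'w \<Rightarrow> real) \<Rightarrow> bool" where
  "KM4 M n T X \<longleftrightarrow>
     (\<forall>i\<in>{1..n}. \<forall>j\<in>{1..n}. i < j \<longrightarrow>
        stopping_time (joint_filtration M n T X) (\<lambda>\<omega>. first_meeting T X \<omega> i j) \<and>
        (AE \<omega> in M. first_meeting T X \<omega> i j < \<infinity> \<longrightarrow>
           X i (real_of_ereal (first_meeting T X \<omega> i j)) \<omega> =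
           X j (real_of_ereal (first_meeting T X \<omega> i j)) \<omega>))"


section \<open>Labels and coalescence patterns\<close>

text \<open>\<open>Intv a b\<close> is the half-open integer interval \<open>[a, b)\<close>.\<close>

datatype label = Intv nat nat | Junc nat

fun lab_less :: "label \<Rightarrow> label \<Rightarrow> bool" (infix \<open>\<lhd>\<^sub>L\<close> 50) where
  "Intv a b \<lhd>\<^sub>L Junc g \<longleftrightarrow> b \<le> g"
| "Junc g \<lhd>\<^sub>L Intv a b \<longleftrightarrow> g \<le> a"
| "Intv a b \<lhd>\<^sub>L Intv a' b' \<longleftrightarrow> b \<le> a'"
| "Junc g \<lhd>\<^sub>L Junc g' \<longleftrightarrow> g < g'"

definition actor :: "nat \<Rightarrow> label" where
  "actor j = Intv j (j + 1)"

definition actors :: "nat \<Rightarrow> label set" where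
  "actors n = actor ` {1..n}"

definition junctions :: "nat \<Rightarrow> nat set" where
  "junctions n = {2..n}"

definition uncut :: "nat \<Rightarrow> nat set \<Rightarrow> nat \<Rightarrow> nat \<Rightarrow> bool" where
  "uncut n G a b \<longleftrightarrow>
     1 \<le> a \<and> a < b \<and> b \<le> n + 1 \<and> (\<forall>g\<in>junctions n - G. \<not> (a < g \<and> g < b))"

definition heirs :: "nat \<Rightarrow> nat set \<Rightarrow> label set" where
  "heirs n G = {Intv a b | a b. uncut n G a b \<and>
     (\<forall>a' b'. uncut n G a' b' \<and> a' \<le> a \<and> b \<le> b' \<longrightarrow> a' = a \<and> b' = b)}"

definition roles :: "nat \<Rightarrow> nat set \<Rightarrow> label set" where
  "roles n G = heirs n G \<union> Junc ` G"

definition heir :: "nat \<Rightarrow> nat set \<Rightarrow> nat \<Rightarrow> label" where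
  "heir n G g = (THE H. H \<in> heirs n G \<and> (\<exists>a b. H = Intv a b \<and> a < g \<and> g < b))"


section \<open>Admissible sets, candidates and signs\<close>

definition admissible ::
    "nat \<Rightarrow> nat set \<Rightarrow> (nat \<Rightarrow> int) \<Rightarrow> (label \<Rightarrow> real) set \<Rightarrow> bool" where
  "admissible n G \<epsilon> A \<longleftrightarrow>
     A \<in> sets (\<Pi>\<^sub>M f\<in>roles n G. borel) \<and>
     (\<forall>y\<in>A.
        (\<forall>g\<in>G. (\<epsilon> g = 1 \<longrightarrow> y (Junc g) \<le> y (heir n G g)) \<and>
                (\<epsilon> g = -1 \<longrightarrow> y (heir n G g) < y (Junc g))) \<and>
        (\<forall>H\<in>heirs n G. \<forall>H'\<in>heirs n G. H \<lhd>\<^sub>L H' \<longrightarrow> y H \<le> y H'))"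

definition candidates :: "nat \<Rightarrow> nat set \<Rightarrow> (nat \<Rightarrow> int) \<Rightarrow> (label \<Rightarrow> label) set" where
  "candidates n G \<epsilon> =
     {\<pi> \<in> extensional (actors n). bij_betw \<pi> (actors n) (roles n G) \<and>
        (\<forall>g\<in>G. (\<epsilon> g = 1 \<longrightarrow> Junc g \<lhd>\<^sub>L inv_into (actors n) \<pi> (Junc g)) \<and>
                (\<epsilon> g = -1 \<longrightarrow> inv_into (actors n) \<pi> (Junc g) \<lhd>\<^sub>L Junc g))}"

text \<open>
  On the roles, the only pairs of distinct labels that are not \<open>\<lhd>\<^sub>L\<close>-comparable are the pairs
  consisting of a ghost and its heir.
\<close>

definition lab_less_eps ::
    "nat \<Rightarrow> nat set \<Rightarrow> (nat \<Rightarrow> int) \<Rightarrow> label \<Rightarrow> label \<Rightarrow> bool" where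
  "lab_less_eps n G \<epsilon> f f' \<longleftrightarrow>
     f \<lhd>\<^sub>L f' \<or>
     (\<exists>g\<in>G. \<epsilon> g = -1 \<and> f = Junc g \<and> f' = heir n G g) \<or>
     (\<exists>g\<in>G. \<epsilon> g = 1 \<and> f = heir n G g \<and> f' = Junc g)"

definition sgn_eps ::
    "nat \<Rightarrow> nat set \<Rightarrow> (nat \<Rightarrow> int) \<Rightarrow> (label \<Rightarrow> label) \<Rightarrow> real" where
  "sgn_eps n G \<epsilon> \<pi> =
     (-1) ^ card {(I, I'). I \<in> actors n \<and> I' \<in> actors n \<and> I \<lhd>\<^sub>L I' \<and>
                           lab_less_eps n G \<epsilon> (\<pi> I') (\<pi> I)}"

text \<open>The set \<open>A\<^sub>\<pi>\<close>.\<close>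

definition pulled_back ::
    "nat \<Rightarrow> (label \<Rightarrow> label) \<Rightarrow> (label \<Rightarrow> real) set \<Rightarrow> (nat \<Rightarrow> real) set" where
  "pulled_back n \<pi> A = (\<lambda>y. \<lambda>j\<in>{1..n}. y (\<pi> (actor j))) ` A"


section \<open>The coalescing system with ghosts\<close>

text \<open>
  A configuration \<open>(S, D)\<close> consists of the set \<open>S\<close> of all \<open>(p, a, b)\<close> such that particle \<open>p\<close> is
  active and carries \<open>[a, b)\<close>, and of the map \<open>D\<close> sending a junction \<open>g\<close> to the particle that became
  the ghost \<open>g\<close>.  In what follows, \<open>m p q\<close> is the first meeting time of the trajectories of \<open>p\<close> and
  \<open>q\<close>; since the order of active particles is preserved, two neighbouring active particles cannot
  have met before the current time, so no later meeting times are needed.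

  Particle \<open>p\<close> has priority over \<open>q\<close> iff \<open>prio p < prio q\<close>.  Simultaneous collisions are resolved
  one by one, ordered first by the priority of the winner and then by that of the loser.
\<close>

type_synonym config = "(nat \<times> nat \<times> nat) set \<times> (nat \<rightharpoonup> nat)"

definition initial_config :: "nat \<Rightarrow> config" where
  "initial_config n = ((\<lambda>j. (j, j, j + 1)) ` {1..n}, Map.empty)"

text \<open>\<open>(p, a, g, q, c)\<close>: particle \<open>p\<close> carrying \<open>[a, g)\<close> collides with \<open>q\<close> carrying \<open>[g, c)\<close>.\<close>

definition collisions ::
    "(nat \<Rightarrow> nat \<Rightarrow> ereal) \<Rightarrow> (nat \<times> nat \<times> nat) set \<Rightarrow> (nat \<times> nat \<times> nat \<times> nat \<times> nat) set" where
  "collisions m S = {(p, a, g, q, c). (p, a, g) \<in> S \<and> (q, g, c) \<in> S \<and> m p q < \<infinity>}"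

definition precedes ::
    "(nat \<Rightarrow> nat) \<Rightarrow> (nat \<Rightarrow> nat \<Rightarrow> ereal) \<Rightarrow>
      nat \<times> nat \<times> nat \<times> nat \<times> nat \<Rightarrow> nat \<times> nat \<times> nat \<times> nat \<times> nat \<Rightarrow> bool" where
  "precedes prio m = (\<lambda>(p, _, _, q, _) (p', _, _, q', _).
     let w = min (prio p) (prio q); w' = min (prio p') (prio q');
         l = max (prio p) (prio q); l' = max (prio p') (prio q')
     in m p q < m p' q' \<or> m p q = m p' q' \<and> (w < w' \<or> w = w' \<and> l < l'))"

definition next_collision ::
    "(nat \<Rightarrow> nat) \<Rightarrow> (nat \<Rightarrow> nat \<Rightarrow> ereal) \<Rightarrow> (nat \<times> nat \<times> nat) set \<Rightarrow>
      nat \<times> nat \<times> nat \<times> nat \<times> nat" where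
  "next_collision prio m S =
     (THE k. k \<in> collisions m S \<and> (\<forall>k'\<in>collisions m S. k' \<noteq> k \<longrightarrow> precedes prio m k k'))"

definition collide :: "(nat \<Rightarrow> nat) \<Rightarrow> (nat \<Rightarrow> nat \<Rightarrow> ereal) \<Rightarrow> config \<Rightarrow> config" where
  "collide prio m = (\<lambda>(S, D).
     if collisions m S = {} then (S, D)
     else case next_collision prio m S of (p, a, g, q, c) \<Rightarrow>
       let (winner, loser) = (if prio p < prio q then (p, q) else (q, p))
       in (S - {(p, a, g), (q, g, c)} \<union> {(winner, a, c)}, D(g \<mapsto> loser)))"

text \<open>At most \<open>n - 1\<close> collisions occur, so \<open>n\<close> steps exhaust them.\<close>

definition final_config ::
    "nat \<Rightarrow> real \<Rightarrow> (nat \<Rightarrow> nat) \<Rightarrow> (nat \<Rightarrow> real \<Rightarrow> 'w \<Rightarrow> real) \<Rightarrow> 'w \<Rightarrow> config" where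
  "final_config n T prio X \<omega> = (collide prio (first_meeting T X \<omega>) ^^ n) (initial_config n)"

definition realized_ghosts ::
    "nat \<Rightarrow> real \<Rightarrow> (nat \<Rightarrow> nat) \<Rightarrow> (nat \<Rightarrow> real \<Rightarrow> 'w \<Rightarrow> real) \<Rightarrow> 'w \<Rightarrow> nat set" where
  "realized_ghosts n T prio X \<omega> = dom (snd (final_config n T prio X \<omega>))"

text \<open>Meaningful when the realized ghost set is \<open>G\<close>, so that the intervals carried are the heirs.\<close>

definition final_positions ::
    "nat \<Rightarrow> real \<Rightarrow> (nat \<Rightarrow> nat) \<Rightarrow> nat set \<Rightarrow> (nat \<Rightarrow> real \<Rightarrow> 'w \<Rightarrow> real) \<Rightarrow> 'w \<Rightarrow>
      label \<Rightarrow> real" where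
  "final_positions n T prio G X \<omega> = (\<lambda>f\<in>roles n G. case f of
       Intv a b \<Rightarrow> X (THE p. (p, a, b) \<in> fst (final_config n T prio X \<omega>)) T \<omega>
     | Junc g \<Rightarrow> X (the (snd (final_config n T prio X \<omega>) g)) T \<omega>)"

text \<open>The probability, under the law of the coalescing system, of "final positions \<open>\<in> A\<close>".\<close>

definition P_int ::
    "'w measure \<Rightarrow> nat \<Rightarrow> real \<Rightarrow> (nat \<Rightarrow> nat) \<Rightarrow> (nat \<Rightarrow> real \<Rightarrow> 'w \<Rightarrow> real) \<Rightarrow> nat set \<Rightarrow>
      (label \<Rightarrow> real) set \<Rightarrow> real" where
  "P_int M n T prio X G A = measure M {\<omega>\<in>space M.
     realized_ghosts n T prio X \<omega> = G \<and> final_positions n T prio G X \<omega> \<in> A}"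

end

theory Submission
  imports Defs
begin

text \<open>
  Code an interval \<open>[a, b)\<close> by its left end \<open>a\<close> and a ghost \<open>g\<close> by \<open>g\<close> itself.  Then the labels present
  at any stage of the coalescing system are coded by \<open>1, \<dots>, n\<close>, a stage is given by the set \<open>\<Gamma>\<close> of
  ghosts created so far and a permutation \<open>\<psi>\<close> sending codes to particles, and the bijections between
  the labels of a stage and the roles become permutations \<open>\<rho>\<close> of \<open>{1..n}\<close>.  To a stage we attach the
  signed sum, over those \<open>\<rho>\<close> that fix \<open>\<Gamma>\<close> and satisfy the candidate condition at the remaining ghosts,
  of the indicators that the end positions, read through \<open>\<rho>\<close>, lie in \<open>A\<close>.  At stage 0 its expectation
  is the right-hand side of the theorem.

  The expectation does not change at a collision.  Let \<open>[a, g)\<close> and \<open>[g, c)\<close> collide.  By the strong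
  Markov property the two trajectories may be exchanged afterwards, so \<open>\<rho>\<close> and its composition with the
  transposition of \<open>a\<close> and \<open>g\<close> have the same probability but opposite signs; they cancel unless one of
  the two intervals takes the role of the ghost \<open>g\<close>.  The surviving \<open>\<rho>\<close> correspond, with equal signs, to
  the permutations of the next stage.

  When no collision is left, the active particles are strictly ordered, and admissibility of \<open>A\<close> leaves
  only \<open>\<Gamma> = G\<close> with \<open>\<rho> = id\<close>, so that the expectation is the left-hand side.
\<close>


section \<open>Signed sums over permutations\<close>

text \<open>A collision preserves the signed sum only after adding its values at an end
  configuration and at the configuration with the two colliding particles exchanged. The priority
  rule merely decides which of these two particles continues, so it drops out of this symmetrised
  identity. The obstacle is to use the strong Markov property at a collision, whose pair of
  particles is random. Only the first meeting of a fixed pair is known to be a stopping time. So a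
  stage \<open>s\<close> and a junction \<open>g\<close> are fixed, and the argument runs at the
  first meeting of the two holders adjacent at \<open>g\<close>; the event that \<open>s\<close> is
  the current stage and \<open>g\<close> collides next must be shown to lie in the past of that
  time. This rests on the collision times being nondecreasing along the run, which follows from the
  initial order and (KM3). The relation \<open>before_eps\<close> is total but may contain cycles,
  so signs are handled by counting pairs: totality alone makes an exchange of neighbours alter
  exactly one counted pair.\<close>

hide_const (open) Finite_Cartesian_Product.transpose

text \<open>
  When \<open>\<Gamma>\<close> is the set of ghosts, the label coded by \<open>a \<notin> \<Gamma>\<close> is the interval \<open>[a, nxt n \<Gamma> a)\<close>.  For \<open>g \<notin> \<Gamma>\<close>,
  \<open>prv \<Gamma> g\<close> codes the interval that ends at \<open>g\<close>; for \<open>g \<in> \<Gamma>\<close>, it codes the interval containing \<open>g\<close>.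
\<close>

definition prv :: "nat set \<Rightarrow> nat \<Rightarrow> nat" where
  "prv \<Gamma> g = Max ({1..<g} - \<Gamma>)"

definition nxt :: "nat \<Rightarrow> nat set \<Rightarrow> nat \<Rightarrow> nat" where
  "nxt n \<Gamma> a = Min ({a<..n + 1} - \<Gamma>)"

lemma prv_props:
  assumes "\<Gamma> \<subseteq> {2..n}" "2 \<le> g"
  shows "1 \<le> prv \<Gamma> g" "prv \<Gamma> g < g" "prv \<Gamma> g \<notin> \<Gamma>"
    and prv_greatest: "\<And>b. 1 \<le> b \<Longrightarrow> b < g \<Longrightarrow> b \<notin> \<Gamma> \<Longrightarrow> b \<le> prv \<Gamma> g"
proof -
  have "1 \<in> {1..<g} - \<Gamma>" using assms by auto
  then have "prv \<Gamma> g \<in> {1..<g} - \<Gamma>"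
    unfolding prv_def by (intro Max_in) auto
  then show "1 \<le> prv \<Gamma> g" "prv \<Gamma> g < g" "prv \<Gamma> g \<notin> \<Gamma>" by auto
  show "\<And>b. 1 \<le> b \<Longrightarrow> b < g \<Longrightarrow> b \<notin> \<Gamma> \<Longrightarrow> b \<le> prv \<Gamma> g"
    unfolding prv_def by (intro Max_ge) auto
qed

lemma nxt_props:
  assumes "\<Gamma> \<subseteq> {2..n}" "a \<le> n"
  shows "a < nxt n \<Gamma> a" "nxt n \<Gamma> a \<le> n + 1" "nxt n \<Gamma> a \<notin> \<Gamma>"
    and nxt_least: "\<And>b. a < b \<Longrightarrow> b \<le> n + 1 \<Longrightarrow> b \<notin> \<Gamma> \<Longrightarrow> nxt n \<Gamma> a \<le> b"
proof -
  have "n + 1 \<in> {a<..n + 1} - \<Gamma>" using assms by auto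
  then have "nxt n \<Gamma> a \<in> {a<..n + 1} - \<Gamma>"
    unfolding nxt_def by (intro Min_in) auto
  then show "a < nxt n \<Gamma> a" "nxt n \<Gamma> a \<le> n + 1" "nxt n \<Gamma> a \<notin> \<Gamma>" by auto
  show "\<And>b. a < b \<Longrightarrow> b \<le> n + 1 \<Longrightarrow> b \<notin> \<Gamma> \<Longrightarrow> nxt n \<Gamma> a \<le> b"
    unfolding nxt_def by (intro Min_le) auto
qed

lemma nxt_eqI:
  assumes "a < b" "b \<le> n + 1" "b \<notin> \<Gamma>" "\<And>c. a < c \<Longrightarrow> c < b \<Longrightarrow> c \<in> \<Gamma>"
  shows "nxt n \<Gamma> a = b"
  unfolding nxt_def
proof (rule Min_eqI)
  show "b \<le> c" if "c \<in> {a<..n + 1} - \<Gamma>" for c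
    using that assms(4)[of c] by (cases "b \<le> c") auto
qed (use assms in auto)

lemma prv_eqI:
  assumes "b < a" "1 \<le> b" "b \<notin> \<Gamma>" "\<And>c. b < c \<Longrightarrow> c < a \<Longrightarrow> c \<in> \<Gamma>"
  shows "prv \<Gamma> a = b"
  unfolding prv_def
proof (rule Max_eqI)
  show "c \<le> b" if "c \<in> {1..<a} - \<Gamma>" for c
    using that assms(4)[of c] by (cases "c \<le> b") auto
qed (use assms in auto)

lemma nxt_prv:
  assumes "\<Gamma> \<subseteq> {2..n}" "2 \<le> g" "g \<le> n + 1" "g \<notin> \<Gamma>"
  shows "nxt n \<Gamma> (prv \<Gamma> g) = g"
proof (rule nxt_eqI)
  fix c assume c: "prv \<Gamma> g < c" "c < g"
  show "c \<in> \<Gamma>"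
  proof (rule ccontr)
    assume "c \<notin> \<Gamma>"
    then have "c \<le> prv \<Gamma> g" using assms c by (intro prv_greatest[of \<Gamma> n]) auto
    then show False using c by simp
  qed
qed (use assms prv_props[OF assms(1,2)] in auto)

lemma prv_nxt:
  assumes "\<Gamma> \<subseteq> {2..n}" "1 \<le> a" "a \<le> n" "a \<notin> \<Gamma>"
  shows "prv \<Gamma> (nxt n \<Gamma> a) = a"
proof (rule prv_eqI)
  fix c assume c: "a < c" "c < nxt n \<Gamma> a"
  show "c \<in> \<Gamma>"
  proof (rule ccontr)
    assume "c \<notin> \<Gamma>"
    then have "nxt n \<Gamma> a \<le> c"
      using assms c nxt_props[OF assms(1,3)] by (intro nxt_least) auto
    then show False using c by simp
  qed
qed (use assms nxt_props[OF assms(1,3)] in auto)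

lemma transpose_if: "transpose a b c = (if c = a then b else if c = b then a else c)"
  by (simp add: transpose_def)

locale pattern =
  fixes n :: nat and G :: "nat set" and \<epsilon> :: "nat \<Rightarrow> int"
  assumes G: "G \<subseteq> {2..n}" and eps: "\<And>g. g \<in> G \<Longrightarrow> \<epsilon> g \<in> {1, -1}"
begin

text \<open>
  On codes, \<open>\<lhd>\<^sub>\<epsilon>\<close> is the order of the natural numbers, reversed only between \<open>g\<close> and its heir \<open>prv G g\<close>
  when \<open>\<epsilon> g = -1\<close>.
\<close>

definition before_eps :: "nat \<Rightarrow> nat \<Rightarrow> bool" where
  "before_eps k l \<longleftrightarrow> k < l \<and> \<not> (l \<in> G \<and> \<epsilon> l = -1 \<and> k = prv G l) \<or>
             k \<in> G \<and> \<epsilon> k = -1 \<and> l = prv G k"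

text \<open>With \<open>\<pi>\<close> the inverse of \<open>\<rho>\<close>, these are the pairs
  counted by N(\<pi>), indexed by roles instead of labels. Ghosts already created are left out
  because their roles are settled.\<close>

definition inv_pairs :: "nat set \<Rightarrow> (nat \<Rightarrow> nat) \<Rightarrow> (nat \<times> nat) set" where
  "inv_pairs \<Gamma> \<rho> = {(f, f'). f \<in> {1..n} - \<Gamma> \<and> f' \<in> {1..n} - \<Gamma> \<and> \<rho> f < \<rho> f' \<and> before_eps f' f}"

definition inv_sign :: "nat set \<Rightarrow> (nat \<Rightarrow> nat) \<Rightarrow> real" where
  "inv_sign \<Gamma> \<rho> = (-1) ^ card (inv_pairs \<Gamma> \<rho>)"

text \<open>Here \<open>\<rho>\<close> sends a role to the label of the stage that takes it, so it plays the part of \<open>\<pi>\<inverse>\<close>.\<close>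

definition cands :: "nat set \<Rightarrow> (nat \<Rightarrow> nat) set" where
  "cands \<Gamma> = {\<rho>. \<Gamma> \<subseteq> G \<and> \<rho> permutes {1..n} \<and> (\<forall>g\<in>\<Gamma>. \<rho> g = g) \<and>
     (\<forall>g\<in>G - \<Gamma>. (\<epsilon> g = 1 \<longrightarrow> g \<le> \<rho> g) \<and> (\<epsilon> g = -1 \<longrightarrow> \<rho> g < g))}"

text \<open>Here \<open>z k\<close> is the end position of the holder of label \<open>k\<close>, and
  \<open>h\<close> will be the indicator of \<open>A\<close>; thus \<open>z \<circ> \<rho>\<close>
  lists the positions that \<open>\<rho>\<close> hands to the roles.\<close>

definition signed_sum :: "nat set \<Rightarrow> ((nat \<Rightarrow> real) \<Rightarrow> real) \<Rightarrow> (nat \<Rightarrow> real) \<Rightarrow> real" where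
  "signed_sum \<Gamma> h z = (\<Sum>\<rho>\<in>cands \<Gamma>. inv_sign \<Gamma> \<rho> * h (z \<circ> \<rho>))"

section \<open>Signs under an exchange of neighbours and under the creation of a ghost\<close>

lemma finite_cands: "finite (cands \<Gamma>)"
  by (rule finite_subset[OF _ finite_permutations[of "{1..n}"]]) (auto simp: cands_def)

lemma finite_inv_pairs: "finite (inv_pairs \<Gamma> \<rho>)"
  by (rule finite_subset[of _ "{1..n} \<times> {1..n}"]) (auto simp: inv_pairs_def)

lemma prv_less: "g \<in> G \<Longrightarrow> prv G g < g"
  using G prv_props(2)[OF G, of g] by force

lemma before_eps_total: "k \<noteq> l \<Longrightarrow> before_eps k l \<longleftrightarrow> \<not> before_eps l k"
  unfolding before_eps_def using prv_less by (metis less_asym linorder_cases)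

lemma before_eps_plus:
  assumes "g \<in> G" "\<epsilon> g = 1"
  shows "before_eps f g \<longleftrightarrow> f < g" "before_eps g f \<longleftrightarrow> g < f"
proof -
  have "prv G f \<noteq> g" if "f \<in> G" for f
    using prv_props(3)[OF G, of f] that assms(1) G by force
  then show "before_eps f g \<longleftrightarrow> f < g" "before_eps g f \<longleftrightarrow> g < f"
    using assms by (auto simp: before_eps_def)
qed

lemma before_eps_minus:
  assumes "g \<in> G" "\<epsilon> g = -1"
  shows "before_eps f g \<longleftrightarrow> f < g \<and> f \<noteq> prv G g" "before_eps g f \<longleftrightarrow> g < f \<or> f = prv G g"
proof -
  have "prv G f \<noteq> g" if "f \<in> G" for f
    using prv_props(3)[OF G, of f] that assms(1) G by force
  then show "before_eps f g \<longleftrightarrow> f < g \<and> f \<noteq> prv G g" "before_eps g f \<longleftrightarrow> g < f \<or> f = prv G g"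
    using assms by (auto simp: before_eps_def)
qed

text \<open>Since \<open>a\<close> is the last code before \<open>g\<close> outside
  \<open>\<Gamma>\<close>, the codes \<open>a\<close> and \<open>g\<close> are neighbours there, and
  exchanging neighbours disturbs no other comparison.\<close>

lemma transpose_adjacent_less:
  assumes "\<Gamma> \<subseteq> {2..n}" "g \<in> {2..n} - \<Gamma>" "a = prv \<Gamma> g"
    and "k \<in> {1..n} - \<Gamma>" "l \<in> {1..n} - \<Gamma>" "{k, l} \<noteq> {a, g}"
  shows "transpose a g k < transpose a g l \<longleftrightarrow> k < l"
proof -
  have a: "1 \<le> a" "a < g" "a \<notin> \<Gamma>" using prv_props[OF assms(1), of g] assms by auto
  have gr: "b \<le> a" if "1 \<le> b" "b < g" "b \<notin> \<Gamma>" for b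
    using prv_greatest[OF assms(1) _ that] assms by auto
  have k: "k \<le> a \<or> k = g \<or> g < k" and l: "l \<le> a \<or> l = g \<or> g < l"
    using gr[of k] gr[of l] assms by auto
  show ?thesis
    unfolding transpose_if
    using k l a assms(6) by (auto simp: doubleton_eq_iff)
qed

text \<open>Only the pair of roles taken by the labels \<open>a\<close> and \<open>g\<close> changes
  its status. By totality of \<open>before_eps\<close> it is counted for exactly one of the two
  permutations, so the parity flips; transitivity plays no part in this.\<close>

lemma inv_sign_transpose:
  assumes \<Gamma>: "\<Gamma> \<subseteq> {2..n}" and g: "g \<in> {2..n} - \<Gamma>" and a_def: "a = prv \<Gamma> g"
    and \<rho>: "\<rho> permutes {1..n}" and fix': "\<forall>k\<in>\<Gamma>. \<rho> k = k"
  shows "inv_sign \<Gamma> (transpose a g \<circ> \<rho>) = - inv_sign \<Gamma> \<rho>"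
proof -
  let ?t = "transpose a g" and ?K = "{1..n} - \<Gamma>"
  have a: "1 \<le> a" "a < g" "a \<notin> \<Gamma>" using prv_props[OF \<Gamma>, of g] a_def g by auto
  then have aK: "a \<in> ?K" "g \<in> ?K" using g by auto
  have bij: "bij \<rho>" using \<rho> by (rule permutes_bij)
  have inj: "\<rho> k = \<rho> l \<longleftrightarrow> k = l" for k l using permutes_inj[OF \<rho>] by (auto dest: injD)
  have K: "\<rho> k \<in> ?K \<longleftrightarrow> k \<in> ?K" for k
    using permutes_in_image[OF \<rho>, of k] fix' inj by (metis Diff_iff)
  \<comment> \<open>These are the roles taken by the labels \<open>a\<close> and
    \<open>g\<close>.\<close>
  obtain f0 f1 where f: "\<rho> f0 = a" "\<rho> f1 = g" using bij by (metis bij_pointE)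
  have fK: "f0 \<in> ?K" "f1 \<in> ?K" using K f aK by metis+
  have ne: "f0 \<noteq> f1" using f a by auto
  have less: "?t (\<rho> k) < ?t (\<rho> l) \<longleftrightarrow> \<rho> k < \<rho> l"
    if "k \<in> ?K" "l \<in> ?K" "{k, l} \<noteq> {f0, f1}" for k l
  proof -
    have "{\<rho> k, \<rho> l} \<noteq> {a, g}"
      using that(3) inj unfolding f[symmetric] by (auto simp: doubleton_eq_iff)
    then show ?thesis
      using that K by (intro transpose_adjacent_less[OF \<Gamma> g a_def]) auto
  qed
  have mem: "(k, l) \<in> inv_pairs \<Gamma> (?t \<circ> \<rho>) \<longleftrightarrow> (k, l) \<in> inv_pairs \<Gamma> \<rho>" if "{k, l} \<noteq> {f0, f1}" for k l
    using less that by (auto simp: inv_pairs_def)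
  have special: "(f0, f1) \<notin> inv_pairs \<Gamma> (?t \<circ> \<rho>)" "(f1, f0) \<notin> inv_pairs \<Gamma> \<rho>"
     "(f1, f0) \<in> inv_pairs \<Gamma> (?t \<circ> \<rho>) \<longleftrightarrow> before_eps f0 f1"
     "(f0, f1) \<in> inv_pairs \<Gamma> \<rho> \<longleftrightarrow> \<not> before_eps f0 f1"
    using f fK a before_eps_total[OF ne] by (auto simp: inv_pairs_def)
  show ?thesis
  proof (cases "before_eps f0 f1")
    case True
    have "inv_pairs \<Gamma> (?t \<circ> \<rho>) = insert (f1, f0) (inv_pairs \<Gamma> \<rho>)"
    proof (rule set_eqI)
      fix x :: "nat \<times> nat"
      obtain k l where x: "x = (k, l)" by (cases x)
      show "x \<in> inv_pairs \<Gamma> (?t \<circ> \<rho>) \<longleftrightarrow> x \<in> insert (f1, f0) (inv_pairs \<Gamma> \<rho>)"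
      proof (cases "{k, l} = {f0, f1}")
        case True
        then show ?thesis using special \<open>before_eps f0 f1\<close> x ne by (auto simp: doubleton_eq_iff)
      next
        case False
        then show ?thesis using mem[OF False] x by (auto simp: doubleton_eq_iff)
      qed
    qed
    then show ?thesis using special finite_inv_pairs by (simp add: inv_sign_def)
  next
    case False
    have "inv_pairs \<Gamma> \<rho> = insert (f0, f1) (inv_pairs \<Gamma> (?t \<circ> \<rho>))"
    proof (rule set_eqI)
      fix x :: "nat \<times> nat"
      obtain k l where x: "x = (k, l)" by (cases x)
      show "x \<in> inv_pairs \<Gamma> \<rho> \<longleftrightarrow> x \<in> insert (f0, f1) (inv_pairs \<Gamma> (?t \<circ> \<rho>))"
      proof (cases "{k, l} = {f0, f1}")
        case True
        then show ?thesis using special \<open>\<not> before_eps f0 f1\<close> x ne by (auto simp: doubleton_eq_iff)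
      next
        case False
        then show ?thesis using mem[OF False] x by (auto simp: doubleton_eq_iff)
      qed
    qed
    then show ?thesis using special finite_inv_pairs by (simp add: inv_sign_def)
  qed
qed

text \<open>Passing to the new stage drops the pairs that contain the fixed code \<open>g\<close>.
  In the natural order their number is even, because \<open>\<rho>\<close> carries as many codes
  over \<open>g\<close> upwards as downwards. For \<epsilon> = -1 the comparison of \<open>g\<close>
  with its heir is reversed, which changes the parity.\<close>

lemma inv_sign_insert:
  assumes \<Gamma>: "\<Gamma> \<subseteq> G" and g: "g \<in> G - \<Gamma>"
    and \<rho>: "\<rho> permutes {1..n}" and fix': "\<forall>k\<in>insert g \<Gamma>. \<rho> k = k"
  shows "inv_sign (insert g \<Gamma>) \<rho> = \<epsilon> g * inv_sign \<Gamma> \<rho>"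
proof -
  define K where "K = {1..n} - insert g \<Gamma>"
  define P where "P = {f\<in>K. \<rho> f < g \<and> before_eps g f}"
  define Q where "Q = {f\<in>K. g < \<rho> f \<and> before_eps f g}"
  \<comment> \<open>\<open>P\<close> and \<open>Q\<close> are the dropped pairs; \<open>P0\<close>
    and \<open>Q0\<close> are what they would be in the natural order.\<close>
  define P0 where "P0 = {f\<in>K. \<rho> f < g \<and> g < f}"
  define Q0 where "Q0 = {f\<in>K. g < \<rho> f \<and> f < g}"
  have fin: "finite K" "finite P" "finite Q" "finite P0" "finite Q0"
    by (auto simp: K_def P_def Q_def P0_def Q0_def)
  have gn: "g \<in> {1..n}" using g G by auto
  have inj: "\<rho> k = \<rho> l \<longleftrightarrow> k = l" for k l using permutes_inj[OF \<rho>] by (auto dest: injD)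
  have gfix: "\<rho> g = g" using fix' by auto
  have K: "\<rho> k \<in> K \<longleftrightarrow> k \<in> K" for k
    using permutes_in_image[OF \<rho>, of k] fix' inj unfolding K_def by (metis Diff_iff)
  have neg: "\<rho> f \<noteq> g" "f \<noteq> g" if "f \<in> K" for f using that K[of f] by (auto simp: K_def)
  have bij: "bij_betw \<rho> {f\<in>K. \<rho> f < g} {f\<in>K. f < g}"
    unfolding bij_betw_def
  proof
    show "inj_on \<rho> {f\<in>K. \<rho> f < g}" by (auto simp: inj_on_def inj)
    have "f \<in> \<rho> ` {f\<in>K. \<rho> f < g}" if "f \<in> K" "f < g" for f
    proof -
      obtain k where "\<rho> k = f" using permutes_bij[OF \<rho>] by (metis bij_pointE)
      then show ?thesis using that K by blast
    qed
    then show "\<rho> ` {f\<in>K. \<rho> f < g} = {f\<in>K. f < g}" using K by auto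
  qed
  have card0: "card P0 = card Q0"
  proof -
    let ?D = "{f\<in>K. \<rho> f < g \<and> f < g}"
    have *: "finite ?D" "finite P0" "finite Q0" "?D \<inter> P0 = {}" "?D \<inter> Q0 = {}"
      using fin by (auto simp: P0_def Q0_def)
    have "{f\<in>K. \<rho> f < g} = ?D \<union> P0" using neg by (auto simp: P0_def neq_iff)
    moreover have "{f\<in>K. f < g} = ?D \<union> Q0" using neg by (auto simp: Q0_def neq_iff)
    ultimately have "card ?D + card P0 = card ?D + card Q0"
      using bij_betw_same_card[OF bij] card_Un_disjoint[OF *(1,2,4)] card_Un_disjoint[OF *(1,3,5)]
      by simp
    then show ?thesis by simp
  qed
  have parity: "(-1) ^ (card P + card Q) = real_of_int (\<epsilon> g)"
  proof (cases "\<epsilon> g = 1")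
    case True
    have "P = P0" "Q = Q0"
      using g True by (auto simp: P_def Q_def P0_def Q0_def before_eps_plus)
    then show ?thesis using card0 True by simp
  next
    case False
    then have em: "\<epsilon> g = -1" using eps g by auto
    \<comment> \<open>The heir of \<open>g\<close> is the only code whose comparison with
      \<open>g\<close> differs from the natural one. It enters \<open>P\<close> or leaves
      \<open>Q\<close>, according to the side on which \<open>\<rho> h\<close> lies.\<close>
    define h where "h = prv G g"
    have h: "1 \<le> h" "h < g" "h \<notin> G" using prv_props[OF G, of g] g G unfolding h_def by auto
    have hK: "h \<in> K" using h gn \<Gamma> by (auto simp: K_def)
    have before_eps: "before_eps g f \<longleftrightarrow> g < f \<or> f = h" "before_eps f g \<longleftrightarrow> f < g \<and> f \<noteq> h" for f
      using before_eps_minus[of g f] g em by (auto simp: h_def)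
    show ?thesis
    proof (cases "\<rho> h < g")
      case True
      have "P = insert h P0" "Q = Q0" "h \<notin> P0"
        using True hK h by (auto simp: P_def Q_def P0_def Q0_def before_eps)
      then show ?thesis using card0 em fin by simp
    next
      case False
      then have "g < \<rho> h" using neg[OF hK] by simp
      then have "P = P0" "Q0 = insert h Q" "h \<notin> Q"
        using hK h by (auto simp: P_def Q_def P0_def Q0_def before_eps)
      then show ?thesis using card0 em fin by simp
    qed
  qed
  have split: "inv_pairs \<Gamma> \<rho> = inv_pairs (insert g \<Gamma>) \<rho> \<union> ((\<lambda>f. (f, g)) ` P \<union> (\<lambda>f. (g, f)) ` Q)"
    using gn g gfix by (auto simp: inv_pairs_def P_def Q_def K_def)
  have "card (inv_pairs \<Gamma> \<rho>) = card (inv_pairs (insert g \<Gamma>) \<rho>) + (card P + card Q)"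
    unfolding split
  proof (subst card_Un_disjoint)
    show "card (inv_pairs (insert g \<Gamma>) \<rho>) + card ((\<lambda>f. (f, g)) ` P \<union> Pair g ` Q) =
      card (inv_pairs (insert g \<Gamma>) \<rho>) + (card P + card Q)"
      using fin by (subst card_Un_disjoint) (auto simp: card_image inj_on_def P_def Q_def K_def)
  qed (use fin in \<open>auto simp: finite_inv_pairs\<close>, auto simp: inv_pairs_def)
  then have "inv_sign \<Gamma> \<rho> = inv_sign (insert g \<Gamma>) \<rho> * \<epsilon> g"
    by (simp add: inv_sign_def power_add parity[symmetric])
  moreover have "real_of_int (\<epsilon> g) * \<epsilon> g = 1" using eps[of g] g by auto
  ultimately show ?thesis by (simp add: mult_ac)
qed

section \<open>Signed sums across a collision\<close>

lemma transpose_cands: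
  assumes \<Gamma>: "\<Gamma> \<subseteq> {2..n}" and g: "g \<in> {2..n} - \<Gamma>" and a_def: "a = prv \<Gamma> g"
    and \<rho>: "\<rho> \<in> cands \<Gamma>" and ok: "g \<in> G \<Longrightarrow> \<rho> g \<noteq> a \<and> \<rho> g \<noteq> g"
  shows "transpose a g \<circ> \<rho> \<in> cands \<Gamma>"
proof -
  have a: "1 \<le> a" "a < g" "a \<notin> \<Gamma>" using prv_props[OF \<Gamma>, of g] a_def g by auto
  have gr: "b \<le> a" if "1 \<le> b" "b < g" "b \<notin> \<Gamma>" for b
    using prv_greatest[OF \<Gamma> _ that] a_def g by auto
  have perm: "transpose a g \<circ> \<rho> permutes {1..n}"
    using \<rho> a g by (intro permutes_compose permutes_swap_id) (auto simp: cands_def)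
  \<comment> \<open>For \<open>h \<noteq> g\<close> the labels \<open>a\<close> and \<open>g\<close>
    lie on the same side of the threshold \<open>h\<close>, so exchanging them keeps the condition.
    At \<open>h = g\<close> the hypothesis \<open>ok\<close> says that the exchange leaves
    \<open>\<rho> g\<close> alone.\<close>
  have cond: "(\<epsilon> h = 1 \<longrightarrow> h \<le> transpose a g (\<rho> h)) \<and> (\<epsilon> h = -1 \<longrightarrow> transpose a g (\<rho> h) < h)"
    if h: "h \<in> G - \<Gamma>" for h
  proof -
    have *: "(\<epsilon> h = 1 \<longrightarrow> h \<le> \<rho> h) \<and> (\<epsilon> h = -1 \<longrightarrow> \<rho> h < h)" using \<rho> h by (auto simp: cands_def)
    have "2 \<le> h" using h G by auto
    then have "h < g \<Longrightarrow> h \<le> a" using gr[of h] h by auto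
          then have "h \<le> a \<or> h = g \<or> g < h" by linarith
    then show ?thesis
      using * a ok h by (cases "h = g") (auto simp: transpose_if)
  qed
  show ?thesis
    using \<rho> perm cond a g by (auto simp: cands_def transpose_if)
qed

text \<open>Composition with the transposition is a sign-reversing involution of \<open>S\<close>
  that preserves \<open>w\<close>, so the sum equals its own negative.\<close>

lemma sum_transpose_eq_0:
  assumes \<Gamma>: "\<Gamma> \<subseteq> {2..n}" and g: "g \<in> {2..n} - \<Gamma>" and a_def: "a = prv \<Gamma> g"
    and S: "S \<subseteq> cands \<Gamma>" "\<And>\<rho>. \<rho> \<in> S \<Longrightarrow> transpose a g \<circ> \<rho> \<in> S"
    and w: "\<And>\<rho>. w (transpose a g \<circ> \<rho>) = w \<rho>"
  shows "(\<Sum>\<rho>\<in>S. inv_sign \<Gamma> \<rho> * w \<rho>) = 0"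
proof -
  have tt: "transpose a g \<circ> (transpose a g \<circ> \<rho>) = \<rho>" for \<rho> :: "nat \<Rightarrow> nat"
    by (simp add: o_assoc)
  have "(\<Sum>\<rho>\<in>S. inv_sign \<Gamma> \<rho> * w \<rho>) = (\<Sum>\<rho>\<in>S. - (inv_sign \<Gamma> \<rho> * w \<rho>))"
  proof (rule sum.reindex_bij_witness[where i = "(\<circ>) (transpose a g)" and j = "(\<circ>) (transpose a g)"])
    fix \<rho> assume "\<rho> \<in> S"
    then have "inv_sign \<Gamma> (transpose a g \<circ> \<rho>) = - inv_sign \<Gamma> \<rho>"
      using S(1) by (intro inv_sign_transpose[OF \<Gamma> g a_def]) (auto simp: cands_def)
    then show "- (inv_sign \<Gamma> (transpose a g \<circ> \<rho>) * w (transpose a g \<circ> \<rho>)) = inv_sign \<Gamma> \<rho> * w \<rho>"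
      by (simp add: w)
  qed (use S tt in auto)
  then show ?thesis by (simp add: sum_negf)
qed

text \<open>Adding the values at \<open>z\<close> and at the exchanged \<open>z\<close> makes the
  weight of \<open>\<rho>\<close> invariant under the exchange. The candidates whose role
  \<open>g\<close> goes to neither colliding interval then cancel; the others are matched with those
  of the next stage.\<close>

lemma signed_sum_collision:
  assumes \<Gamma>: "\<Gamma> \<subseteq> {2..n}" and g: "g \<in> {2..n} - \<Gamma>" and a_def: "a = prv \<Gamma> g"
  shows "signed_sum \<Gamma> h z + signed_sum \<Gamma> h (z \<circ> transpose a g) =
    signed_sum (insert g \<Gamma>) h z + signed_sum (insert g \<Gamma>) h (z \<circ> transpose a g)"
proof -
  let ?t = "transpose a g"
  define w where "w \<rho> = h (z \<circ> \<rho>) + h (z \<circ> ?t \<circ> \<rho>)" for \<rho>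
  have tt: "?t \<circ> (?t \<circ> \<rho>) = \<rho>" for \<rho> :: "nat \<Rightarrow> nat" by (simp add: o_assoc)
  have wt: "w (?t \<circ> \<rho>) = w \<rho>" for \<rho> by (simp add: w_def o_assoc[symmetric] tt)
  have sums: "signed_sum \<Delta> h z + signed_sum \<Delta> h (z \<circ> ?t) = (\<Sum>\<rho>\<in>cands \<Delta>. inv_sign \<Delta> \<rho> * w \<rho>)" for \<Delta>
    by (simp add: signed_sum_def w_def sum.distrib distrib_left)
  have a: "1 \<le> a" "a < g" "a \<notin> \<Gamma>" using prv_props[OF \<Gamma>, of g] a_def g by auto
  have "(\<Sum>\<rho>\<in>cands \<Gamma>. inv_sign \<Gamma> \<rho> * w \<rho>) = (\<Sum>\<rho>\<in>cands (insert g \<Gamma>). inv_sign (insert g \<Gamma>) \<rho> * w \<rho>)"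
  proof (cases "g \<in> G \<and> \<Gamma> \<subseteq> G")
    case False
    \<comment> \<open>The inclusion of the ghosts in \<open>G\<close> is built into
      \<open>cands\<close>: a ghost outside the pattern leaves nothing on the right, and on the left
      everything cancels.\<close>
    then have "cands (insert g \<Gamma>) = {}" by (auto simp: cands_def)
    moreover have "(\<Sum>\<rho>\<in>cands \<Gamma>. inv_sign \<Gamma> \<rho> * w \<rho>) = 0"
    proof (cases "\<Gamma> \<subseteq> G")
      case True
      show ?thesis
        by (rule sum_transpose_eq_0[OF \<Gamma> g a_def]) (use True False wt transpose_cands[OF \<Gamma> g a_def] in auto)
    qed (simp add: cands_def)
    ultimately show ?thesis by simp
  next
    case True
    \<comment> \<open>The candidate condition at \<open>g\<close> permits only one of the two
      colliding labels to take the role \<open>g\<close>: the right one for \<epsilon> = 1 and the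
      left one for \<epsilon> = -1.\<close>
    define c where "c = (if \<epsilon> g = 1 then g else a)"
    let ?good = "{\<rho>\<in>cands \<Gamma>. \<rho> g = c}" and ?bad = "{\<rho>\<in>cands \<Gamma>. \<rho> g \<noteq> c}"
    have "\<rho> g \<noteq> a \<and> \<rho> g \<noteq> g" if "\<rho> \<in> ?bad" for \<rho>
      using that True g a eps[of g] by (auto simp: c_def cands_def split: if_splits)
    then have bad: "(\<Sum>\<rho>\<in>?bad. inv_sign \<Gamma> \<rho> * w \<rho>) = 0"
      using a by (intro sum_transpose_eq_0[OF \<Gamma> g a_def])
        (auto intro!: transpose_cands[OF \<Gamma> g a_def] simp: wt c_def transpose_if)
    have good: "(\<Sum>\<rho>\<in>?good. inv_sign \<Gamma> \<rho> * w \<rho>) =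
      (\<Sum>\<rho>\<in>cands (insert g \<Gamma>). inv_sign (insert g \<Gamma>) \<rho> * w \<rho>)"
    proof (cases "\<epsilon> g = 1")
      case e: True
      then have "?good = cands (insert g \<Gamma>)" using g True by (auto simp: cands_def c_def)
      moreover have "inv_sign (insert g \<Gamma>) \<rho> = inv_sign \<Gamma> \<rho>" if "\<rho> \<in> cands (insert g \<Gamma>)" for \<rho>
        using inv_sign_insert[of \<Gamma> g \<rho>] that True g e by (auto simp: cands_def)
      ultimately show ?thesis by simp
    next
      case False
      then have e: "\<epsilon> g = -1" "c = a" using eps[of g] True by (auto simp: c_def)
      have ins: "?t \<circ> \<rho> \<in> cands (insert g \<Gamma>)" if "\<rho> \<in> ?good" for \<rho>
      proof -
        have gr: "b \<le> a" if "1 \<le> b" "b < g" "b \<notin> \<Gamma>" for b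
          using prv_greatest[OF \<Gamma> _ that] a_def g by auto
        have \<rho>: "\<rho> \<in> cands \<Gamma>" "\<rho> g = a" using that e by auto
        have perm: "?t \<circ> \<rho> permutes {1..n}"
          using \<rho> a g by (intro permutes_compose permutes_swap_id) (auto simp: cands_def)
        have inj: "\<rho> k = a \<longleftrightarrow> k = g" for k
          using \<rho> by (metis (mono_tags, lifting) cands_def injD mem_Collect_eq permutes_inj)
        have cond: "(\<epsilon> h = 1 \<longrightarrow> h \<le> ?t (\<rho> h)) \<and> (\<epsilon> h = -1 \<longrightarrow> ?t (\<rho> h) < h)"
          if h: "h \<in> G - insert g \<Gamma>" for h
        proof -
          have *: "(\<epsilon> h = 1 \<longrightarrow> h \<le> \<rho> h) \<and> (\<epsilon> h = -1 \<longrightarrow> \<rho> h < h)" using \<rho> h by (auto simp: cands_def)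
          have "2 \<le> h" using h G by auto
          then have "h < g \<Longrightarrow> h \<le> a" using gr[of h] h by auto
          then have "h \<le> a \<or> h = g \<or> g < h" by linarith
          then show ?thesis
            using * a h inj[of h] by (auto simp: transpose_if)
        qed
        show ?thesis
          using \<rho> perm cond a g True by (auto simp: cands_def transpose_if)
      qed
      have ins': "?t \<circ> \<rho> \<in> ?good" if "\<rho> \<in> cands (insert g \<Gamma>)" for \<rho>
      proof -
        have gr: "b \<le> a" if "1 \<le> b" "b < g" "b \<notin> \<Gamma>" for b
          using prv_greatest[OF \<Gamma> _ that] a_def g by auto
        have \<rho>: "\<rho> \<in> cands (insert g \<Gamma>)" "\<rho> g = g" using that by (auto simp: cands_def)
        have perm: "?t \<circ> \<rho> permutes {1..n}"
          using \<rho> a g by (intro permutes_compose permutes_swap_id) (auto simp: cands_def)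
        have inj: "\<rho> k = g \<longleftrightarrow> k = g" for k
          using \<rho> by (metis (mono_tags, lifting) cands_def injD mem_Collect_eq permutes_inj)
        have cond: "(\<epsilon> h = 1 \<longrightarrow> h \<le> ?t (\<rho> h)) \<and> (\<epsilon> h = -1 \<longrightarrow> ?t (\<rho> h) < h)"
          if h: "h \<in> G - \<Gamma>" for h
        proof (cases "h = g")
          case True
          then show ?thesis using e \<rho> a by auto
        next
          case False
          then have *: "(\<epsilon> h = 1 \<longrightarrow> h \<le> \<rho> h) \<and> (\<epsilon> h = -1 \<longrightarrow> \<rho> h < h)"
            using \<rho> h by (auto simp: cands_def)
          have "2 \<le> h" using h G by auto
          then have "h < g \<Longrightarrow> h \<le> a" using gr[of h] h by auto
          then have "h \<le> a \<or> h = g \<or> g < h" by linarith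
          then show ?thesis
            using * a h inj[of h] False by (auto simp: transpose_if)
        qed
        show ?thesis
          using \<rho> perm cond a g True e by (auto simp: cands_def transpose_if)
      qed
      show ?thesis
      proof (rule sum.reindex_bij_witness[where i = "(\<circ>) ?t" and j = "(\<circ>) ?t"])
        \<comment> \<open>Moving the role \<open>g\<close> from label \<open>a\<close> to label
          \<open>g\<close> costs one sign, and creating the ghost costs another since \<epsilon> =
          -1; the two cancel.\<close>
        fix \<rho> assume \<rho>: "\<rho> \<in> ?good"
        have "inv_sign (insert g \<Gamma>) (?t \<circ> \<rho>) = - inv_sign \<Gamma> (?t \<circ> \<rho>)"
          using inv_sign_insert[of \<Gamma> g "?t \<circ> \<rho>"] ins[OF \<rho>] True g e by (auto simp: cands_def)
        also have "\<dots> = inv_sign \<Gamma> \<rho>"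
          using \<rho> inv_sign_transpose[OF \<Gamma> g a_def, of \<rho>] by (auto simp: cands_def)
        finally show "inv_sign (insert g \<Gamma>) (?t \<circ> \<rho>) * w (?t \<circ> \<rho>) = inv_sign \<Gamma> \<rho> * w \<rho>" by (simp add: wt)
      qed (use ins ins' tt in auto)
    qed
    have "(\<Sum>\<rho>\<in>cands \<Gamma>. inv_sign \<Gamma> \<rho> * w \<rho>) = (\<Sum>\<rho>\<in>?good \<union> ?bad. inv_sign \<Gamma> \<rho> * w \<rho>)"
      by (rule sum.cong) auto
    also have "\<dots> = (\<Sum>\<rho>\<in>?good. inv_sign \<Gamma> \<rho> * w \<rho>) + (\<Sum>\<rho>\<in>?bad. inv_sign \<Gamma> \<rho> * w \<rho>)"
      using finite_cands[of \<Gamma>] by (intro sum.union_disjoint) auto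
    finally have "(\<Sum>\<rho>\<in>cands \<Gamma>. inv_sign \<Gamma> \<rho> * w \<rho>) =
      (\<Sum>\<rho>\<in>?good. inv_sign \<Gamma> \<rho> * w \<rho>) + (\<Sum>\<rho>\<in>?bad. inv_sign \<Gamma> \<rho> * w \<rho>)" .
    then show ?thesis using bad good by simp
  qed
  then show ?thesis by (simp add: sums)
qed

section \<open>The terminal stage, with the order constraints of an admissible set written in
  codes\<close>

definition sorted_positions :: "(nat \<Rightarrow> real) \<Rightarrow> bool" where
  "sorted_positions y \<longleftrightarrow>
     (\<forall>g\<in>G. (\<epsilon> g = 1 \<longrightarrow> y g \<le> y (prv G g)) \<and> (\<epsilon> g = -1 \<longrightarrow> y (prv G g) < y g)) \<and>
     (\<forall>a\<in>{1..n} - G. \<forall>b\<in>{1..n} - G. a < b \<longrightarrow> y a \<le> y b)"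

text \<open>
  Below the first missing ghost \<open>g\<close>, an induction from the left shows that every heir takes its own role.
  In particular the heir of \<open>g\<close> does, which leaves no position for \<open>g\<close>.
\<close>

lemma cands_sorted_imp_id:
  assumes \<rho>: "\<rho> \<in> cands \<Gamma>" and z: "strict_mono_on ({1..n} - \<Gamma>) z"
    and y: "sorted_positions (z \<circ> \<rho>)"
  shows "\<Gamma> = G \<and> \<rho> = id"
proof -
  have \<Gamma>: "\<Gamma> \<subseteq> G" and perm: "\<rho> permutes {1..n}" and fix': "\<And>k. k \<in> \<Gamma> \<Longrightarrow> \<rho> k = k"
    and plus: "\<And>g. g \<in> G - \<Gamma> \<Longrightarrow> \<epsilon> g = 1 \<Longrightarrow> g \<le> \<rho> g"
    and minus: "\<And>g. g \<in> G - \<Gamma> \<Longrightarrow> \<epsilon> g = -1 \<Longrightarrow> \<rho> g < g"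
    using \<rho> by (auto simp: cands_def)
  let ?K = "{1..n} - \<Gamma>"
  have inj: "\<rho> k = \<rho> l \<longleftrightarrow> k = l" for k l using permutes_inj[OF perm] by (auto dest: injD)
  have K: "\<rho> k \<in> ?K \<longleftrightarrow> k \<in> ?K" for k
    using permutes_in_image[OF perm, of k] fix' inj by (metis Diff_iff)
  have zle: "k \<le> l" if "z k \<le> z l" "k \<in> ?K" "l \<in> ?K" for k l
    using strict_mono_onD[OF z that(3,2)] that(1) by (meson leD leI)
  have zless: "k < l" if "z k < z l" "k \<in> ?K" "l \<in> ?K" for k l
    using zle[of k l] that by (cases "k = l") auto
  have key: "\<rho> k = k" if "k \<in> {1..n} - G" "\<forall>g\<in>G - \<Gamma>. k < g" for k
    using that
  proof (induction k rule: less_induct)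
    case (less k)
    have kK: "k \<in> ?K" using less.prems \<Gamma> by auto
    \<comment> \<open>\<open>f\<close> is the role taken by the label \<open>k\<close>. It lies to
      the right of \<open>k\<close>, because all smaller roles outside \<open>\<Gamma>\<close> are
      fixed.\<close>
    obtain f where f: "\<rho> f = k" using permutes_bij[OF perm] by (metis bij_pointE)
    have fK: "f \<in> ?K" using K f kK by metis
    have small: "\<rho> j = j" if "j \<in> ?K" "j < k" for j
    proof (rule less.IH)
      show "j \<in> {1..n} - G" using that less.prems(2) by (auto dest: less_asym)
      show "\<forall>g\<in>G - \<Gamma>. j < g" using that(2) less.prems(2) by (auto intro: less_trans)
    qed (use that in auto)
    show ?case
    proof (rule ccontr)
      assume ne: "\<rho> k \<noteq> k"
      then have "f \<noteq> k" using f by auto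
      have fk: "k < f" using small[of f] fK f \<open>f \<noteq> k\<close> by (metis linorder_neqE_nat)
      show False
      proof (cases "f \<in> G")
        case False
        then have "z (\<rho> k) \<le> z (\<rho> f)"
          using y less.prems fK fk by (auto simp: sorted_positions_def)
        then have "\<rho> k \<le> k" using zle[of "\<rho> k" k] f K[of k] kK by simp
        then have "\<rho> k < k" using ne by simp
        then show False using small[of "\<rho> k"] K kK inj ne by metis
      next
        case True
        then have fG: "f \<in> G - \<Gamma>" using fK by auto
        show False
        proof (cases "\<epsilon> f = 1")
          case True
          then show False using plus[OF fG] f fk by simp
        next
          case False
          then have e: "\<epsilon> f = -1" using eps fG by auto
          \<comment> \<open>The heir of \<open>f\<close> is not to the left of \<open>k\<close>, yet
            its position must lie strictly below that of \<open>\<rho> f = k\<close>. It would thus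
            take a label smaller than \<open>k\<close>, and those are already taken by their own
            roles.\<close>
          define h where "h = prv G f"
          have h: "1 \<le> h" "h < f" "h \<notin> G"
            using prv_props[OF G, of f] fG G unfolding h_def by auto
          have hk: "k \<le> h"
            unfolding h_def using less.prems fG G fk by (intro prv_greatest[OF G]) auto
          have hK: "h \<in> ?K" using h fK \<Gamma> by auto
          have "z (\<rho> h) < z k" using y True e f by (auto simp: sorted_positions_def h_def)
          then have "\<rho> h < k" using zless[of "\<rho> h" k] K[of h] hK kK by auto
          then have "\<rho> (\<rho> h) = \<rho> h" using small[of "\<rho> h"] K hK by metis
          then have "\<rho> h = h" by (simp add: inj)
          then show False using \<open>\<rho> h < k\<close> hk by simp
        qed
      qed
    qed
  qed
  have "\<Gamma> = G"
  proof (rule ccontr)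
    assume "\<Gamma> \<noteq> G"
    then have ne: "G - \<Gamma> \<noteq> {}" using \<Gamma> by auto
    have fin: "finite (G - \<Gamma>)" using G finite_subset by blast
    define g where "g = Min (G - \<Gamma>)"
    have g: "g \<in> G - \<Gamma>" using Min_in[OF fin ne] by (simp add: g_def)
    have gmin: "g \<le> k" if "k \<in> G - \<Gamma>" for k using that fin by (simp add: g_def)
    have g2: "2 \<le> g" "g \<le> n" using g G by auto
    define h where "h = prv G g"
    have h: "1 \<le> h" "h < g" "h \<notin> G" using prv_props[OF G g2(1)] by (auto simp: h_def)
    have hK: "h \<in> ?K" and gK: "g \<in> ?K" using h g g2 \<Gamma> by auto
    have \<rho>h: "\<rho> h = h" using h g2 gmin by (intro key) (auto intro: less_le_trans)
    have \<rho>gK: "\<rho> g \<in> ?K" using K gK by simp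
    show False
    proof (cases "\<epsilon> g = 1")
      case True
      then have "z (\<rho> g) \<le> z h" using y g \<rho>h by (auto simp: sorted_positions_def h_def)
      then have "\<rho> g \<le> h" by (rule zle[OF _ \<rho>gK hK])
      then show False using plus[OF g True] h by simp
    next
      case False
      then have e: "\<epsilon> g = -1" using eps g by auto
      then have "z h < z (\<rho> g)" using y g \<rho>h by (auto simp: sorted_positions_def h_def)
      then have 1: "h < \<rho> g" by (rule zless[OF _ hK \<rho>gK])
      have 2: "\<rho> g < g" by (rule minus[OF g e])
      \<comment> \<open>Minimality of \<open>g\<close> excludes the missing ghosts, and
        \<open>\<rho> g\<close> is no created one; but every code strictly between \<open>h\<close>
        and \<open>g\<close> belongs to \<open>G\<close>.\<close>
      then have "\<rho> g \<notin> G" using gmin[of "\<rho> g"] \<rho>gK by auto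
      then have "\<rho> g \<le> h"
        unfolding h_def using 2 \<rho>gK g2 by (intro prv_greatest[OF G]) auto
      then show False using 1 by simp
    qed
  qed
  moreover have "\<rho> k = k" for k
  proof (cases "k \<in> {1..n} - G")
    case True
    then show ?thesis using key \<open>\<Gamma> = G\<close> by auto
  next
    case False
    then show ?thesis using fix' \<open>\<Gamma> = G\<close> permutes_not_in[OF perm] by auto
  qed
  ultimately show ?thesis by auto
qed

lemma signed_sum_final:
  assumes z: "strict_mono_on ({1..n} - \<Gamma>) z"
    and h: "\<And>y. h y \<noteq> 0 \<Longrightarrow> sorted_positions y"
  shows "signed_sum \<Gamma> h z = (if \<Gamma> = G then h z else 0)"
proof -
  have zero: "h (z \<circ> \<rho>) = 0" if "\<rho> \<in> cands \<Gamma>" "\<not> (\<Gamma> = G \<and> \<rho> = id)" for \<rho>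
    using cands_sorted_imp_id[OF that(1) z] h that(2) by blast
  show ?thesis
  proof (cases "\<Gamma> = G")
    case False
    then show ?thesis using zero by (simp add: signed_sum_def)
  next
    case True
    have id: "id \<in> cands \<Gamma>" using True by (auto simp: cands_def permutes_id)
    have "signed_sum \<Gamma> h z = (\<Sum>\<rho>\<in>{id}. inv_sign \<Gamma> \<rho> * h (z \<circ> \<rho>))"
      unfolding signed_sum_def using id zero finite_cands
      by (intro sum.mono_neutral_right) auto
    \<comment> \<open>Every reversal in \<open>before_eps\<close> involves a ghost, and here all
      ghosts are excluded from the count.\<close>
    moreover have "inv_pairs G id = {}" by (auto simp: inv_pairs_def before_eps_def)
    ultimately show ?thesis using True by (simp add: inv_sign_def)
  qed
qed

end


section \<open>Trajectories of the coalescing system\<close>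

definition conf :: "nat \<Rightarrow> nat set \<Rightarrow> (nat \<Rightarrow> nat) \<Rightarrow> config" where
  "conf n \<Gamma> \<psi> = ((\<lambda>a. (\<psi> a, a, nxt n \<Gamma> a)) ` ({1..n} - \<Gamma>), \<lambda>g. if g \<in> \<Gamma> then Some (\<psi> g) else None)"

definition states :: "nat \<Rightarrow> (nat set \<times> (nat \<Rightarrow> nat)) set" where
  "states n = Pow {2..n} \<times> {\<psi>. \<psi> permutes {1..n}}"

definition meet :: "(nat \<Rightarrow> nat \<Rightarrow> ereal) \<Rightarrow> nat set \<Rightarrow> (nat \<Rightarrow> nat) \<Rightarrow> nat \<Rightarrow> ereal" where
  "meet m \<Gamma> \<psi> g = m (\<psi> (prv \<Gamma> g)) (\<psi> g)"

definition coll :: "nat \<Rightarrow> nat set \<Rightarrow> (nat \<Rightarrow> nat) \<Rightarrow> nat \<Rightarrow> nat \<times> nat \<times> nat \<times> nat \<times> nat" where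
  "coll n \<Gamma> \<psi> g = (\<psi> (prv \<Gamma> g), prv \<Gamma> g, g, \<psi> g, nxt n \<Gamma> g)"

definition pending :: "nat \<Rightarrow> (nat \<Rightarrow> nat \<Rightarrow> ereal) \<Rightarrow> nat set \<Rightarrow> (nat \<Rightarrow> nat) \<Rightarrow> nat set" where
  "pending n m \<Gamma> \<psi> = {g \<in> {2..n} - \<Gamma>. meet m \<Gamma> \<psi> g < \<infinity>}"

definition is_next ::
    "nat \<Rightarrow> (nat \<Rightarrow> nat) \<Rightarrow> (nat \<Rightarrow> nat \<Rightarrow> ereal) \<Rightarrow> nat set \<Rightarrow> (nat \<Rightarrow> nat) \<Rightarrow> nat \<Rightarrow> bool" where
  "is_next n prio m \<Gamma> \<psi> g \<longleftrightarrow> g \<in> pending n m \<Gamma> \<psi> \<and>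
     (\<forall>g'\<in>pending n m \<Gamma> \<psi>. g' \<noteq> g \<longrightarrow> precedes prio m (coll n \<Gamma> \<psi> g) (coll n \<Gamma> \<psi> g'))"

text \<open>The united interval keeps its left end as code, while the new ghost gets the code
  \<open>g\<close>. Hence the holders change places exactly when the right-hand particle
  wins.\<close>

definition merge :: "(nat \<Rightarrow> nat) \<Rightarrow> nat set \<Rightarrow> (nat \<Rightarrow> nat) \<Rightarrow> nat \<Rightarrow> nat set \<times> (nat \<Rightarrow> nat)" where
  "merge prio \<Gamma> \<psi> g = (insert g \<Gamma>,
     if prio (\<psi> (prv \<Gamma> g)) < prio (\<psi> g) then \<psi> else \<psi> \<circ> transpose (prv \<Gamma> g) g)"

section \<open>The next collision is well defined\<close>

lemma precedes_trans: "precedes prio m k1 k2 \<Longrightarrow> precedes prio m k2 k3 \<Longrightarrow> precedes prio m k1 k3"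
  unfolding precedes_def by (cases k1; cases k2; cases k3) (auto simp: Let_def)

lemma precedes_asym: "precedes prio m k1 k2 \<Longrightarrow> \<not> precedes prio m k2 k1"
  unfolding precedes_def by (cases k1; cases k2) (auto simp: Let_def)

lemma min_max_eq_imp:
  "min a b = min c d \<Longrightarrow> max a b = max c d \<Longrightarrow> a = c \<and> b = d \<or> a = d \<and> b = (c :: nat)"
  by (auto simp: min_def max_def split: if_splits)

text \<open>If neither collision precedes the other, both have the same winner and loser priorities,
  hence the same pair of particles. Different junctions have different pairs of neighbours, since
  each junction lies to the right of its predecessor.\<close>

lemma coll_total:
  assumes \<Gamma>: "\<Gamma> \<subseteq> {2..n}" and \<psi>: "\<psi> permutes {1..n}" and prio: "inj_on prio {1..n}"
    and g: "g \<in> {2..n}" "g' \<in> {2..n}" "g \<noteq> g'"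
  shows "precedes prio m (coll n \<Gamma> \<psi> g) (coll n \<Gamma> \<psi> g') \<or> precedes prio m (coll n \<Gamma> \<psi> g') (coll n \<Gamma> \<psi> g)"
proof (rule ccontr)
  let ?p = "\<psi> (prv \<Gamma> g)" and ?q = "\<psi> g" and ?p' = "\<psi> (prv \<Gamma> g')" and ?q' = "\<psi> g'"
  assume "\<not> ?thesis"
  then have "min (prio ?p) (prio ?q) = min (prio ?p') (prio ?q')"
    "max (prio ?p) (prio ?q) = max (prio ?p') (prio ?q')"
    unfolding coll_def precedes_def by (auto simp: Let_def)
  then have pq: "prio ?p = prio ?p' \<and> prio ?q = prio ?q' \<or> prio ?p = prio ?q' \<and> prio ?q = prio ?p'"
    by (rule min_max_eq_imp)
  have a: "prv \<Gamma> g \<in> {1..n}" "prv \<Gamma> g < g" "prv \<Gamma> g' \<in> {1..n}" "prv \<Gamma> g' < g'" "g \<in> {1..n}" "g' \<in> {1..n}"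
    using prv_props[OF \<Gamma>, of g] prv_props[OF \<Gamma>, of g'] g by auto
  have "inj_on (prio \<circ> \<psi>) {1..n}"
    using prio permutes_inj_on[OF \<psi>] permutes_image[OF \<psi>] by (intro comp_inj_on) auto
  then have "prio (\<psi> k) = prio (\<psi> l) \<Longrightarrow> k \<in> {1..n} \<Longrightarrow> l \<in> {1..n} \<Longrightarrow> k = l" for k l
    by (metis comp_apply inj_onD)
  then have "g = g' \<or> prv \<Gamma> g = g' \<and> g = prv \<Gamma> g'" using pq a by blast
  then show False using a g by auto
qed

lemma finite_strict_total_least:
  assumes "finite C" "C \<noteq> {}"
    and "\<And>x y z. R x y \<Longrightarrow> R y z \<Longrightarrow> R x z"
    and "\<And>x y. x \<in> C \<Longrightarrow> y \<in> C \<Longrightarrow> x \<noteq> y \<Longrightarrow> R x y \<or> R y x"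
  shows "\<exists>x\<in>C. \<forall>y\<in>C. y \<noteq> x \<longrightarrow> R x y"
  using assms(1,2,4)
proof (induction C rule: finite_ne_induct)
  case (insert a C)
  then obtain x where x: "x \<in> C" "\<forall>y\<in>C. y \<noteq> x \<longrightarrow> R x y" by auto
  have "R a x \<or> R x a" using insert x by (metis insertCI)
  then show ?case
  proof
    assume "R a x"
    then show ?thesis using x assms(3) by (intro bexI[of _ a]) auto
  next
    assume "R x a"
    then show ?thesis using x by (intro bexI[of _ x]) auto
  qed
qed auto

lemma is_next_unique: "is_next n prio m \<Gamma> \<psi> g \<Longrightarrow> is_next n prio m \<Gamma> \<psi> g' \<Longrightarrow> g = g'"
  unfolding is_next_def using precedes_asym by metis

lemma is_next_exists:
  assumes "\<Gamma> \<subseteq> {2..n}" "\<psi> permutes {1..n}" "inj_on prio {1..n}" "pending n m \<Gamma> \<psi> \<noteq> {}"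
  obtains g where "is_next n prio m \<Gamma> \<psi> g"
proof -
  have "\<exists>g\<in>pending n m \<Gamma> \<psi>. \<forall>g'\<in>pending n m \<Gamma> \<psi>. g' \<noteq> g \<longrightarrow>
      precedes prio m (coll n \<Gamma> \<psi> g) (coll n \<Gamma> \<psi> g')"
  proof (rule finite_strict_total_least[where R = "\<lambda>g g'. precedes prio m (coll n \<Gamma> \<psi> g) (coll n \<Gamma> \<psi> g')"])
    show "finite (pending n m \<Gamma> \<psi>)" by (auto simp: pending_def)
  qed (use assms coll_total precedes_trans in \<open>auto simp: pending_def\<close>)
  then show ?thesis using that by (auto simp: is_next_def)
qed

section \<open>One collision in terms of ghosts and holders\<close>

lemma merge_states:
  assumes "\<Gamma> \<subseteq> {2..n}" "\<psi> permutes {1..n}" "g \<in> {2..n}"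
  shows "merge prio \<Gamma> \<psi> g \<in> states n"
proof -
  have "\<psi> \<circ> transpose (prv \<Gamma> g) g permutes {1..n}"
    using assms prv_props[OF assms(1), of g] by (intro permutes_compose permutes_swap_id) auto
  then show ?thesis using assms by (auto simp: merge_def states_def)
qed

lemma collisions_conf:
  assumes \<Gamma>: "\<Gamma> \<subseteq> {2..n}"
  shows "collisions m (fst (conf n \<Gamma> \<psi>)) = coll n \<Gamma> \<psi> ` pending n m \<Gamma> \<psi>"
proof (intro set_eqI iffI)
  fix k assume "k \<in> collisions m (fst (conf n \<Gamma> \<psi>))"
  then obtain a g where k: "k = (\<psi> a, a, g, \<psi> g, nxt n \<Gamma> g)" "a \<in> {1..n} - \<Gamma>" "g \<in> {1..n} - \<Gamma>"
    "nxt n \<Gamma> a = g" "m (\<psi> a) (\<psi> g) < \<infinity>"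
    by (auto simp: collisions_def conf_def)
  then have "prv \<Gamma> g = a" "a < g" using prv_nxt[OF \<Gamma>, of a] nxt_props[OF \<Gamma>, of a] by auto
  then show "k \<in> coll n \<Gamma> \<psi> ` pending n m \<Gamma> \<psi>"
    using k by (intro image_eqI[of _ _ g]) (auto simp: coll_def pending_def meet_def)
next
  fix k assume "k \<in> coll n \<Gamma> \<psi> ` pending n m \<Gamma> \<psi>"
  then obtain g where g: "k = coll n \<Gamma> \<psi> g" "g \<in> {2..n} - \<Gamma>" "meet m \<Gamma> \<psi> g < \<infinity>"
    by (auto simp: pending_def)
  then show "k \<in> collisions m (fst (conf n \<Gamma> \<psi>))"
    using prv_props[OF \<Gamma>, of g] nxt_prv[OF \<Gamma>, of g]
    by (auto simp: coll_def meet_def collisions_def conf_def image_iff)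
qed

lemma nxt_insert:
  assumes \<Gamma>: "\<Gamma> \<subseteq> {2..n}" and g: "g \<in> {2..n} - \<Gamma>" and b: "b \<in> {1..n} - \<Gamma>" "b \<noteq> g"
  shows "nxt n (insert g \<Gamma>) b = (if b = prv \<Gamma> g then nxt n \<Gamma> g else nxt n \<Gamma> b)"
proof -
  note g' = nxt_props[OF \<Gamma>, of g] prv_props[OF \<Gamma>, of g] nxt_prv[OF \<Gamma>, of g]
  note b' = nxt_props[OF \<Gamma>, of b] prv_nxt[OF \<Gamma>, of b]
  have lb: "c \<in> \<Gamma>" if "b < c" "c < nxt n \<Gamma> b" for c
    using that nxt_least[OF \<Gamma>, of b c] b b' by force
  have lg: "c \<in> \<Gamma>" if "g < c" "c < nxt n \<Gamma> g" for c
    using that nxt_least[OF \<Gamma>, of g c] g g' by force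
  show ?thesis
  proof (cases "b = prv \<Gamma> g")
    case True
    have "nxt n (insert g \<Gamma>) b = nxt n \<Gamma> g"
    proof (rule nxt_eqI)
      show "c \<in> insert g \<Gamma>" if "b < c" "c < nxt n \<Gamma> g" for c
        using that lb[of c] lg[of c] g g' True by (cases c g rule: linorder_cases) auto
    qed (use g g' True in auto)
    then show ?thesis using True by simp
  next
    case False
    have "nxt n \<Gamma> b \<noteq> g" using False b b' by auto
    then have "nxt n (insert g \<Gamma>) b = nxt n \<Gamma> b"
      using b b' lb by (intro nxt_eqI) auto
    then show ?thesis using False by simp
  qed
qed

lemma prv_insert:
  assumes \<Gamma>: "\<Gamma> \<subseteq> {2..n}" and g: "g \<in> {2..n} - \<Gamma>" and b: "2 \<le> b"
  shows "prv (insert g \<Gamma>) b = (if prv \<Gamma> b = g then prv \<Gamma> g else prv \<Gamma> b)"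
proof -
  note g' = prv_props[OF \<Gamma>, of g]
  note b' = prv_props[OF \<Gamma>, of b]
  have lb: "c \<in> \<Gamma>" if "prv \<Gamma> b < c" "c < b" for c
    using that prv_greatest[OF \<Gamma> b, of c] prv_props(1)[OF \<Gamma> b] by (cases "c \<in> \<Gamma>") auto
  have lg: "c \<in> \<Gamma>" if "prv \<Gamma> g < c" "c < g" for c
    using that prv_greatest[OF \<Gamma>, of g c] prv_props(1)[OF \<Gamma>, of g] g by (cases "c \<in> \<Gamma>") auto
  show ?thesis
  proof (cases "prv \<Gamma> b = g")
    case True
    have "prv (insert g \<Gamma>) b = prv \<Gamma> g"
    proof (rule prv_eqI)
      show "c \<in> insert g \<Gamma>" if "prv \<Gamma> g < c" "c < b" for c
        using that lb[of c] lg[of c] True by (cases c g rule: linorder_cases) auto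
    qed (use g g' b b' True in auto)
    then show ?thesis using True by simp
  next
    case False
    then have "prv (insert g \<Gamma>) b = prv \<Gamma> b"
      using b b' lb by (intro prv_eqI) auto
    then show ?thesis using False by simp
  qed
qed

lemma collide_conf_stuck:
  assumes "\<Gamma> \<subseteq> {2..n}" "pending n m \<Gamma> \<psi> = {}"
  shows "collide prio m (conf n \<Gamma> \<psi>) = conf n \<Gamma> \<psi>"
  using collisions_conf[OF assms(1), of m \<psi>] assms(2)
  by (cases "conf n \<Gamma> \<psi>") (simp add: collide_def)

lemma collide_conf:
  assumes \<Gamma>: "\<Gamma> \<subseteq> {2..n}" and \<psi>: "\<psi> permutes {1..n}" and nx: "is_next n prio m \<Gamma> \<psi> g"
  shows "collide prio m (conf n \<Gamma> \<psi>) = conf n (fst (merge prio \<Gamma> \<psi> g)) (snd (merge prio \<Gamma> \<psi> g))"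
proof -
  define a where "a = prv \<Gamma> g"
  define S where "S = (\<lambda>b. (\<psi> b, b, nxt n \<Gamma> b)) ` ({1..n} - \<Gamma>)"
  define D where "D = (\<lambda>h. if h \<in> \<Gamma> then Some (\<psi> h) else None)"
  define \<psi>' where "\<psi>' = snd (merge prio \<Gamma> \<psi> g)"
  have conf: "conf n \<Gamma> \<psi> = (S, D)" by (simp add: conf_def S_def D_def)
  have g: "g \<in> {2..n} - \<Gamma>" using nx by (auto simp: is_next_def pending_def)
  have a: "1 \<le> a" "a < g" "a \<notin> \<Gamma>" "nxt n \<Gamma> a = g"
    using prv_props[OF \<Gamma>, of g] nxt_prv[OF \<Gamma>, of g] g by (auto simp: a_def)
  have coll: "collisions m S = coll n \<Gamma> \<psi> ` pending n m \<Gamma> \<psi>"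
    using collisions_conf[OF \<Gamma>, of m \<psi>] by (simp add: conf)
  have next': "next_collision prio m S = (\<psi> a, a, g, \<psi> g, nxt n \<Gamma> g)"
  proof -
    have "next_collision prio m S = coll n \<Gamma> \<psi> g"
      unfolding next_collision_def coll
    proof (rule the_equality)
      show "coll n \<Gamma> \<psi> g \<in> coll n \<Gamma> \<psi> ` pending n m \<Gamma> \<psi> \<and>
        (\<forall>k'\<in>coll n \<Gamma> \<psi> ` pending n m \<Gamma> \<psi>. k' \<noteq> coll n \<Gamma> \<psi> g \<longrightarrow> precedes prio m (coll n \<Gamma> \<psi> g) k')"
        using nx by (auto simp: is_next_def)
      fix k assume k: "k \<in> coll n \<Gamma> \<psi> ` pending n m \<Gamma> \<psi> \<and>
        (\<forall>k'\<in>coll n \<Gamma> \<psi> ` pending n m \<Gamma> \<psi>. k' \<noteq> k \<longrightarrow> precedes prio m k k')"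
      then obtain g' where g': "k = coll n \<Gamma> \<psi> g'" "g' \<in> pending n m \<Gamma> \<psi>" by auto
      have inj: "coll n \<Gamma> \<psi> h = coll n \<Gamma> \<psi> h' \<Longrightarrow> h = h'" for h h' by (simp add: coll_def)
      have "is_next n prio m \<Gamma> \<psi> g'" using k g' inj unfolding is_next_def by blast
      then show "k = coll n \<Gamma> \<psi> g" using is_next_unique[OF nx] g' by simp
    qed
    then show ?thesis by (simp add: coll_def a_def)
  qed
  have ne: "collisions m S \<noteq> {}" using coll nx by (auto simp: is_next_def)
  have \<psi>'_other: "\<psi>' b = \<psi> b" if "b \<noteq> a" "b \<noteq> g" for b
    using that by (simp add: \<psi>'_def merge_def a_def)
  have \<psi>'_a: "\<psi>' a = (if prio (\<psi> a) < prio (\<psi> g) then \<psi> a else \<psi> g)"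
   and \<psi>'_g: "\<psi>' g = (if prio (\<psi> a) < prio (\<psi> g) then \<psi> g else \<psi> a)"
    by (auto simp: \<psi>'_def merge_def a_def)
  have fst_eq: "S - {(\<psi> a, a, g), (\<psi> g, g, nxt n \<Gamma> g)} \<union> {(\<psi>' a, a, nxt n \<Gamma> g)} =
    (\<lambda>b. (\<psi>' b, b, nxt n (insert g \<Gamma>) b)) ` ({1..n} - insert g \<Gamma>)" (is "?L = ?R")
  proof -
    have "S - {(\<psi> a, a, g), (\<psi> g, g, nxt n \<Gamma> g)} = (\<lambda>b. (\<psi> b, b, nxt n \<Gamma> b)) ` ({1..n} - \<Gamma> - {a, g})"
      using a unfolding S_def by auto
    also have "\<dots> = (\<lambda>b. (\<psi>' b, b, nxt n (insert g \<Gamma>) b)) ` ({1..n} - \<Gamma> - {a, g})"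
      using \<psi>'_other nxt_insert[OF \<Gamma> g] by (intro image_cong) (auto simp: a_def)
    finally have "?L = (\<lambda>b. (\<psi>' b, b, nxt n (insert g \<Gamma>) b)) ` ({1..n} - \<Gamma> - {a, g}) \<union>
        {(\<psi>' a, a, nxt n (insert g \<Gamma>) a)}"
      using nxt_insert[OF \<Gamma> g, of a] a g by (simp add: a_def)
    also have "(\<lambda>b. (\<psi>' b, b, nxt n (insert g \<Gamma>) b)) ` ({1..n} - \<Gamma> - {a, g}) \<union> {(\<psi>' a, a, nxt n (insert g \<Gamma>) a)} = ?R"
    proof -
      have "{1..n} - insert g \<Gamma> = insert a ({1..n} - \<Gamma> - {a, g})" using a g by auto
      then show ?thesis by simp
    qed
    finally show ?thesis .
  qed
  have snd_eq: "D(g \<mapsto> \<psi>' g) = (\<lambda>h. if h \<in> insert g \<Gamma> then Some (\<psi>' h) else None)"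
  proof
    fix h
    have "h \<in> \<Gamma> \<Longrightarrow> h \<noteq> a" using a by auto
    then show "(D(g \<mapsto> \<psi>' g)) h = (if h \<in> insert g \<Gamma> then Some (\<psi>' h) else None)"
      using \<psi>'_other[of h] by (simp add: D_def)
  qed
  have "collide prio m (S, D) =
     (S - {(\<psi> a, a, g), (\<psi> g, g, nxt n \<Gamma> g)} \<union> {(\<psi>' a, a, nxt n \<Gamma> g)}, D(g \<mapsto> \<psi>' g))"
    using ne by (simp add: collide_def next' Let_def \<psi>'_a \<psi>'_g)
  also have "\<dots> = conf n (insert g \<Gamma>) \<psi>'"
    unfolding fst_eq snd_eq by (simp add: conf_def)
  finally show ?thesis by (simp add: conf \<psi>'_def[symmetric]) (simp add: merge_def)
qed

definition step ::
    "nat \<Rightarrow> (nat \<Rightarrow> nat) \<Rightarrow> (nat \<Rightarrow> nat \<Rightarrow> ereal) \<Rightarrow>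
      nat set \<times> (nat \<Rightarrow> nat) \<Rightarrow> nat set \<times> (nat \<Rightarrow> nat)" where
  "step n prio m = (\<lambda>(\<Gamma>, \<psi>). if pending n m \<Gamma> \<psi> = {} then (\<Gamma>, \<psi>)
     else merge prio \<Gamma> \<psi> (THE g. is_next n prio m \<Gamma> \<psi> g))"

definition run ::
    "nat \<Rightarrow> (nat \<Rightarrow> nat) \<Rightarrow> (nat \<Rightarrow> nat \<Rightarrow> ereal) \<Rightarrow> nat \<Rightarrow> nat set \<times> (nat \<Rightarrow> nat)" where
  "run n prio m i = (step n prio m ^^ i) ({}, id)"

lemma step_next: "is_next n prio m \<Gamma> \<psi> g \<Longrightarrow> step n prio m (\<Gamma>, \<psi>) = merge prio \<Gamma> \<psi> g"
  using the_equality[of "is_next n prio m \<Gamma> \<psi>" g, OF _ is_next_unique]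
  unfolding step_def by (simp, auto simp: is_next_def)

lemma step_stuck: "pending n m \<Gamma> \<psi> = {} \<Longrightarrow> step n prio m (\<Gamma>, \<psi>) = (\<Gamma>, \<psi>)"
  by (simp add: step_def)

lemma run_0 [simp]: "run n prio m 0 = ({}, id)"
  and run_Suc [simp]: "run n prio m (Suc i) = step n prio m (run n prio m i)"
  by (simp_all add: run_def)

text \<open>Each interval is carried by one of the particles it has absorbed. So the active
  particles are ordered by number as their intervals are, which brings in the order of the starting
  points.\<close>

definition located :: "nat \<Rightarrow> nat set \<Rightarrow> (nat \<Rightarrow> nat) \<Rightarrow> bool" where
  "located n \<Gamma> \<psi> \<longleftrightarrow> (\<forall>a\<in>{1..n} - \<Gamma>. a \<le> \<psi> a \<and> \<psi> a < nxt n \<Gamma> a)"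

lemma located_merge:
  assumes \<Gamma>: "\<Gamma> \<subseteq> {2..n}" and g: "g \<in> {2..n} - \<Gamma>" and loc: "located n \<Gamma> \<psi>"
  shows "located n (insert g \<Gamma>) (snd (merge prio \<Gamma> \<psi> g))"
  unfolding located_def
proof
  define a where "a = prv \<Gamma> g"
  have a: "1 \<le> a" "a < g" "a \<notin> \<Gamma>" "nxt n \<Gamma> a = g"
    using prv_props[OF \<Gamma>, of g] nxt_prv[OF \<Gamma>, of g] g by (auto simp: a_def)
  have L: "b \<in> {1..n} - \<Gamma> \<Longrightarrow> b \<le> \<psi> b \<and> \<psi> b < nxt n \<Gamma> b" for b using loc by (auto simp: located_def)
  have La: "a \<le> \<psi> a" "\<psi> a < g" "g \<le> \<psi> g" "\<psi> g < nxt n \<Gamma> g"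
    using L[of a] L[of g] a g by auto
  fix b assume b: "b \<in> {1..n} - insert g \<Gamma>"
  show "b \<le> snd (merge prio \<Gamma> \<psi> g) b \<and> snd (merge prio \<Gamma> \<psi> g) b < nxt n (insert g \<Gamma>) b"
    using nxt_insert[OF \<Gamma> g, of b] b L[of b] La a
    by (cases "b = a") (auto simp: merge_def a_def[symmetric])
qed

text \<open>The last clause counts collisions: as long as the process is not stuck, every step has
  created a new ghost.\<close>

lemma run_invariant:
  assumes prio: "inj_on prio {1..n}"
  shows "run n prio m i \<in> states n \<and> located n (fst (run n prio m i)) (snd (run n prio m i)) \<and>
    (collide prio m ^^ i) (initial_config n) = conf n (fst (run n prio m i)) (snd (run n prio m i)) \<and>
    (pending n m (fst (run n prio m i)) (snd (run n prio m i)) = {} \<or> card (fst (run n prio m i)) = i)"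
proof (induction i)
  case 0
  have nxt: "nxt n {} a = Suc a" if "a \<in> {1..n}" for a using that by (intro nxt_eqI) auto
  then have "conf n {} id = initial_config n"
    by (auto simp: conf_def initial_config_def image_iff)
  moreover have "located n {} id" using nxt by (auto simp: located_def)
  moreover have "({}, id) \<in> states n" by (simp add: states_def permutes_id)
  ultimately show ?case unfolding run_0 fst_conv snd_conv funpow.simps id_apply card.empty by metis
next
  case (Suc i)
  obtain \<Gamma> \<psi> where s: "run n prio m i = (\<Gamma>, \<psi>)" by (cases "run n prio m i")
  have inv: "\<Gamma> \<subseteq> {2..n}" "\<psi> permutes {1..n}" "located n \<Gamma> \<psi>"
    "(collide prio m ^^ i) (initial_config n) = conf n \<Gamma> \<psi>" "pending n m \<Gamma> \<psi> = {} \<or> card \<Gamma> = i"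
    using Suc by (auto simp: s states_def)
  show ?case
  proof (cases "pending n m \<Gamma> \<psi> = {}")
    case True
    then show ?thesis
      using inv by (simp add: s step_stuck states_def collide_conf_stuck)
  next
    case False
    then obtain g where nx: "is_next n prio m \<Gamma> \<psi> g" using inv prio is_next_exists by metis
    have g: "g \<in> {2..n} - \<Gamma>" using nx by (auto simp: is_next_def pending_def)
    have "finite \<Gamma>" using inv(1) finite_subset by blast
    then have "card (insert g \<Gamma>) = Suc i" using inv False g by simp
    moreover have "fst (merge prio \<Gamma> \<psi> g) = insert g \<Gamma>" by (simp add: merge_def)
    ultimately show ?thesis
      using inv g nx located_merge[OF inv(1) g inv(3), of prio] merge_states[OF inv(1,2), of g prio]
        collide_conf[OF inv(1,2) nx] by (simp add: s step_next)
  qed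
qed

lemma run_terminal:
  assumes prio: "inj_on prio {1..n}"
  shows "pending n m (fst (run n prio m n)) (snd (run n prio m n)) = {}"
proof (rule ccontr)
  assume ne: "pending n m (fst (run n prio m n)) (snd (run n prio m n)) \<noteq> {}"
  then have card: "card (fst (run n prio m n)) = n" using run_invariant[OF prio, of m n] by auto
  have "fst (run n prio m n) \<subseteq> {2..n}" using run_invariant[OF prio, of m n] by (auto simp: states_def)
  then have "n \<le> n - 1" using card card_mono[of "{2..n}" "fst (run n prio m n)"] by auto
  \<comment> \<open>Subtraction is truncated, so more than \<open>n - 1\<close> ghosts are
    conceivable only for \<open>n = 0\<close>, where no junction exists.\<close>
  then have "n = 0" by simp
  then show False using ne by (auto simp: pending_def)
qed

text \<open>
  The event that \<open>i\<close> collisions occurred up to time \<open>\<tau>\<close> and led to \<open>s\<close>.  For a stopping time \<open>\<tau>\<close> it belongs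
  to the past of \<open>\<tau>\<close>, whereas the event \<open>run n prio m i = s\<close> need not.
\<close>

primrec hist ::
    "nat \<Rightarrow> (nat \<Rightarrow> nat) \<Rightarrow> (nat \<Rightarrow> nat \<Rightarrow> ereal) \<Rightarrow> ereal \<Rightarrow> nat \<Rightarrow> nat set \<times> (nat \<Rightarrow> nat) \<Rightarrow> bool" where
  "hist n prio m \<tau> 0 s \<longleftrightarrow> s = ({}, id)"
| "hist n prio m \<tau> (Suc i) s \<longleftrightarrow> (\<exists>s'\<in>states n. \<exists>g\<in>{2..n}. hist n prio m \<tau> i s' \<and>
     is_next n prio m (fst s') (snd s') g \<and> meet m (fst s') (snd s') g \<le> \<tau> \<and>
     s = merge prio (fst s') (snd s') g)"

lemma hist_mono: "hist n prio m \<tau> i s \<Longrightarrow> \<tau> \<le> \<tau>' \<Longrightarrow> hist n prio m \<tau>' i s"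
  by (induction i arbitrary: s) (force intro: order_trans)+

lemma hist_run: "hist n prio m \<tau> i s \<Longrightarrow> run n prio m i = s"
  by (induction i arbitrary: s) (auto simp: step_next)

section \<open>Meeting times and collision times along a single trajectory\<close>

lemma first_meeting_commute: "first_meeting T X \<omega> i j = first_meeting T X \<omega> j i"
  unfolding first_meeting_def by (rule arg_cong[where f = Inf]) auto

lemma first_meeting_nonneg: "0 \<le> first_meeting T X \<omega> i j"
  unfolding first_meeting_def by (auto intro!: Inf_greatest)

lemma first_meeting_le: "0 \<le> t \<Longrightarrow> t \<le> T \<Longrightarrow> X i t \<omega> = X j t \<omega> \<Longrightarrow> first_meeting T X \<omega> i j \<le> ereal t"
  unfolding first_meeting_def by (intro Inf_lower) auto

text \<open>The infimum of the empty set is \<open>\<infinity>\<close>, so a finite value is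
  witnessed by a common state within \<open>{0..T}\<close>.\<close>

lemma first_meeting_finite:
  assumes "first_meeting T X \<omega> i j < \<infinity>"
  shows "first_meeting T X \<omega> i j \<le> ereal T"
    and "ereal (real_of_ereal (first_meeting T X \<omega> i j)) = first_meeting T X \<omega> i j"
    and "0 \<le> real_of_ereal (first_meeting T X \<omega> i j)" "real_of_ereal (first_meeting T X \<omega> i j) \<le> T"
proof -
  obtain e where "e \<in> {ereal t | t. t \<in> {0..T} \<and> X i t \<omega> = X j t \<omega>}"
    using assms unfolding first_meeting_def Inf_less_iff by blast
  then obtain t where t: "t \<in> {0..T}" "X i t \<omega> = X j t \<omega>" by auto
  then have "first_meeting T X \<omega> i j \<le> ereal t" by (intro first_meeting_le) auto
  also have "\<dots> \<le> ereal T" using t by simp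
  finally show le: "first_meeting T X \<omega> i j \<le> ereal T" .
  note nn = first_meeting_nonneg[of T X \<omega> i j]
  show eq: "ereal (real_of_ereal (first_meeting T X \<omega> i j)) = first_meeting T X \<omega> i j"
    using assms nn by (cases "first_meeting T X \<omega> i j") auto
  show "0 \<le> real_of_ereal (first_meeting T X \<omega> i j)"
    using nn by (rule real_of_ereal_pos)
  show "real_of_ereal (first_meeting T X \<omega> i j) \<le> T"
    using le eq by (metis ereal_less_eq(3))
qed

text \<open>The almost sure consequences of the initial order, of (KM3) and of the attainment of the
  first meeting in (KM4), gathered so that the collisions can be analysed one trajectory at a
  time.\<close>

definition good_path :: "nat \<Rightarrow> real \<Rightarrow> (nat \<Rightarrow> real \<Rightarrow> 'w \<Rightarrow> real) \<Rightarrow> 'w \<Rightarrow> bool" where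
  "good_path n T X \<omega> \<longleftrightarrow>
     (\<forall>i\<in>{1..n}. \<forall>j\<in>{1..n}. i \<le> j \<longrightarrow> X i 0 \<omega> \<le> X j 0 \<omega>) \<and>
     (\<forall>i\<in>{1..n}. \<forall>j\<in>{1..n}. \<forall>s t. 0 \<le> s \<and> s \<le> t \<and> t \<le> T \<and> X i s \<omega> < X j s \<omega> \<and> X j t \<omega> < X i t \<omega> \<longrightarrow>
        (\<exists>u\<in>{s..t}. X i u \<omega> = X j u \<omega>)) \<and>
     (\<forall>i\<in>{1..n}. \<forall>j\<in>{1..n}. i < j \<longrightarrow> first_meeting T X \<omega> i j < \<infinity> \<longrightarrow>
        X i (real_of_ereal (first_meeting T X \<omega> i j)) \<omega> = X j (real_of_ereal (first_meeting T X \<omega> i j)) \<omega>)"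

text \<open>Equality at time 0 would already be a meeting, so the order is strict at the start, and
  (KM3) allows no later reversal without a meeting.\<close>

lemma good_path_less:
  assumes good: "good_path n T X \<omega>" and ij: "i \<in> {1..n}" "j \<in> {1..n}" "i < j"
    and t: "0 \<le> t" "t \<le> T" "ereal t < first_meeting T X \<omega> i j"
  shows "X i t \<omega> < X j t \<omega>"
proof -
  have no: "X i u \<omega> \<noteq> X j u \<omega>" if "0 \<le> u" "u \<le> t" for u
  proof
    assume "X i u \<omega> = X j u \<omega>"
    then have "first_meeting T X \<omega> i j \<le> ereal u" using that t by (intro first_meeting_le) auto
    also have "\<dots> \<le> ereal t" using that by simp
    finally show False using t by simp
  qed
  have "X i 0 \<omega> \<le> X j 0 \<omega>" using good ij by (auto simp: good_path_def)
  then have 0: "X i 0 \<omega> < X j 0 \<omega>" using no[of 0] t by simp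
  have "\<not> X j t \<omega> < X i t \<omega>"
  proof
    assume "X j t \<omega> < X i t \<omega>"
    then have "\<exists>u\<in>{0..t}. X i u \<omega> = X j u \<omega>" using good ij 0 t unfolding good_path_def by blast
    then show False using no by auto
  qed
  then show ?thesis using no[of t] t by simp
qed

text \<open>Before \<open>\<mu>\<close> the particle \<open>j\<close> stays strictly between
  \<open>i\<close> and \<open>k\<close>. As the first meeting is attained, a meeting of
  \<open>i\<close> and \<open>k\<close> before \<open>\<mu>\<close> would squeeze \<open>j\<close>
  between equal positions.\<close>

lemma first_meeting_between:
  assumes good: "good_path n T X \<omega>" and ijk: "i \<in> {1..n}" "j \<in> {1..n}" "k \<in> {1..n}" "i < j" "j < k"
    and le: "\<mu> \<le> first_meeting T X \<omega> i j" "\<mu> \<le> first_meeting T X \<omega> j k"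
  shows "\<mu> \<le> first_meeting T X \<omega> i k"
proof (rule ccontr)
  assume "\<not> ?thesis"
  then have less: "first_meeting T X \<omega> i k < \<mu>" by simp
  then have fin: "first_meeting T X \<omega> i k < \<infinity>" by (rule less_le_trans) simp
  define u where "u = real_of_ereal (first_meeting T X \<omega> i k)"
  note u = first_meeting_finite[OF fin, folded u_def]
  have eq: "X i u \<omega> = X k u \<omega>" using good ijk(1,3) less_trans[OF ijk(4,5)] fin unfolding good_path_def u_def by blast
  have "X i u \<omega> < X j u \<omega>" using ijk u less le by (intro good_path_less[OF good]) auto
  moreover have "X j u \<omega> < X k u \<omega>" using ijk u less le by (intro good_path_less[OF good]) auto
  ultimately show False using eq by simp
qed

text \<open>Collision times do not decrease. A collision may create new neighbours only beside the
  united interval, and such a pair encloses a particle that neither of them met before the current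
  time.\<close>

lemma meet_mono:
  assumes good: "good_path n T X \<omega>" and m: "m = first_meeting T X \<omega>"
    and \<Gamma>: "\<Gamma> \<subseteq> {2..n}" and \<psi>: "\<psi> permutes {1..n}" and loc: "located n \<Gamma> \<psi>"
    and nx: "is_next n prio m \<Gamma> \<psi> g" and h: "h \<in> {2..n} - insert g \<Gamma>"
    and \<psi>': "\<psi>' = snd (merge prio \<Gamma> \<psi> g)"
  shows "meet m \<Gamma> \<psi> g \<le> meet m (insert g \<Gamma>) \<psi>' h"
proof -
  define a where "a = prv \<Gamma> g"
  define \<mu> where "\<mu> = meet m \<Gamma> \<psi> g"
  have g: "g \<in> {2..n} - \<Gamma>" using nx by (auto simp: is_next_def pending_def)
  have a: "1 \<le> a" "a < g" "a \<notin> \<Gamma>" "nxt n \<Gamma> a = g"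
    using prv_props[OF \<Gamma>, of g] nxt_prv[OF \<Gamma>, of g] g by (auto simp: a_def)
  have \<mu>: "\<mu> = m (\<psi> a) (\<psi> g)" by (simp add: \<mu>_def meet_def a_def)
  have le: "\<mu> \<le> meet m \<Gamma> \<psi> k" if "k \<in> {2..n} - \<Gamma>" for k
  proof (cases "k \<in> pending n m \<Gamma> \<psi> \<and> k \<noteq> g")
    case True
    then have "precedes prio m (coll n \<Gamma> \<psi> g) (coll n \<Gamma> \<psi> k)" using nx by (auto simp: is_next_def)
    then show ?thesis by (auto simp: precedes_def coll_def \<mu>_def meet_def Let_def)
  next
    case False
    then show ?thesis using that by (auto simp: pending_def \<mu>_def)
  qed
  have \<psi>'_other: "\<psi>' b = \<psi> b" if "b \<noteq> a" "b \<noteq> g" for b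
    using that by (simp add: \<psi>' merge_def a_def)
  have \<psi>'_a: "\<psi>' a = \<psi> a \<or> \<psi>' a = \<psi> g" by (auto simp: \<psi>' merge_def a_def)
  have in': "\<psi> k \<in> {1..n}" if "k \<in> {1..n}" for k using permutes_in_image[OF \<psi>] that by blast
  have loc': "k \<le> \<psi> k" "\<psi> k < nxt n \<Gamma> k" if "1 \<le> k" "k \<le> n" "k \<notin> \<Gamma>" for k
    using loc that by (auto simp: located_def)
  have pq: "\<psi> a < \<psi> g" using loc'[of a] loc'[of g] a g by auto
  have hprv: "1 \<le> prv \<Gamma> h" "prv \<Gamma> h < h" "prv \<Gamma> h \<notin> \<Gamma>" "nxt n \<Gamma> (prv \<Gamma> h) = h"
    using prv_props[OF \<Gamma>, of h] nxt_prv[OF \<Gamma>, of h] h by auto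
  have ps: "\<psi> (prv \<Gamma> h) < \<psi> h" using loc'[of "prv \<Gamma> h"] loc'[of h] hprv h by auto
  have mh: "\<mu> \<le> m (\<psi> (prv \<Gamma> h)) (\<psi> h)" using le[of h] h by (simp add: meet_def)
  have prvh: "prv \<Gamma> h \<noteq> a" using hprv a h by auto
  have ins: "\<psi> (prv \<Gamma> h) \<in> {1..n}" "\<psi> a \<in> {1..n}" "\<psi> g \<in> {1..n}" "\<psi> h \<in> {1..n}"
    using hprv h g a by (intro in'; simp)+
  \<comment> \<open>The junction \<open>h\<close> is the left end of the united interval, its right
    end, or away from it; in the last case its two neighbours are unchanged.\<close>
  consider "h = a" | "prv \<Gamma> h = g" | "h \<noteq> a" "prv \<Gamma> h \<noteq> g" by blast
  then have "\<mu> \<le> meet m (insert g \<Gamma>) \<psi>' h"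
  proof cases
    case 1
    then have "prv \<Gamma> h \<noteq> g" using hprv a by simp
    then have "meet m (insert g \<Gamma>) \<psi>' h = m (\<psi> (prv \<Gamma> h)) (\<psi>' a)"
      using prv_insert[OF \<Gamma> g, of h] h 1 \<psi>'_other[of "prv \<Gamma> h"] prvh by (simp add: meet_def)
    moreover have "\<mu> \<le> m (\<psi> (prv \<Gamma> h)) (\<psi> g)"
      unfolding m
    proof (rule first_meeting_between[OF good])
      show "\<psi> (prv \<Gamma> h) < \<psi> a" using ps 1 by simp
      show "\<mu> \<le> first_meeting T X \<omega> (\<psi> (prv \<Gamma> h)) (\<psi> a)" using mh 1 unfolding m by simp
      show "\<mu> \<le> first_meeting T X \<omega> (\<psi> a) (\<psi> g)" using \<mu> unfolding m by simp
    qed (use ins pq in simp_all)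
    ultimately show ?thesis using \<psi>'_a mh 1 by auto
  next
    case 2
    then have "meet m (insert g \<Gamma>) \<psi>' h = m (\<psi>' a) (\<psi> h)"
      using prv_insert[OF \<Gamma> g, of h] h \<psi>'_other[of h] hprv a by (auto simp: meet_def a_def)
    moreover have "\<mu> \<le> m (\<psi> a) (\<psi> h)"
      unfolding m
    proof (rule first_meeting_between[OF good])
      show "\<psi> g < \<psi> h" using ps 2 by simp
      show "\<mu> \<le> first_meeting T X \<omega> (\<psi> g) (\<psi> h)" using mh 2 unfolding m by simp
      show "\<mu> \<le> first_meeting T X \<omega> (\<psi> a) (\<psi> g)" using \<mu> unfolding m by simp
    qed (use ins pq in simp_all)
    ultimately show ?thesis using \<psi>'_a mh 2 by auto
  next
    case 3
    then have "meet m (insert g \<Gamma>) \<psi>' h = meet m \<Gamma> \<psi> h"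
      using prv_insert[OF \<Gamma> g, of h] h \<psi>'_other prvh by (simp add: meet_def)
    then show ?thesis using le h by simp
  qed
  then show ?thesis by (simp add: \<mu>_def)
qed

text \<open>Earlier collisions happened no later than the next one by \<open>meet_mono\<close>, so
  the stage reached by the run is already determined at the time of the next collision.\<close>

lemma run_hist:
  assumes good: "good_path n T X \<omega>" and m: "m = first_meeting T X \<omega>" and prio: "inj_on prio {1..n}"
  shows "is_next n prio m (fst (run n prio m i)) (snd (run n prio m i)) g \<Longrightarrow>
    hist n prio m (meet m (fst (run n prio m i)) (snd (run n prio m i)) g) i (run n prio m i)"
proof (induction i arbitrary: g)
  case (Suc i)
  obtain \<Gamma> \<psi> where s: "run n prio m i = (\<Gamma>, \<psi>)" by (cases "run n prio m i")
  have inv: "\<Gamma> \<subseteq> {2..n}" "\<psi> permutes {1..n}" "located n \<Gamma> \<psi>"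
    using run_invariant[OF prio, of m i] by (auto simp: s states_def)
  have ne: "pending n m \<Gamma> \<psi> \<noteq> {}"
  proof
    assume "pending n m \<Gamma> \<psi> = {}"
    then show False using Suc.prems by (simp add: s step_stuck is_next_def)
  qed
  then obtain g0 where nx: "is_next n prio m \<Gamma> \<psi> g0" using inv prio is_next_exists by metis
  have run: "run n prio m (Suc i) = merge prio \<Gamma> \<psi> g0" using nx by (simp add: s step_next)
  have fst: "fst (merge prio \<Gamma> \<psi> g0) = insert g0 \<Gamma>" by (simp add: merge_def)
  have g: "g \<in> {2..n} - insert g0 \<Gamma>"
    using Suc.prems unfolding run by (auto simp: fst is_next_def pending_def)
  have le: "meet m \<Gamma> \<psi> g0 \<le> meet m (insert g0 \<Gamma>) (snd (merge prio \<Gamma> \<psi> g0)) g"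
    by (rule meet_mono[OF good m inv nx g refl])
  have "hist n prio m (meet m \<Gamma> \<psi> g0) i (\<Gamma>, \<psi>)" using Suc.IH[of g0] nx by (simp add: s)
  then have "hist n prio m (meet m (insert g0 \<Gamma>) (snd (merge prio \<Gamma> \<psi> g0)) g) i (\<Gamma>, \<psi>)"
    using le by (rule hist_mono)
  moreover have "g0 \<in> {2..n}" using nx by (auto simp: is_next_def pending_def)
  ultimately show ?case
    unfolding run fst hist.simps using inv nx le
    by (intro bexI[of _ "(\<Gamma>, \<psi>)"] bexI[of _ g0]) (auto simp: states_def)
qed simp

text \<open>Neighbouring active particles never met up to \<open>T\<close>, so they are strictly
  ordered there; chaining neighbours gives the claim.\<close>

lemma terminal_strict_mono:
  assumes good: "good_path n T X \<omega>" and m: "m = first_meeting T X \<omega>" and T: "0 \<le> T"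
    and \<Gamma>: "\<Gamma> \<subseteq> {2..n}" and \<psi>: "\<psi> permutes {1..n}" and loc: "located n \<Gamma> \<psi>"
    and stuck: "pending n m \<Gamma> \<psi> = {}"
  shows "strict_mono_on ({1..n} - \<Gamma>) (\<lambda>k. X (\<psi> k) T \<omega>)"
proof (rule strict_mono_onI)
  have in': "\<psi> k \<in> {1..n}" if "k \<in> {1..n}" for k using permutes_in_image[OF \<psi>] that by blast
  have adj: "X (\<psi> (prv \<Gamma> g)) T \<omega> < X (\<psi> g) T \<omega>" if g: "g \<in> {2..n} - \<Gamma>" for g
  proof (rule good_path_less[OF good])
    have p: "1 \<le> prv \<Gamma> g" "prv \<Gamma> g < g" "prv \<Gamma> g \<notin> \<Gamma>" "nxt n \<Gamma> (prv \<Gamma> g) = g"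
      using prv_props[OF \<Gamma>, of g] nxt_prv[OF \<Gamma>, of g] g by auto
    then show "\<psi> (prv \<Gamma> g) \<in> {1..n}" "\<psi> g \<in> {1..n}" using g by (intro in'; simp)+
    have "prv \<Gamma> g \<in> {1..n} - \<Gamma>" "g \<in> {1..n} - \<Gamma>" using p g by auto
    then have "\<psi> (prv \<Gamma> g) < g" "g \<le> \<psi> g" using loc p(4) unfolding located_def by metis+
    then show "\<psi> (prv \<Gamma> g) < \<psi> g" by simp
    have "meet m \<Gamma> \<psi> g = \<infinity>" using stuck g by (auto simp: pending_def)
    then show "ereal T < first_meeting T X \<omega> (\<psi> (prv \<Gamma> g)) (\<psi> g)" by (simp add: meet_def m)
  qed (use T in auto)
  show "X (\<psi> a) T \<omega> < X (\<psi> b) T \<omega>" if "a \<in> {1..n} - \<Gamma>" "b \<in> {1..n} - \<Gamma>" "a < b" for a b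
    using that
  proof (induction b rule: less_induct)
    case (less b)
    then have b: "b \<in> {2..n} - \<Gamma>" by auto
    have p: "1 \<le> prv \<Gamma> b" "prv \<Gamma> b < b" "prv \<Gamma> b \<notin> \<Gamma>" "a \<le> prv \<Gamma> b"
      using prv_props[OF \<Gamma>, of b] prv_greatest[OF \<Gamma>, of b a] less.prems b by auto
    show ?case
    proof (cases "a = prv \<Gamma> b")
      case True
      then show ?thesis using adj[OF b] by simp
    next
      case False
      then have "X (\<psi> a) T \<omega> < X (\<psi> (prv \<Gamma> b)) T \<omega>"
        using p less.prems b by (intro less.IH) auto
      then show ?thesis using adj[OF b] by simp
    qed
  qed
qed


section \<open>Coding of labels\<close>

fun code :: "label \<Rightarrow> nat" where
  "code (Intv a b) = a"
| "code (Junc g) = g"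

lemma code_actor [simp]: "code (actor j) = j"
  by (simp add: actor_def)

context pattern
begin

definition decode :: "nat \<Rightarrow> label" where
  "decode k = (if k \<in> G then Junc k else Intv k (nxt n G k))"

lemma code_decode [simp]: "code (decode k) = k"
  by (simp add: decode_def)

text \<open>An end that belongs to \<open>G\<close> could be moved outwards without enclosing a
  junction outside \<open>G\<close>, so maximality forces both ends out of \<open>G\<close>, and
  everything strictly inside lies in \<open>G\<close>.\<close>

lemma heirs_eq: "heirs n G = (\<lambda>a. Intv a (nxt n G a)) ` ({1..n} - G)"
proof (intro set_eqI iffI)
  fix H assume "H \<in> heirs n G"
  then obtain a b where H: "H = Intv a b" and un: "uncut n G a b"
    and mx: "\<And>a' b'. uncut n G a' b' \<Longrightarrow> a' \<le> a \<Longrightarrow> b \<le> b' \<Longrightarrow> a' = a \<and> b' = b"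
    by (auto simp: heirs_def)
  have ab: "1 \<le> a" "a < b" "b \<le> n + 1" and cut: "\<And>g. g \<in> {2..n} - G \<Longrightarrow> \<not> (a < g \<and> g < b)"
    using un by (auto simp: uncut_def junctions_def)
  have aG: "a \<notin> G"
  proof
    assume a: "a \<in> G"
    have "\<not> (a - 1 < g \<and> g < b)" if "g \<in> {2..n} - G" for g
      using cut[OF that] a that by (cases "g = a") auto
    then have "uncut n G (a - 1) b" using ab a G by (auto simp: uncut_def junctions_def)
    then show False using mx[of "a - 1" b] ab by auto
  qed
  have bG: "b \<notin> G"
  proof
    assume b: "b \<in> G"
    have "\<not> (a < g \<and> g < b + 1)" if "g \<in> {2..n} - G" for g
      using cut[OF that] b that by (cases "g = b") auto
    then have "uncut n G a (b + 1)" using ab b G by (auto simp: uncut_def junctions_def)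
    then show False using mx[of a "b + 1"] ab by auto
  qed
  have "c \<in> G" if "a < c" "c < b" for c using cut[of c] that ab by auto
  then have "nxt n G a = b" using ab bG by (intro nxt_eqI) auto
  then show "H \<in> (\<lambda>a. Intv a (nxt n G a)) ` ({1..n} - G)" using H ab aG by auto
next
  fix H assume "H \<in> (\<lambda>a. Intv a (nxt n G a)) ` ({1..n} - G)"
  then obtain a where H: "H = Intv a (nxt n G a)" and a: "1 \<le> a" "a \<le> n" "a \<notin> G" by auto
  note p = nxt_props[OF G a(2)]
  have "uncut n G a (nxt n G a)"
    using a p nxt_least[OF G a(2)] by (force simp: uncut_def junctions_def)
  moreover have "a' = a \<and> b' = nxt n G a" if un: "uncut n G a' b'" and le: "a' \<le> a" "nxt n G a \<le> b'" for a' b'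
  proof -
    have cut: "\<And>g. g \<in> {2..n} - G \<Longrightarrow> \<not> (a' < g \<and> g < b')" and b': "b' \<le> n + 1" "1 \<le> a'"
      using un by (auto simp: uncut_def junctions_def)
    have "\<not> a' < a"
    proof
      assume lt: "a' < a"
      then have "a \<in> {2..n} - G" using a b' by auto
      from cut[OF this] show False using p le lt by simp
    qed
    moreover have "\<not> nxt n G a < b'"
    proof
      assume lt: "nxt n G a < b'"
      then have "nxt n G a \<in> {2..n} - G" using a p b' by auto
      from cut[OF this] show False using p le lt by simp
    qed
    ultimately show ?thesis using le by auto
  qed
  ultimately show "H \<in> heirs n G" unfolding heirs_def H by blast
qed

lemma roles_eq: "roles n G = decode ` {1..n}"
proof -
  have "decode ` {1..n} = decode ` ({1..n} - G) \<union> decode ` G" using G by auto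
  then show ?thesis by (auto simp: roles_def heirs_eq decode_def)
qed

lemma decode_code: "f \<in> roles n G \<Longrightarrow> decode (code f) = f"
  by (auto simp: roles_eq)

lemma code_roles: "f \<in> roles n G \<Longrightarrow> code f \<in> {1..n}"
  by (auto simp: roles_eq)

lemma heir_eq:
  assumes g: "g \<in> G"
  shows "heir n G g = decode (prv G g)"
proof -
  have g': "2 \<le> g" "g \<le> n" using g G by auto
  note p = prv_props[OF G g'(1)]
  have q: "prv G g \<le> n" using p g' by simp
  note nx = nxt_props[OF G q]
  have gt: "g < nxt n G (prv G g)"
  proof (rule ccontr)
    assume "\<not> ?thesis"
    then have "nxt n G (prv G g) < g" using nx g by (cases "nxt n G (prv G g) = g") auto
    then have "nxt n G (prv G g) \<le> prv G g" using nx p by (intro prv_greatest[OF G g'(1)]) auto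
    then show False using nx by simp
  qed
  have "heir n G g = Intv (prv G g) (nxt n G (prv G g))"
    unfolding heir_def
  proof (rule the_equality)
    show "Intv (prv G g) (nxt n G (prv G g)) \<in> heirs n G \<and>
      (\<exists>a b. Intv (prv G g) (nxt n G (prv G g)) = Intv a b \<and> a < g \<and> g < b)"
      using p q gt by (auto simp: heirs_eq)
    fix H assume "H \<in> heirs n G \<and> (\<exists>a b. H = Intv a b \<and> a < g \<and> g < b)"
    then obtain a where a: "H = Intv a (nxt n G a)" "a \<in> {1..n} - G" "a < g" "g < nxt n G a"
      by (auto simp: heirs_eq)
    have "a \<le> prv G g" using a by (intro prv_greatest[OF G g'(1)]) auto
    moreover have "\<not> a < prv G g"
    proof
      assume "a < prv G g"
      then have "nxt n G a \<le> prv G g" using a p q by (intro nxt_least[OF G]) auto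
      then show False using a p by simp
    qed
    ultimately show "H = Intv (prv G g) (nxt n G (prv G g))" using a by simp
  qed
  then show ?thesis using p by (simp add: decode_def)
qed

text \<open>An heir that starts before the ghost \<open>l\<close> either ends by \<open>l\<close> or
  contains it, and only the heir coded by \<open>prv G l\<close> contains it. This is the one place
  where label order and order of codes disagree.\<close>

lemma nxt_le_iff:
  assumes "k \<in> {1..n} - G" "l \<in> G"
  shows "nxt n G k \<le> l \<longleftrightarrow> k < l \<and> k \<noteq> prv G l"
proof -
  have l: "2 \<le> l" "l \<le> n" using assms G by auto
  note p = prv_props[OF G l(1)]
  have kn: "k \<le> n" using assms by simp
  note nx = nxt_props[OF G kn]
  show ?thesis
  proof
    assume le: "nxt n G k \<le> l"
    have "nxt n G k \<le> prv G l"
    proof (rule prv_greatest[OF G l(1)])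
      show "nxt n G k < l" using le nx assms by (cases "nxt n G k = l") auto
    qed (use nx assms in auto)
    then show "k < l \<and> k \<noteq> prv G l" using nx le by auto
  next
    assume kl: "k < l \<and> k \<noteq> prv G l"
    then have "k \<le> prv G l" using assms by (intro prv_greatest[OF G l(1)]) auto
    then have "nxt n G k \<le> prv G l" using p kl l by (intro nxt_least[OF G kn]) auto
    then show "nxt n G k \<le> l" using p by simp
  qed
qed

lemma lab_less_eps_decode:
  assumes k: "k \<in> {1..n}" and l: "l \<in> {1..n}"
  shows "lab_less_eps n G \<epsilon> (decode k) (decode l) \<longleftrightarrow> before_eps k l"
proof -
  have h: "heir n G g = Intv (prv G g) (nxt n G (prv G g))" "prv G g \<notin> G" "prv G g < g" if "g \<in> G" for g
    using that heir_eq[OF that] prv_props[OF G, of g] G by (force simp: decode_def)+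
  have e: "\<epsilon> g = 1 \<longleftrightarrow> \<epsilon> g \<noteq> -1" if "g \<in> G" for g using eps[OF that] by auto
  consider "k \<in> G" "l \<in> G" | "k \<in> G" "l \<notin> G" | "k \<notin> G" "l \<in> G" | "k \<notin> G" "l \<notin> G" by blast
  then show ?thesis
  proof cases
    case 1
    then show ?thesis using h[of k] h[of l] by (auto simp: lab_less_eps_def decode_def before_eps_def h)
  next
    case 2
    then have "k \<noteq> l" by auto
    then show ?thesis using 2 h[of k] by (auto simp: lab_less_eps_def decode_def before_eps_def h)
  next
    case 3
    then show ?thesis using h[of l] e[of l] nxt_le_iff[of k l] k
      by (auto simp: lab_less_eps_def decode_def before_eps_def h)
  next
    case 4
    have "nxt n G k \<le> l \<longleftrightarrow> k < l"
      using nxt_props[OF G, of k] nxt_least[OF G, of k l] 4 k l by auto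
    then show ?thesis using 4 by (auto simp: lab_less_eps_def decode_def before_eps_def h)
  qed
qed

section \<open>Candidate bijections as permutations of codes\<close>

definition to_cand :: "(nat \<Rightarrow> nat) \<Rightarrow> label \<Rightarrow> label" where
  "to_cand \<rho> = (\<lambda>I\<in>actors n. decode (inv \<rho> (code I)))"

text \<open>Inverse of \<open>to_cand\<close>; fixing all numbers outside \<open>{1..n}\<close>
  makes it a permutation in the sense of \<open>permutes\<close>.\<close>

definition of_cand :: "(label \<Rightarrow> label) \<Rightarrow> nat \<Rightarrow> nat" where
  "of_cand \<pi> = (\<lambda>k. if k \<in> {1..n} then code (inv_into (actors n) \<pi> (decode k)) else k)"

lemma to_cand_actor:
  "\<rho> permutes {1..n} \<Longrightarrow> k \<in> {1..n} \<Longrightarrow> to_cand \<rho> (actor (\<rho> k)) = decode k"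
  using permutes_inverses[of \<rho> "{1..n}"] permutes_in_image[of \<rho> "{1..n}" k]
  by (simp add: to_cand_def actors_def)

lemma actors_image: "\<rho> permutes {1..n} \<Longrightarrow> actors n = (\<lambda>k. actor (\<rho> k)) ` {1..n}"
  unfolding actors_def using permutes_image[of \<rho> "{1..n}"] by (metis image_image)

lemma bij_to_cand:
  assumes \<rho>: "\<rho> permutes {1..n}"
  shows "bij_betw (to_cand \<rho>) (actors n) (roles n G)"
proof -
  have inj: "decode k = decode l \<longleftrightarrow> k = l" for k l by (metis code_decode)
  have "(\<lambda>k. to_cand \<rho> (actor (\<rho> k))) ` {1..n} = decode ` {1..n}"
    by (intro image_cong refl to_cand_actor[OF \<rho>])
  then show ?thesis
    unfolding actors_image[OF \<rho>] roles_eq bij_betw_def inj_on_def image_image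
    using inj by (auto simp: to_cand_actor[OF \<rho>])
qed

lemma inv_into_to_cand:
  assumes \<rho>: "\<rho> permutes {1..n}" and k: "k \<in> {1..n}"
  shows "inv_into (actors n) (to_cand \<rho>) (decode k) = actor (\<rho> k)"
  using bij_to_cand[OF \<rho>] to_cand_actor[OF \<rho> k] actors_image[OF \<rho>] k
  by (intro inv_into_f_eq) (auto simp: bij_betw_def)

lemma to_cand_candidates:
  assumes \<rho>: "\<rho> \<in> cands {}"
  shows "to_cand \<rho> \<in> candidates n G \<epsilon>"
proof -
  have perm: "\<rho> permutes {1..n}" using \<rho> by (simp add: cands_def)
  have "inv_into (actors n) (to_cand \<rho>) (Junc g) = actor (\<rho> g)" if "g \<in> G" for g
    using inv_into_to_cand[OF perm, of g] that G by (force simp: decode_def)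
  moreover have "to_cand \<rho> \<in> extensional (actors n)" by (simp add: to_cand_def)
  ultimately show ?thesis
    using \<rho> bij_to_cand[OF perm] by (auto simp: candidates_def cands_def actor_def)
qed

lemma of_cand_cands:
  assumes \<pi>: "\<pi> \<in> candidates n G \<epsilon>"
  shows "of_cand \<pi> \<in> cands {}"
proof -
  have bij: "bij_betw \<pi> (actors n) (roles n G)" using \<pi> by (simp add: candidates_def)
  have 1: "bij_betw decode {1..n} (roles n G)"
    unfolding roles_eq bij_betw_def inj_on_def by (metis code_decode)
  have 2: "bij_betw code (actors n) {1..n}"
    unfolding actors_def bij_betw_def by (auto simp: inj_on_def image_image)
  have "bij_betw (code \<circ> (inv_into (actors n) \<pi> \<circ> decode)) {1..n} {1..n}"
    using bij_betw_trans[OF bij_betw_trans[OF 1 bij_betw_inv_into[OF bij]] 2] .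
  then have "bij_betw (of_cand \<pi>) {1..n} {1..n}"
    by (rule bij_betw_cong[THEN iffD1, rotated]) (simp add: of_cand_def)
  then have perm: "of_cand \<pi> permutes {1..n}"
    by (rule bij_imp_permutes) (auto simp: of_cand_def)
  have act: "inv_into (actors n) \<pi> (Junc g) = actor (of_cand \<pi> g)" if g: "g \<in> G" for g
  proof -
    have gn: "g \<in> {1..n}" using g G by auto
    have "inv_into (actors n) \<pi> (Junc g) \<in> actors n"
      using bij g by (intro inv_into_into) (auto simp: bij_betw_def roles_def)
    then show ?thesis using gn g by (auto simp: of_cand_def decode_def actors_def)
  qed
  show ?thesis using perm \<pi> by (auto simp: cands_def candidates_def act actor_def)
qed

lemma of_to_cand: "\<rho> \<in> cands {} \<Longrightarrow> of_cand (to_cand \<rho>) = \<rho>"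
  using permutes_not_in[of \<rho> "{1..n}"]
  by (auto simp: of_cand_def fun_eq_iff cands_def inv_into_to_cand)

lemma to_of_cand:
  assumes \<pi>: "\<pi> \<in> candidates n G \<epsilon>"
  shows "to_cand (of_cand \<pi>) = \<pi>"
proof
  fix I
  have perm: "of_cand \<pi> permutes {1..n}" using of_cand_cands[OF \<pi>] by (simp add: cands_def)
  have bij: "bij_betw \<pi> (actors n) (roles n G)" and ext: "\<pi> \<in> extensional (actors n)"
    using \<pi> by (auto simp: candidates_def)
  show "to_cand (of_cand \<pi>) I = \<pi> I"
  proof (cases "I \<in> actors n")
    case False
    then show ?thesis using ext by (auto simp: to_cand_def extensional_def)
  next
    case True
    define k where "k = code (\<pi> I)"
    have r: "\<pi> I \<in> roles n G" using bij True by (auto simp: bij_betw_def)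
    then have k: "k \<in> {1..n}" "decode k = \<pi> I" using code_roles[OF r] decode_code[OF r] unfolding k_def by blast+
    have "inv_into (actors n) \<pi> (\<pi> I) = I" using bij True by (simp add: bij_betw_def)
    then have "actor (of_cand \<pi> k) = I" using k True by (auto simp: of_cand_def actors_def)
    then show ?thesis using to_cand_actor[OF perm k(1)] k by simp
  qed
qed

text \<open>At the initial stage the labels are the actors, and sending a pair of roles to the
  actors that take them is a bijection between the two sets of counted pairs.\<close>

lemma sgn_to_cand:
  assumes \<rho>: "\<rho> permutes {1..n}"
  shows "sgn_eps n G \<epsilon> (to_cand \<rho>) = inv_sign {} \<rho>"
proof -
  have inj: "\<rho> k = \<rho> l \<longleftrightarrow> k = l" for k l using permutes_inj[OF \<rho>] by (auto dest: injD)
  have less: "actor k \<lhd>\<^sub>L actor l \<longleftrightarrow> k < l" for k l by (auto simp: actor_def)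
  have "{(I, I'). I \<in> actors n \<and> I' \<in> actors n \<and> I \<lhd>\<^sub>L I' \<and>
      lab_less_eps n G \<epsilon> (to_cand \<rho> I') (to_cand \<rho> I)} =
    (\<lambda>(k, l). (actor (\<rho> k), actor (\<rho> l))) ` inv_pairs {} \<rho>" (is "?L = ?R")
  proof (intro set_eqI iffI)
    fix p assume "p \<in> ?L"
    then obtain k l where "p = (actor (\<rho> k), actor (\<rho> l))" "k \<in> {1..n}" "l \<in> {1..n}" "\<rho> k < \<rho> l"
      "lab_less_eps n G \<epsilon> (to_cand \<rho> (actor (\<rho> l))) (to_cand \<rho> (actor (\<rho> k)))"
      unfolding actors_image[OF \<rho>] by (auto simp: less)
    then show "p \<in> ?R"
      by (auto simp: to_cand_actor[OF \<rho>] lab_less_eps_decode inv_pairs_def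
          intro!: image_eqI[of _ _ "(k, l)"])
  next
    fix p assume "p \<in> ?R"
    then obtain k l where "p = (actor (\<rho> k), actor (\<rho> l))" "k \<in> {1..n}" "l \<in> {1..n}" "\<rho> k < \<rho> l" "before_eps l k"
      by (auto simp: inv_pairs_def)
    then show "p \<in> ?L"
      unfolding actors_image[OF \<rho>] by (auto simp: less to_cand_actor[OF \<rho>] lab_less_eps_decode)
  qed
  moreover have "inj_on (\<lambda>(k, l). (actor (\<rho> k), actor (\<rho> l))) (inv_pairs {} \<rho>)"
    by (auto simp: inj_on_def actor_def inj)
  ultimately show ?thesis by (simp add: sgn_eps_def inv_sign_def card_image)
qed

section \<open>Positions of the roles and the pulled-back sets\<close>

definition role_positions :: "(nat \<Rightarrow> real) \<Rightarrow> label \<Rightarrow> real" where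
  "role_positions z = (\<lambda>f\<in>roles n G. z (code f))"

lemma role_positions_decode: "k \<in> {1..n} \<Longrightarrow> role_positions z (decode k) = z k"
  by (simp add: role_positions_def roles_eq)

lemma admissible_sorted:
  assumes A: "admissible n G \<epsilon> A" and z: "role_positions z \<in> A"
  shows "sorted_positions z"
proof -
  have g: "role_positions z (Junc g) = z g" "role_positions z (heir n G g) = z (prv G g)"
    if "g \<in> G" for g
  proof -
    have *: "g \<in> {1..n}" "prv G g \<in> {1..n}" using that G prv_props[OF G, of g] by force+
    show "role_positions z (Junc g) = z g" "role_positions z (heir n G g) = z (prv G g)"
      using role_positions_decode[OF *(1), of z] role_positions_decode[OF *(2), of z] that
      by (auto simp: heir_eq decode_def)
  qed
  have H: "role_positions z (decode a) \<le> role_positions z (decode b)"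
    if "a \<in> {1..n} - G" "b \<in> {1..n} - G" "a < b" for a b
  proof -
    have "decode a \<in> heirs n G" "decode b \<in> heirs n G" using that by (auto simp: heirs_eq decode_def)
    moreover have "decode a \<lhd>\<^sub>L decode b"
      using that nxt_least[OF G, of a b] by (auto simp: decode_def)
    ultimately show ?thesis using A z by (auto simp: admissible_def)
  qed
  show ?thesis
    unfolding sorted_positions_def
  proof (intro conjI ballI impI)
    fix a b assume "a \<in> {1..n} - G" "b \<in> {1..n} - G" "a < b"
    then show "z a \<le> z b" using H[of a b] by (simp add: role_positions_decode)
  qed (use A z g in \<open>auto simp: admissible_def\<close>)
qed

text \<open>The set is defined as an image, but a candidate is a bijection, so the positions of the
  roles can be recovered from \<open>y\<close>; this turns the image into a preimage.\<close>

lemma pulled_back_iff: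
  assumes A: "admissible n G \<epsilon> A" and \<rho>: "\<rho> permutes {1..n}" and y: "y \<in> extensional {1..n}"
  shows "y \<in> pulled_back n (to_cand \<rho>) A \<longleftrightarrow> role_positions (y \<circ> \<rho>) \<in> A"
proof
  have surj: "\<exists>k\<in>{1..n}. j = \<rho> k" if "j \<in> {1..n}" for j using permutes_image[OF \<rho>] that by blast
  {
    assume "y \<in> pulled_back n (to_cand \<rho>) A"
    then obtain v where v: "v \<in> A" "y = (\<lambda>j\<in>{1..n}. v (to_cand \<rho> (actor j)))"
      by (auto simp: pulled_back_def)
    have "A \<subseteq> extensional (roles n G)"
      using A sets.sets_into_space unfolding admissible_def space_PiM by (force simp: space_PiM PiE_def)
    then have "v \<in> extensional (roles n G)" using v by auto
    moreover have "role_positions (y \<circ> \<rho>) f = v f" if "f \<in> roles n G" for f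
      using that v permutes_in_image[OF \<rho>] code_roles[OF that]
      by (simp add: role_positions_def to_cand_actor[OF \<rho>] decode_code)
    ultimately have "role_positions (y \<circ> \<rho>) = v"
      by (intro extensionalityI[of _ "roles n G"]) (auto simp: role_positions_def)
    then show "role_positions (y \<circ> \<rho>) \<in> A" using v by simp
  }
  {
    assume r: "role_positions (y \<circ> \<rho>) \<in> A"
    have "y = (\<lambda>j\<in>{1..n}. role_positions (y \<circ> \<rho>) (to_cand \<rho> (actor j)))"
    proof (rule extensionalityI[OF y])
      fix j assume "j \<in> {1..n}"
      then obtain k where "k \<in> {1..n}" "j = \<rho> k" using surj by blast
      then show "y j = (\<lambda>j\<in>{1..n}. role_positions (y \<circ> \<rho>) (to_cand \<rho> (actor j))) j"
        using \<open>j \<in> {1..n}\<close> by (simp add: to_cand_actor[OF \<rho>] role_positions_decode)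
    qed simp
    then show "y \<in> pulled_back n (to_cand \<rho>) A" using r unfolding pulled_back_def by blast
  }
qed

lemma conf_positions:
  assumes c: "final_config n T prio X \<omega> = conf n G \<psi>" and \<psi>: "\<psi> permutes {1..n}"
  shows "final_positions n T prio G X \<omega> = role_positions ((\<lambda>j\<in>{1..n}. X j T \<omega>) \<circ> \<psi>)"
proof
  fix f
  show "final_positions n T prio G X \<omega> f = role_positions ((\<lambda>j\<in>{1..n}. X j T \<omega>) \<circ> \<psi>) f"
  proof (cases "f \<in> roles n G")
    case False
    then show ?thesis by (simp add: final_positions_def role_positions_def)
  next
    case True
    then obtain k where k: "k \<in> {1..n}" "f = decode k" by (auto simp: roles_eq)
    have \<psi>k: "\<psi> k \<in> {1..n}" using k permutes_in_image[OF \<psi>] by blast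
    show ?thesis
    proof (cases "k \<in> G")
      case g: True
      then show ?thesis using k True \<psi>k
        by (simp add: final_positions_def role_positions_def decode_def c conf_def)
    next
      case False
      then have "(THE p. (p, k, nxt n G k) \<in> fst (conf n G \<psi>)) = \<psi> k"
        using k by (intro the_equality) (auto simp: conf_def)
      then show ?thesis using k True \<psi>k False
        by (simp add: final_positions_def role_positions_def decode_def c)
    qed
  qed
qed

lemma dom_conf: "dom (snd (conf n \<Gamma> \<psi>)) = \<Gamma>"
  by (auto simp: conf_def dom_def)

end


section \<open>Exchange of trajectories after a meeting\<close>

text \<open>An event of the past of \<open>S\<close>, cut down to \<open>S \<le> T\<close>, is known
  at \<open>T\<close>. This is how events at earlier collision times are carried to later
  ones.\<close>

lemma (in filtration) pred_pre_sigma_le: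
  assumes S: "stopping_time F S" and T: "stopping_time F T"
    and P: "Measurable.pred (pre_sigma S) P"
  shows "Measurable.pred (pre_sigma T) (\<lambda>\<omega>. P \<omega> \<and> S \<omega> \<le> T \<omega>)"
proof (rule pred_pre_sigmaI[OF T])
  fix t
  have "{\<omega> \<in> \<Omega>. P \<omega>} \<in> sets (pre_sigma S)" using P by (simp add: pred_def space_pre_sigma)
  then have 1: "{\<omega> \<in> {\<omega> \<in> \<Omega>. P \<omega>}. S \<omega> \<le> t} \<in> sets (F t)" by (rule sets_pre_sigmaD[OF S])
  have "{\<omega> \<in> \<Omega>. T \<omega> < S \<omega>} \<in> sets (pre_sigma T)"
    using stopping_time_less[OF T S] by (simp add: pred_def space_pre_sigma)
  then have 2: "{\<omega> \<in> {\<omega> \<in> \<Omega>. T \<omega> < S \<omega>}. T \<omega> \<le> t} \<in> sets (F t)" by (rule sets_pre_sigmaD[OF T])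
  have 3: "{\<omega> \<in> \<Omega>. T \<omega> \<le> t} \<in> sets (F t)" using stopping_timeD[OF T] by (simp add: pred_def space_F)
  have "{\<omega> \<in> \<Omega>. (P \<omega> \<and> S \<omega> \<le> T \<omega>) \<and> T \<omega> \<le> t} =
    {\<omega> \<in> {\<omega> \<in> \<Omega>. P \<omega>}. S \<omega> \<le> t} \<inter> ({\<omega> \<in> \<Omega>. T \<omega> \<le> t} - {\<omega> \<in> {\<omega> \<in> \<Omega>. T \<omega> < S \<omega>}. T \<omega> \<le> t})"
    by auto
  also have "\<dots> \<in> sets (F t)" using 1 2 3 by auto
  finally show "Measurable.pred (F t) (\<lambda>\<omega>. (P \<omega> \<and> S \<omega> \<le> T \<omega>) \<and> T \<omega> \<le> t)"
    by (simp add: pred_def space_F)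
qed

lemma (in filtration) pred_pre_sigma_less':
  assumes S: "stopping_time F S" and T: "stopping_time F T"
  shows "Measurable.pred (pre_sigma T) (\<lambda>\<omega>. S \<omega> < T \<omega>)"
proof -
  have "(\<lambda>\<omega>. S \<omega> < T \<omega>) = (\<lambda>\<omega>. S \<omega> < T \<omega> \<and> S \<omega> \<le> T \<omega>)" by auto
  then show ?thesis using pred_pre_sigma_le[OF S T stopping_time_less[OF S T]] by simp
qed

lemma (in filtration) pred_pre_sigma_eq:
  assumes S: "stopping_time F S" and T: "stopping_time F T"
  shows "Measurable.pred (pre_sigma S) (\<lambda>\<omega>. S \<omega> = T \<omega>)"
proof -
  have "(\<lambda>\<omega>. S \<omega> = T \<omega>) = (\<lambda>\<omega>. \<not> S \<omega> < T \<omega> \<and> \<not> T \<omega> < S \<omega>)" by auto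
  then show ?thesis
    using stopping_time_less[OF S T] pred_pre_sigma_less'[OF T S] by (simp add: pred_intros_logic)
qed

section \<open>The non-interacting system and its exchange symmetry\<close>

locale karlin_mcgregor = prob_space M for M :: "'w measure" +
  fixes n :: nat and T :: real and x :: "nat \<Rightarrow> real"
    and Q :: "real \<Rightarrow> real \<Rightarrow> (real \<Rightarrow> real) measure" and X :: "nat \<Rightarrow> real \<Rightarrow> 'w \<Rightarrow> real"
  assumes T: "0 \<le> T"
    and x: "\<And>i j. 1 \<le> i \<Longrightarrow> i \<le> j \<Longrightarrow> j \<le> n \<Longrightarrow> x i \<le> x j"
    and Q: "path_laws T Q"
    and KM1: "KM1 M n T Q X" and KM2: "KM2 M n T Q x X" and KM3: "KM3 M n T X" and KM4: "KM4 M n T X"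
begin

abbreviation "F \<equiv> joint_filtration M n T X"

sublocale filtration "space M" F
  by (rule filtration_joint_filtration)

abbreviation "m \<omega> \<equiv> first_meeting T X \<omega>"

definition XT :: "'w \<Rightarrow> nat \<Rightarrow> real" where
  "XT \<omega> = (\<lambda>j\<in>{1..n}. X j T \<omega>)"

abbreviation "states_T \<equiv> \<Pi>\<^sub>M j\<in>{1..n}. (borel :: real measure)"

lemma measurable_path: "j \<in> {1..n} \<Longrightarrow> path T X j \<in> M \<rightarrow>\<^sub>M path_space T"
  using KM2 by (auto simp: KM2_def indep_vars_def)

lemma measurable_X: "j \<in> {1..n} \<Longrightarrow> t \<in> {0..T} \<Longrightarrow> X j t \<in> borel_measurable M"
proof -
  assume j: "j \<in> {1..n}" and t: "t \<in> {0..T}"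
  have "(\<lambda>w. w t) \<in> path_space T \<rightarrow>\<^sub>M borel"
    unfolding path_space_def using t by (rule measurable_component_singleton)
  from measurable_compose[OF measurable_path[OF j] this]
  show "X j t \<in> borel_measurable M" using t by (simp add: path_def)
qed

lemma measurable_XT: "XT \<in> M \<rightarrow>\<^sub>M states_T"
  unfolding XT_def using T by (intro measurable_restrict measurable_X) auto

lemma sets_F: "sets (F t) \<subseteq> sets M"
proof -
  have "{X j s -` B \<inter> space M | j s B. j \<in> {1..n} \<and> s \<in> {0..T} \<and> ereal s \<le> t \<and> B \<in> sets borel} \<subseteq> sets M"
    using measurable_X by (auto intro!: measurable_sets)
  then show ?thesis
    unfolding joint_filtration_def by (subst sets_measure_of) (auto intro!: sets.sigma_sets_subset)
qed

lemma sets_pre_sigma_M: "stopping_time F \<tau> \<Longrightarrow> sets (pre_sigma \<tau>) \<subseteq> sets M"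
proof
  fix E assume \<tau>: "stopping_time F \<tau>" and E: "E \<in> sets (pre_sigma \<tau>)"
  \<comment> \<open>At time \<open>\<infinity>\<close> the restriction is void, so \<open>E\<close>
    itself belongs to the full filtration.\<close>
  have "{\<omega> \<in> E. \<tau> \<omega> \<le> \<infinity>} \<in> sets (F \<infinity>)" by (rule sets_pre_sigmaD[OF \<tau> E])
  then show "E \<in> sets M" using sets_F[of \<infinity>] by auto
qed

lemma pred_pre_sigma_M: "stopping_time F \<tau> \<Longrightarrow> Measurable.pred (pre_sigma \<tau>) P \<Longrightarrow> Measurable.pred M P"
  using sets_pre_sigma_M[of \<tau>] by (auto simp: pred_def space_pre_sigma)

lemma stopping_time_meeting:
  assumes "p \<in> {1..n}" "q \<in> {1..n}" "p \<noteq> q"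
  shows "stopping_time F (\<lambda>\<omega>. m \<omega> p q)"
proof (cases "p < q")
  case True
  then show ?thesis using KM4 assms by (auto simp: KM4_def)
next
  case False
  then have "stopping_time F (\<lambda>\<omega>. m \<omega> q p)" using KM4 assms by (auto simp: KM4_def)
  then show ?thesis by (simp add: first_meeting_commute)
qed

lemma stopping_time_meet:
  assumes \<Gamma>: "\<Gamma> \<subseteq> {2..n}" and \<psi>: "\<psi> permutes {1..n}" and g: "g \<in> {2..n}"
  shows "stopping_time F (\<lambda>\<omega>. meet (m \<omega>) \<Gamma> \<psi> g)"
  unfolding meet_def
proof (rule stopping_time_meeting)
  have p: "1 \<le> prv \<Gamma> g" "prv \<Gamma> g < g" using prv_props[OF \<Gamma>, of g] g by auto
  have "prv \<Gamma> g \<in> {1..n}" "g \<in> {1..n}" using p g by auto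
  then show "\<psi> (prv \<Gamma> g) \<in> {1..n}" "\<psi> g \<in> {1..n}" using permutes_in_image[OF \<psi>] by blast+
  show "\<psi> (prv \<Gamma> g) \<noteq> \<psi> g" using permutes_inj[OF \<psi>] p by (metis injD less_irrefl)
qed

lemma AE_good_path: "AE \<omega> in M. good_path n T X \<omega>"
proof -
  \<comment> \<open>A path under \<open>Q 0 (x j)\<close> has the value \<open>x j\<close> on the
    degenerate interval \<open>{0..0}\<close>, which gives the initial condition.\<close>
  have start: "AE \<omega> in M. X j 0 \<omega> = x j" if j: "j \<in> {1..n}" for j
  proof -
    have "AE w in Q 0 (x j). w 0 = x j" using Q T by (auto simp: path_laws_def)
    moreover have "Q 0 (x j) = distr M (path_space T) (path T X j)" using KM2 j by (auto simp: KM2_def)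
    ultimately have "AE w in distr M (path_space T) (path T X j). w 0 = x j" by metis
    then have "AE \<omega> in M. path T X j \<omega> 0 = x j"
      by (rule AE_distrD[OF measurable_path[OF j]])
    then show ?thesis using T by (simp add: path_def)
  qed
  have "AE \<omega> in M. \<forall>i\<in>{1..n}. \<forall>j\<in>{1..n}. i \<le> j \<longrightarrow> X i 0 \<omega> \<le> X j 0 \<omega>"
  proof (intro AE_finite_allI)
    fix i j assume ij: "i \<in> {1..n}" "j \<in> {1..n}"
    show "AE \<omega> in M. i \<le> j \<longrightarrow> X i 0 \<omega> \<le> X j 0 \<omega>"
      using start[OF ij(1)] start[OF ij(2)]
    proof eventually_elim
      case (elim \<omega>)
      then show ?case using x[of i j] ij by simp
    qed
  qed auto
  moreover have "AE \<omega> in M. \<forall>i\<in>{1..n}. \<forall>j\<in>{1..n}. \<forall>s t. 0 \<le> s \<and> s \<le> t \<and> t \<le> T \<and> X i s \<omega> < X j s \<omega> \<and> X j t \<omega> < X i t \<omega> \<longrightarrow>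
        (\<exists>u\<in>{s..t}. X i u \<omega> = X j u \<omega>)"
  proof (intro AE_finite_allI)
    fix i j assume "i \<in> {1..n}" "j \<in> {1..n}"
    then show "AE \<omega> in M. \<forall>s t. 0 \<le> s \<and> s \<le> t \<and> t \<le> T \<and> X i s \<omega> < X j s \<omega> \<and> X j t \<omega> < X i t \<omega> \<longrightarrow>
        (\<exists>u\<in>{s..t}. X i u \<omega> = X j u \<omega>)"
      using KM3 unfolding KM3_def by blast
  qed auto
  moreover have "AE \<omega> in M. \<forall>i\<in>{1..n}. \<forall>j\<in>{1..n}. i < j \<longrightarrow> first_meeting T X \<omega> i j < \<infinity> \<longrightarrow>
        X i (real_of_ereal (first_meeting T X \<omega> i j)) \<omega> = X j (real_of_ereal (first_meeting T X \<omega> i j)) \<omega>"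
  proof (intro AE_finite_allI)
    fix i j assume ij: "i \<in> {1..n}" "j \<in> {1..n}"
    show "AE \<omega> in M. i < j \<longrightarrow> first_meeting T X \<omega> i j < \<infinity> \<longrightarrow>
        X i (real_of_ereal (first_meeting T X \<omega> i j)) \<omega> = X j (real_of_ereal (first_meeting T X \<omega> i j)) \<omega>"
      using KM4 ij by (cases "i < j") (auto simp: KM4_def)
  qed auto
  ultimately show ?thesis
  proof eventually_elim
    case (elim \<omega>)
    then show ?case unfolding good_path_def by (intro conjI)
  qed
qed

definition swap :: "nat \<Rightarrow> nat \<Rightarrow> (nat \<Rightarrow> real) \<Rightarrow> nat \<Rightarrow> real" where
  "swap p q y = (\<lambda>j\<in>{1..n}. y (transpose p q j))"

lemma transpose_in: "p \<in> {1..n} \<Longrightarrow> q \<in> {1..n} \<Longrightarrow> j \<in> {1..n} \<Longrightarrow> transpose p q j \<in> {1..n}"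
  by (auto simp: transpose_if)

lemma measurable_swap: "p \<in> {1..n} \<Longrightarrow> q \<in> {1..n} \<Longrightarrow> swap p q \<in> states_T \<rightarrow>\<^sub>M states_T"
  unfolding swap_def
  by (intro measurable_restrict measurable_component_singleton transpose_in)

lemma Q_law: "sets (Q s y) = sets (path_space T)" "prob_space (Q s y)"
proof -
  have meas: "(\<lambda>(s, x). Q s x) \<in> borel \<Otimes>\<^sub>M borel \<rightarrow>\<^sub>M prob_algebra (path_space T)"
    using Q unfolding path_laws_def by blast
  have "Q s y \<in> space (prob_algebra (path_space T))"
    using measurable_space[OF meas, of "(s, y)"] by (simp add: space_pair_measure)
  then show "sets (Q s y) = sets (path_space T)" "prob_space (Q s y)"
    by (auto simp: space_prob_algebra)
qed

definition end_event :: "(nat \<Rightarrow> real) set \<Rightarrow> (nat \<Rightarrow> real \<Rightarrow> real) set" where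
  "end_event B = (\<lambda>w. \<lambda>j\<in>{1..n}. w j T) -` B \<inter> space (\<Pi>\<^sub>M j\<in>{1..n}. path_space T)"

lemma sets_end_event: "B \<in> sets states_T \<Longrightarrow> end_event B \<in> sets (\<Pi>\<^sub>M j\<in>{1..n}. path_space T)"
proof -
  have "(\<lambda>w. w T) \<in> path_space T \<rightarrow>\<^sub>M borel"
    unfolding path_space_def using T by (intro measurable_component_singleton) auto
  then have "(\<lambda>w. \<lambda>j\<in>{1..n}. w j T) \<in> (\<Pi>\<^sub>M j\<in>{1..n}. path_space T) \<rightarrow>\<^sub>M states_T"
    by (intro measurable_restrict measurable_compose[OF measurable_component_singleton])
  then show "B \<in> sets states_T \<Longrightarrow> end_event B \<in> sets (\<Pi>\<^sub>M j\<in>{1..n}. path_space T)"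
    unfolding end_event_def by (rule measurable_sets)
qed

text \<open>Equal states at the restart give equal factors \<open>p\<close> and \<open>q\<close> of
  the product law, which is therefore invariant under exchanging these coordinates.\<close>

lemma system_law_swap:
  assumes pq: "p \<in> {1..n}" "q \<in> {1..n}" and z: "z p = z q" and B: "B \<in> sets states_T"
  shows "emeasure (system_law n Q s z) (end_event (swap p q -` B \<inter> space states_T)) =
    emeasure (system_law n Q s z) (end_event B)"
proof -
  let ?t = "transpose p q" and ?N = "\<lambda>j. Q s (z j)" and ?I = "{1..n}"
  let ?R = "\<lambda>w. \<lambda>j\<in>?I. w (?t j)"
  have Nt: "?N (?t j) = ?N j" for j using z by (auto simp: transpose_if)
  have sets_eq: "sets (PiM ?I ?N) = sets (\<Pi>\<^sub>M j\<in>?I. path_space T)"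
    by (intro sets_PiM_cong refl Q_law)
  have space_eq: "space (PiM ?I ?N) = space (\<Pi>\<^sub>M j\<in>?I. path_space T)"
    using sets_eq by (rule sets_eq_imp_space_eq)
  have distr: "distr (PiM ?I ?N) (PiM ?I ?N) ?R = PiM ?I ?N"
  proof -
    have "?t \<in> ?I \<rightarrow> ?I" using pq transpose_in by blast
    from distr_PiM_reindex[of ?I ?N, OF Q_law(2) inj_on_transpose this]
    show ?thesis unfolding Nt by simp
  qed
  have R: "?R \<in> PiM ?I ?N \<rightarrow>\<^sub>M PiM ?I ?N"
  proof (rule measurable_restrict)
    fix j assume "j \<in> ?I"
    then show "(\<lambda>w. w (?t j)) \<in> PiM ?I ?N \<rightarrow>\<^sub>M ?N j"
      using measurable_component_singleton[OF transpose_in[OF pq], of j ?N] unfolding Nt by blast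
  qed
  have "emeasure (PiM ?I ?N) (end_event B) = emeasure (distr (PiM ?I ?N) (PiM ?I ?N) ?R) (end_event B)"
    by (simp only: distr)
  also have "\<dots> = emeasure (PiM ?I ?N) (?R -` end_event B \<inter> space (PiM ?I ?N))"
    using sets_end_event[OF B] sets_eq by (intro emeasure_distr R) simp
  also have "?R -` end_event B \<inter> space (PiM ?I ?N) = end_event (swap p q -` B \<inter> space states_T)"
  proof -
    have "?R w \<in> space (\<Pi>\<^sub>M j\<in>?I. path_space T)" if "w \<in> space (PiM ?I ?N)" for w
      using measurable_space[OF R that] space_eq by simp
    moreover have "(\<lambda>j\<in>?I. ?R w j T) = swap p q (\<lambda>j\<in>?I. w j T)" for w
      unfolding swap_def using transpose_in[OF pq] by (intro restrict_ext) (metis restrict_apply')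
    ultimately show ?thesis
      unfolding end_event_def space_eq by (auto simp: space_PiM)
  qed
  finally show ?thesis by (simp add: system_law_def)
qed

text \<open>Strong Markov property at the first meeting of \<open>p\<close> and \<open>q\<close>:
  given the past, the system restarts from a state in which the two coincide, so their end positions
  may be exchanged on any event of that past.\<close>

lemma swap_law:
  assumes pq: "p \<in> {1..n}" "q \<in> {1..n}" "p \<noteq> q"
    and E: "E \<in> sets (pre_sigma (\<lambda>\<omega>. m \<omega> p q))" "\<And>\<omega>. \<omega> \<in> E \<Longrightarrow> m \<omega> p q < \<infinity>"
    and B: "B \<in> sets states_T"
  shows "emeasure M {\<omega>\<in>E. swap p q (XT \<omega>) \<in> B} = emeasure M {\<omega>\<in>E. XT \<omega> \<in> B}"
proof -
  let ?\<tau> = "\<lambda>\<omega>. m \<omega> p q"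
  let ?f = "\<lambda>B \<omega>. emeasure (system_law n Q (real_of_ereal (?\<tau> \<omega>)) (\<lambda>j. X j (real_of_ereal (?\<tau> \<omega>)) \<omega>)) (end_event B)"
  have st: "stopping_time F ?\<tau>" by (rule stopping_time_meeting[OF pq])
  \<comment> \<open>On \<open>E\<close> the meeting occurs by \<open>T\<close>, so the post-meeting
    system has the same positions at \<open>T\<close> as the original one. The formula is needed
    both for \<open>B\<close> and for its preimage under the exchange.\<close>
  have key: "emeasure M {\<omega>\<in>E. XT \<omega> \<in> B} = (\<integral>\<^sup>+\<omega>\<in>{\<omega>\<in>E. ?\<tau> \<omega> \<le> ereal T}. ?f B \<omega> \<partial>M)"
    if B: "B \<in> sets states_T" for B
  proof -
    have "{\<omega>\<in>E. XT \<omega> \<in> B} =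
      {\<omega>\<in>E. ?\<tau> \<omega> \<le> ereal T \<and> post_system n T X (real_of_ereal (?\<tau> \<omega>)) \<omega> \<in> end_event B}"
    proof (rule Collect_cong)
      fix \<omega>
      show "\<omega> \<in> E \<and> XT \<omega> \<in> B \<longleftrightarrow>
        \<omega> \<in> E \<and> ?\<tau> \<omega> \<le> ereal T \<and> post_system n T X (real_of_ereal (?\<tau> \<omega>)) \<omega> \<in> end_event B"
      proof (cases "\<omega> \<in> E")
        case True
        note fm = first_meeting_finite[OF E(2)[OF True]]
        have "(\<lambda>j\<in>{1..n}. post_system n T X (real_of_ereal (?\<tau> \<omega>)) \<omega> j T) = XT \<omega>"
          using fm(4) T by (auto simp: post_system_def XT_def fun_eq_iff)
        moreover have "post_system n T X (real_of_ereal (?\<tau> \<omega>)) \<omega> \<in> space (\<Pi>\<^sub>M j\<in>{1..n}. path_space T)"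
          by (auto simp: post_system_def space_PiM path_space_def)
        ultimately show ?thesis using fm(1) True by (simp add: end_event_def)
      qed simp
    qed
    moreover have "emeasure M {\<omega>\<in>E. ?\<tau> \<omega> \<le> ereal T \<and>
        post_system n T X (real_of_ereal (?\<tau> \<omega>)) \<omega> \<in> end_event B} =
      (\<integral>\<^sup>+\<omega>\<in>{\<omega>\<in>E. ?\<tau> \<omega> \<le> ereal T}. ?f B \<omega> \<partial>M)"
      by (rule KM1[unfolded KM1_def, THEN spec[of _ ?\<tau>], THEN mp, OF conjI, THEN conjunct2, THEN bspec, THEN bspec])
        (use st E(1) sets_end_event[OF B] first_meeting_nonneg in auto)
    ultimately show ?thesis by simp
  qed
  have "(\<integral>\<^sup>+\<omega>\<in>{\<omega>\<in>E. ?\<tau> \<omega> \<le> ereal T}. ?f (swap p q -` B \<inter> space states_T) \<omega> \<partial>M) =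
      (\<integral>\<^sup>+\<omega>\<in>{\<omega>\<in>E. ?\<tau> \<omega> \<le> ereal T}. ?f B \<omega> \<partial>M)"
  proof (rule nn_integral_cong_AE)
    show "AE \<omega> in M. ?f (swap p q -` B \<inter> space states_T) \<omega> * indicator {\<omega>\<in>E. ?\<tau> \<omega> \<le> ereal T} \<omega> =
        ?f B \<omega> * indicator {\<omega>\<in>E. ?\<tau> \<omega> \<le> ereal T} \<omega>"
      using AE_good_path
    proof eventually_elim
      case (elim \<omega>)
      show ?case
      proof (cases "\<omega> \<in> E")
        case True
        then have fin: "?\<tau> \<omega> < \<infinity>" by (rule E(2))
        have "X p (real_of_ereal (?\<tau> \<omega>)) \<omega> = X q (real_of_ereal (?\<tau> \<omega>)) \<omega>"
        proof (cases "p < q")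
          case True
          then show ?thesis using elim pq fin unfolding good_path_def by blast
        next
          case False
          then have "q < p" using pq by simp
          then have "X q (real_of_ereal (m \<omega> q p)) \<omega> = X p (real_of_ereal (m \<omega> q p)) \<omega>"
            using elim pq fin first_meeting_commute[of T X \<omega> p q] unfolding good_path_def by metis
          then show ?thesis using first_meeting_commute[of T X \<omega> p q] by simp
        qed
        then show ?thesis using system_law_swap[OF pq(1,2) _ B] by simp
      qed simp
    qed
  qed
  then have "emeasure M {\<omega>\<in>E. XT \<omega> \<in> swap p q -` B \<inter> space states_T} = emeasure M {\<omega>\<in>E. XT \<omega> \<in> B}"
    using key[OF B] key[OF measurable_sets[OF measurable_swap[OF pq(1,2)] B]] by simp
  moreover have "{\<omega>\<in>E. XT \<omega> \<in> swap p q -` B \<inter> space states_T} = {\<omega>\<in>E. swap p q (XT \<omega>) \<in> B}"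
    by (auto simp: space_PiM XT_def)
  ultimately show ?thesis by simp
qed

text \<open>On \<open>E\<close> the law of the end positions is invariant under the exchange, so the
  integral of an antisymmetric function equals its negative.\<close>

lemma swap_integral_eq_0:
  fixes w :: "(nat \<Rightarrow> real) \<Rightarrow> real"
  assumes pq: "p \<in> {1..n}" "q \<in> {1..n}" "p \<noteq> q"
    and E: "E \<in> sets (pre_sigma (\<lambda>\<omega>. m \<omega> p q))" "\<And>\<omega>. \<omega> \<in> E \<Longrightarrow> m \<omega> p q < \<infinity>"
    and w: "w \<in> borel_measurable states_T" "\<And>y. w (swap p q y) = - w y"
  shows "(\<integral>\<omega>. indicator E \<omega> * w (XT \<omega>) \<partial>M) = 0"
proof -
  let ?N = "restrict_space M E"
  have EM: "E \<in> sets M" using sets_pre_sigma_M[OF stopping_time_meeting[OF pq]] E(1) by auto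
  then have EM': "E \<inter> space M \<in> sets M" by auto
  have EN: "space ?N = E" using sets.sets_into_space[OF EM] by (auto simp: space_restrict_space)
  have m1: "XT \<in> ?N \<rightarrow>\<^sub>M states_T" by (rule measurable_restrict_space1[OF measurable_XT])
  have m2: "(\<lambda>\<omega>. swap p q (XT \<omega>)) \<in> ?N \<rightarrow>\<^sub>M states_T"
    by (rule measurable_compose[OF m1 measurable_swap[OF pq(1,2)]])
  have "distr ?N states_T (\<lambda>\<omega>. swap p q (XT \<omega>)) = distr ?N states_T XT"
  proof (rule measure_eqI)
    fix B assume "B \<in> sets (distr ?N states_T (\<lambda>\<omega>. swap p q (XT \<omega>)))"
    then have B: "B \<in> sets states_T" by simp
    have "(\<lambda>\<omega>. swap p q (XT \<omega>)) -` B \<inter> space ?N = {\<omega>\<in>E. swap p q (XT \<omega>) \<in> B}"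
      "XT -` B \<inter> space ?N = {\<omega>\<in>E. XT \<omega> \<in> B}"
      unfolding EN by auto
    then show "emeasure (distr ?N states_T (\<lambda>\<omega>. swap p q (XT \<omega>))) B = emeasure (distr ?N states_T XT) B"
      using swap_law[OF pq E B] EM'
      unfolding emeasure_distr[OF m1 B] emeasure_distr[OF m2 B]
      by (simp add: emeasure_restrict_space)
  qed simp
  then have "(\<integral>\<omega>. w (swap p q (XT \<omega>)) \<partial>?N) = (\<integral>\<omega>. w (XT \<omega>) \<partial>?N)"
    using integral_distr[OF m1 w(1)] integral_distr[OF m2 w(1)] by simp
  then have "(\<integral>\<omega>. w (XT \<omega>) \<partial>?N) = 0" by (simp add: w(2))
  then show ?thesis using EM' by (simp add: integral_restrict_space)
qed

text \<open>Whether another meeting comes before, at or after the meeting at \<open>g\<close> is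
  known at the latter time, even if the other meeting is still to come.\<close>

lemma pred_is_next:
  assumes \<Gamma>: "\<Gamma> \<subseteq> {2..n}" and \<psi>: "\<psi> permutes {1..n}" and g: "g \<in> {2..n}"
  shows "Measurable.pred (pre_sigma (\<lambda>\<omega>. meet (m \<omega>) \<Gamma> \<psi> g)) (\<lambda>\<omega>. is_next n prio (m \<omega>) \<Gamma> \<psi> g)"
proof (cases "g \<in> \<Gamma>")
  case True
  then show ?thesis by (simp add: is_next_def pending_def)
next
  case False
  let ?\<sigma> = "\<lambda>g \<omega>. meet (m \<omega>) \<Gamma> \<psi> g"
  have st: "stopping_time F (?\<sigma> g)" if "g \<in> {2..n}" for g by (rule stopping_time_meet[OF \<Gamma> \<psi> that])
  \<comment> \<open>The tie-break depends on the stage only, so it is the same for every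
    trajectory.\<close>
  define c where "c g' \<longleftrightarrow> (let w = min (prio (\<psi> (prv \<Gamma> g))) (prio (\<psi> g));
      w' = min (prio (\<psi> (prv \<Gamma> g'))) (prio (\<psi> g'));
      l = max (prio (\<psi> (prv \<Gamma> g))) (prio (\<psi> g)); l' = max (prio (\<psi> (prv \<Gamma> g'))) (prio (\<psi> g'))
    in w < w' \<or> w = w' \<and> l < l')" for g'
  have eq: "is_next n prio (m \<omega>) \<Gamma> \<psi> g \<longleftrightarrow> ?\<sigma> g \<omega> < \<infinity> \<and>
    (\<forall>g'\<in>{2..n} - \<Gamma> - {g}. ?\<sigma> g \<omega> < ?\<sigma> g' \<omega> \<or> ?\<sigma> g \<omega> = ?\<sigma> g' \<omega> \<and> c g')" for \<omega>
  proof -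
    have prec: "precedes prio (m \<omega>) (coll n \<Gamma> \<psi> g) (coll n \<Gamma> \<psi> g') \<longleftrightarrow>
      ?\<sigma> g \<omega> < ?\<sigma> g' \<omega> \<or> ?\<sigma> g \<omega> = ?\<sigma> g' \<omega> \<and> c g'" for g'
      by (simp add: precedes_def coll_def meet_def c_def Let_def)
    \<comment> \<open>A junction without a pending collision has an infinite meeting time, so it may
      be included in the comparison.\<close>
    have "?\<sigma> g \<omega> < ?\<sigma> g' \<omega>" if "?\<sigma> g \<omega> < \<infinity>" "\<not> ?\<sigma> g' \<omega> < \<infinity>" for g'
      using that by simp
    then show ?thesis
      unfolding is_next_def prec pending_def using False g by blast
  qed
  have fin: "Measurable.pred (pre_sigma (?\<sigma> g)) (\<lambda>\<omega>. ?\<sigma> g \<omega> < \<infinity>)"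
    by (rule stopping_time_less[OF st[OF g] stopping_time_const])
  have "Measurable.pred (pre_sigma (?\<sigma> g)) (\<lambda>\<omega>. ?\<sigma> g \<omega> < \<infinity> \<and>
    (\<forall>g'\<in>{2..n} - \<Gamma> - {g}. ?\<sigma> g \<omega> < ?\<sigma> g' \<omega> \<or> ?\<sigma> g \<omega> = ?\<sigma> g' \<omega> \<and> c g'))"
  proof (intro pred_intros_logic pred_intros_finite fin)
    fix g' assume g': "g' \<in> {2..n} - \<Gamma> - {g}"
    then show "Measurable.pred (pre_sigma (?\<sigma> g)) (\<lambda>\<omega>. ?\<sigma> g \<omega> < ?\<sigma> g' \<omega>)"
      "Measurable.pred (pre_sigma (?\<sigma> g)) (\<lambda>\<omega>. ?\<sigma> g \<omega> = ?\<sigma> g' \<omega>)"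
      using st[OF g] st[of g'] by (auto intro!: stopping_time_less pred_pre_sigma_eq)
  qed auto
  then show ?thesis by (simp add: eq)
qed

lemma finite_states: "finite (states n)"
  by (simp add: states_def finite_permutations)

text \<open>Each collision is an event in the past of its own meeting time; the clause in
  \<open>hist\<close> that this time is at most \<open>\<tau>\<close> transfers it to the past of
  \<open>\<tau>\<close>.\<close>

lemma pred_hist:
  assumes \<tau>: "stopping_time F \<tau>"
  shows "Measurable.pred (pre_sigma \<tau>) (\<lambda>\<omega>. hist n prio (m \<omega>) (\<tau> \<omega>) i s)"
proof (induction i arbitrary: s)
  case (Suc i)
  show ?case
    unfolding hist.simps
  proof (intro pred_intros_finite finite_states)
    fix s' g assume s': "s' \<in> states n" and g: "g \<in> {2..n}"
    let ?\<sigma> = "\<lambda>\<omega>. meet (m \<omega>) (fst s') (snd s') g"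
    have s'': "fst s' \<subseteq> {2..n}" "snd s' permutes {1..n}" using s' by (auto simp: states_def)
    have *: "Measurable.pred (pre_sigma \<tau>) (\<lambda>\<omega>. is_next n prio (m \<omega>) (fst s') (snd s') g \<and> ?\<sigma> \<omega> \<le> \<tau> \<omega>)"
      using s'' g by (intro pred_pre_sigma_le[OF stopping_time_meet \<tau>] pred_is_next)
    have "Measurable.pred (pre_sigma \<tau>) (\<lambda>\<omega>. hist n prio (m \<omega>) (\<tau> \<omega>) i s' \<and>
      (is_next n prio (m \<omega>) (fst s') (snd s') g \<and> ?\<sigma> \<omega> \<le> \<tau> \<omega>) \<and> s = merge prio (fst s') (snd s') g)"
      by (rule pred_intros_logic(3)[OF Suc.IH pred_intros_conj2'[OF *]])
    then show "Measurable.pred (pre_sigma \<tau>) (\<lambda>\<omega>. hist n prio (m \<omega>) (\<tau> \<omega>) i s' \<and>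
      is_next n prio (m \<omega>) (fst s') (snd s') g \<and> ?\<sigma> \<omega> \<le> \<tau> \<omega> \<and> s = merge prio (fst s') (snd s') g)"
      by (simp add: conj_assoc)
  qed auto
qed simp

lemma pred_run:
  assumes prio: "inj_on prio {1..n}"
  shows "Measurable.pred M (\<lambda>\<omega>. run n prio (m \<omega>) i = s)"
proof (induction i arbitrary: s)
  case (Suc i)
  have eq: "run n prio (m \<omega>) (Suc i) = s \<longleftrightarrow> (\<exists>s'\<in>states n. run n prio (m \<omega>) i = s' \<and>
      ((\<forall>g\<in>{2..n} - fst s'. \<not> meet (m \<omega>) (fst s') (snd s') g < \<infinity>) \<and> s = s' \<or>
       (\<exists>g\<in>{2..n}. is_next n prio (m \<omega>) (fst s') (snd s') g \<and> s = merge prio (fst s') (snd s') g)))" for \<omega>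
  proof -
    obtain \<Gamma> \<psi> where s: "run n prio (m \<omega>) i = (\<Gamma>, \<psi>)" by (cases "run n prio (m \<omega>) i")
    have inv: "(\<Gamma>, \<psi>) \<in> states n" "\<Gamma> \<subseteq> {2..n}" "\<psi> permutes {1..n}"
      using run_invariant[OF prio, of "m \<omega>" i] by (auto simp: s states_def)
    have "(\<forall>g\<in>{2..n} - \<Gamma>. \<not> meet (m \<omega>) \<Gamma> \<psi> g < \<infinity>) \<longleftrightarrow> pending n (m \<omega>) \<Gamma> \<psi> = {}"
      by (auto simp: pending_def)
    moreover have "step n prio (m \<omega>) (\<Gamma>, \<psi>) = s \<longleftrightarrow> pending n (m \<omega>) \<Gamma> \<psi> = {} \<and> s = (\<Gamma>, \<psi>) \<or>
       (\<exists>g\<in>{2..n}. is_next n prio (m \<omega>) \<Gamma> \<psi> g \<and> s = merge prio \<Gamma> \<psi> g)"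
    proof (cases "pending n (m \<omega>) \<Gamma> \<psi> = {}")
      case True
      then show ?thesis by (auto simp: step_stuck is_next_def)
    next
      case False
      then obtain g where nx: "is_next n prio (m \<omega>) \<Gamma> \<psi> g" using inv prio is_next_exists by metis
      then have "g \<in> {2..n}" by (auto simp: is_next_def pending_def)
      then show ?thesis using nx False step_next[OF nx] is_next_unique[OF nx] by metis
    qed
    ultimately show ?thesis using inv(1) by (simp add: s)
  qed
  show ?case
    unfolding eq
  proof (intro pred_intros_finite pred_intros_logic finite_states Suc.IH)
    fix s' g assume s': "s' \<in> states n"
    then have s'': "fst s' \<subseteq> {2..n}" "snd s' permutes {1..n}" by (auto simp: states_def)
    show "Measurable.pred M (\<lambda>\<omega>. is_next n prio (m \<omega>) (fst s') (snd s') g)" if "g \<in> {2..n}"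
      using pred_pre_sigma_M[OF stopping_time_meet pred_is_next] s'' that by blast
    show "Measurable.pred M (\<lambda>\<omega>. meet (m \<omega>) (fst s') (snd s') g < \<infinity>)" if "g \<in> {2..n} - fst s'"
      using pred_pre_sigma_M[OF stopping_time_meet stopping_time_less[OF stopping_time_meet stopping_time_const]]
        s'' that by blast
  qed auto
qed simp

end


section \<open>Invariance of the expectation\<close>

text \<open>\<open>h\<close> stands for the indicator of \<open>A\<close> read in codes. The
  assumption \<open>h_cong\<close> is there because vectors of end positions are meaningful on
  \<open>{1..n}\<close> only, whereas \<open>h\<close> takes total functions.\<close>

locale coalescing_system = karlin_mcgregor M n T x Q X + pattern n G \<epsilon>
  for M :: "'w measure" and n T x Q X G \<epsilon> +
  fixes prio :: "nat \<Rightarrow> nat" and h :: "(nat \<Rightarrow> real) \<Rightarrow> real"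
  assumes prio: "inj_on prio {1..n}"
    and h_measurable: "\<And>\<phi>. \<phi> permutes {1..n} \<Longrightarrow> (\<lambda>y. h (y \<circ> \<phi>)) \<in> borel_measurable (\<Pi>\<^sub>M j\<in>{1..n}. borel)"
    and h_bound: "\<And>z. \<bar>h z\<bar> \<le> 1"
    and h_cong: "\<And>z z'. (\<And>k. k \<in> {1..n} \<Longrightarrow> z k = z' k) \<Longrightarrow> h z = h z'"
    and h_sorted: "\<And>z. h z \<noteq> 0 \<Longrightarrow> sorted_positions z"
begin

definition stage_value :: "nat set \<times> (nat \<Rightarrow> nat) \<Rightarrow> (nat \<Rightarrow> real) \<Rightarrow> real" where
  "stage_value s y = signed_sum (fst s) h (y \<circ> snd s)"

lemma signed_sum_cong:
  assumes "\<And>k. k \<in> {1..n} \<Longrightarrow> z k = z' k"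
  shows "signed_sum \<Gamma> h z = signed_sum \<Gamma> h z'"
  unfolding signed_sum_def
proof (rule sum.cong)
  fix \<rho> assume "\<rho> \<in> cands \<Gamma>"
  then have "\<rho> permutes {1..n}" by (simp add: cands_def)
  then have "h (z \<circ> \<rho>) = h (z' \<circ> \<rho>)"
    using assms permutes_in_image[of \<rho> "{1..n}"] by (intro h_cong) (simp only: comp_apply)
  then show "inv_sign \<Gamma> \<rho> * h (z \<circ> \<rho>) = inv_sign \<Gamma> \<rho> * h (z' \<circ> \<rho>)" by simp
qed simp

lemma measurable_stage_value: "s \<in> states n \<Longrightarrow> stage_value s \<in> borel_measurable states_T"
  unfolding stage_value_def[abs_def] signed_sum_def o_assoc[symmetric]
proof (intro borel_measurable_sum borel_measurable_times borel_measurable_const)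
  fix \<rho> assume "s \<in> states n" "\<rho> \<in> cands (fst s)"
  then have "snd s \<circ> \<rho> permutes {1..n}"
    by (intro permutes_compose) (auto simp: states_def cands_def)
  then show "(\<lambda>y. h (y \<circ> (snd s \<circ> \<rho>))) \<in> borel_measurable states_T" by (rule h_measurable)
qed

lemma stage_value_bound: "\<bar>stage_value s y\<bar> \<le> card (cands (fst s))"
proof -
  have "\<bar>stage_value s y\<bar> \<le> (\<Sum>\<rho>\<in>cands (fst s). \<bar>inv_sign (fst s) \<rho> * h (y \<circ> snd s \<circ> \<rho>)\<bar>)"
    unfolding stage_value_def signed_sum_def by (rule sum_abs)
  also have "\<dots> \<le> (\<Sum>\<rho>\<in>cands (fst s). 1)"
    using h_bound by (intro sum_mono) (auto simp: inv_sign_def abs_mult power_abs)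
  finally show ?thesis by simp
qed

lemma integrable_stage_value:
  assumes "E \<in> sets M" "s \<in> states n"
  shows "integrable M (\<lambda>\<omega>. indicator E \<omega> * stage_value s (XT \<omega>))"
proof (rule integrable_const_bound)
  show "AE \<omega> in M. norm (indicator E \<omega> * stage_value s (XT \<omega>)) \<le> real (card (cands (fst s)))"
    using stage_value_bound[of s] by (intro AE_I2) (auto simp: indicator_def)
  show "(\<lambda>\<omega>. indicator E \<omega> * stage_value s (XT \<omega>)) \<in> borel_measurable M"
    using assms measurable_compose[OF measurable_XT measurable_stage_value[OF assms(2)]]
    by (intro borel_measurable_times borel_measurable_indicator) auto
qed

lemma integrable_run: "integrable M (\<lambda>\<omega>. stage_value (run n prio (m \<omega>) i) (XT \<omega>))"
proof -
  let ?E = "\<lambda>s. {\<omega> \<in> space M. run n prio (m \<omega>) i = s}"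
  have "integrable M (\<lambda>\<omega>. \<Sum>s\<in>states n. indicator (?E s) \<omega> * stage_value s (XT \<omega>))"
    using pred_run[OF prio] by (intro Bochner_Integration.integrable_sum integrable_stage_value) (auto simp: pred_def)
  also have "?this \<longleftrightarrow> ?thesis"
  proof (rule Bochner_Integration.integrable_cong[OF refl])
    fix \<omega> assume \<omega>: "\<omega> \<in> space M"
    let ?r = "run n prio (m \<omega>) i"
    have "?r \<in> states n" using run_invariant[OF prio, of "m \<omega>" i] by simp
    moreover have "(\<Sum>s\<in>states n. indicator (?E s) \<omega> * stage_value s (XT \<omega>)) =
      (\<Sum>s\<in>states n. if s = ?r then stage_value ?r (XT \<omega>) else 0)"
      using \<omega> by (intro sum.cong) (auto simp: indicator_def)
    ultimately show "(\<Sum>s\<in>states n. indicator (?E s) \<omega> * stage_value s (XT \<omega>)) = stage_value ?r (XT \<omega>)"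
      using finite_states by simp
  qed
  finally show ?thesis .
qed

text \<open>Whichever particle wins, the new stage contributes the same sum over \<open>y\<close>
  and its exchange: a win of the right-hand particle only interchanges the two summands. So
  \<open>signed_sum_collision\<close> makes the increment antisymmetric.\<close>

lemma stage_value_merge_swap:
  assumes \<Gamma>: "\<Gamma> \<subseteq> {2..n}" and \<psi>: "\<psi> permutes {1..n}" and g: "g \<in> {2..n} - \<Gamma>"
  defines "p \<equiv> \<psi> (prv \<Gamma> g)" and "q \<equiv> \<psi> g"
  shows "stage_value (merge prio \<Gamma> \<psi> g) (swap p q y) - stage_value (\<Gamma>, \<psi>) (swap p q y) =
    - (stage_value (merge prio \<Gamma> \<psi> g) y - stage_value (\<Gamma>, \<psi>) y)"
proof -
  define a where "a = prv \<Gamma> g"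
  define z where "z = y \<circ> \<psi>"
  let ?t = "transpose a g"
  have a: "1 \<le> a" "a < g" using prv_props[OF \<Gamma>, of g] g by (auto simp: a_def)
  have inj: "\<psi> k = \<psi> l \<longleftrightarrow> k = l" for k l using permutes_inj[OF \<psi>] by (auto dest: injD)
  have sw: "(swap p q y \<circ> \<psi>) k = (z \<circ> ?t) k" if "k \<in> {1..n}" for k
  proof -
    have "\<psi> k \<in> {1..n}" using permutes_in_image[OF \<psi>] that by blast
    then show ?thesis by (simp add: swap_def z_def p_def q_def a_def transpose_if inj)
  qed
  have sw': "(swap p q y \<circ> (\<psi> \<circ> ?t)) k = z k" if "k \<in> {1..n}" for k
  proof -
    have "?t k \<in> {1..n}" using that a g by (auto simp: transpose_if)
    from sw[OF this] show ?thesis by simp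
  qed
  have 1: "stage_value (\<Gamma>, \<psi>) y = signed_sum \<Gamma> h z" by (simp add: stage_value_def z_def)
  have 2: "stage_value (\<Gamma>, \<psi>) (swap p q y) = signed_sum \<Gamma> h (z \<circ> ?t)"
    unfolding stage_value_def fst_conv snd_conv by (rule signed_sum_cong) (rule sw)
  have 3: "stage_value (merge prio \<Gamma> \<psi> g) y + stage_value (merge prio \<Gamma> \<psi> g) (swap p q y) =
    signed_sum (insert g \<Gamma>) h z + signed_sum (insert g \<Gamma>) h (z \<circ> ?t)"
  proof (cases "prio (\<psi> (prv \<Gamma> g)) < prio (\<psi> g)")
    case True
    then have u: "merge prio \<Gamma> \<psi> g = (insert g \<Gamma>, \<psi>)" by (simp add: merge_def)
    have "signed_sum (insert g \<Gamma>) h (swap p q y \<circ> \<psi>) = signed_sum (insert g \<Gamma>) h (z \<circ> ?t)"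
      by (rule signed_sum_cong) (rule sw)
    then show ?thesis unfolding stage_value_def u fst_conv snd_conv z_def[symmetric] by (rule arg_cong)
  next
    case False
    then have u: "merge prio \<Gamma> \<psi> g = (insert g \<Gamma>, \<psi> \<circ> ?t)" by (simp add: merge_def a_def)
    have "signed_sum (insert g \<Gamma>) h (swap p q y \<circ> (\<psi> \<circ> ?t)) = signed_sum (insert g \<Gamma>) h z"
      by (rule signed_sum_cong) (rule sw')
    moreover have "y \<circ> (\<psi> \<circ> ?t) = z \<circ> ?t" by (simp only: z_def o_assoc)
    ultimately show ?thesis unfolding stage_value_def u fst_conv snd_conv by (simp only: add.commute)
  qed
  show ?thesis using 1 2 3 signed_sum_collision[OF \<Gamma> g a_def, of h z] by simp
qed

text \<open>Almost surely this says that the stage after \<open>i\<close> collisions is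
  \<open>s\<close> and that \<open>g\<close> collides next; it is phrased through
  \<open>hist\<close> so as to lie in the past of that collision.\<close>

definition next_event :: "nat \<Rightarrow> nat set \<times> (nat \<Rightarrow> nat) \<Rightarrow> nat \<Rightarrow> 'w set" where
  "next_event i s g = {\<omega> \<in> space M. hist n prio (m \<omega>) (meet (m \<omega>) (fst s) (snd s) g) i s \<and>
     is_next n prio (m \<omega>) (fst s) (snd s) g}"

lemma sets_next_event:
  assumes "s \<in> states n" "g \<in> {2..n}"
  shows "next_event i s g \<in> sets (pre_sigma (\<lambda>\<omega>. meet (m \<omega>) (fst s) (snd s) g))"
proof -
  have s: "fst s \<subseteq> {2..n}" "snd s permutes {1..n}" using assms by (auto simp: states_def)
  note st = stopping_time_meet[OF s assms(2)]
  have "Measurable.pred (pre_sigma (\<lambda>\<omega>. meet (m \<omega>) (fst s) (snd s) g))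
    (\<lambda>\<omega>. hist n prio (m \<omega>) (meet (m \<omega>) (fst s) (snd s) g) i s \<and> is_next n prio (m \<omega>) (fst s) (snd s) g)"
    by (rule pred_intros_logic(3)[OF pred_hist[OF st] pred_is_next[OF s assms(2)]])
  then show ?thesis by (simp add: pred_def space_pre_sigma next_event_def)
qed

lemma sets_next_event_M: "s \<in> states n \<Longrightarrow> g \<in> {2..n} \<Longrightarrow> next_event i s g \<in> sets M"
  using sets_next_event[of s g i] sets_pre_sigma_M[OF stopping_time_meet, of "fst s" "snd s" g]
  by (auto simp: states_def)

lemma integral_next_event:
  assumes s: "s \<in> states n" and g: "g \<in> {2..n}"
  shows "(\<integral>\<omega>. indicator (next_event i s g) \<omega> *
    (stage_value (merge prio (fst s) (snd s) g) (XT \<omega>) - stage_value s (XT \<omega>)) \<partial>M) = 0"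
proof (cases "g \<in> fst s")
  case True
  then have "next_event i s g = {}" by (auto simp: next_event_def is_next_def pending_def)
  then show ?thesis by simp
next
  case False
  obtain \<Gamma> \<psi> where s': "s = (\<Gamma>, \<psi>)" by (cases s)
  have \<Gamma>: "\<Gamma> \<subseteq> {2..n}" "\<psi> permutes {1..n}" and g': "g \<in> {2..n} - \<Gamma>"
    using s g False by (auto simp: s' states_def)
  have p: "1 \<le> prv \<Gamma> g" "prv \<Gamma> g < g" using prv_props[OF \<Gamma>(1), of g] g by auto
  have "prv \<Gamma> g \<in> {1..n}" "g \<in> {1..n}" using p g by auto
  then have pq: "\<psi> (prv \<Gamma> g) \<in> {1..n}" "\<psi> g \<in> {1..n}" using permutes_in_image[OF \<Gamma>(2)] by blast+
  have ne: "\<psi> (prv \<Gamma> g) \<noteq> \<psi> g" using permutes_inj[OF \<Gamma>(2)] p by (metis injD less_irrefl)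
  show ?thesis
    unfolding s' fst_conv snd_conv
  proof (rule swap_integral_eq_0[OF pq ne])
    show "next_event i (\<Gamma>, \<psi>) g \<in> sets (pre_sigma (\<lambda>\<omega>. m \<omega> (\<psi> (prv \<Gamma> g)) (\<psi> g)))"
      using sets_next_event[OF s g, of i] by (simp add: s' meet_def)
    show "m \<omega> (\<psi> (prv \<Gamma> g)) (\<psi> g) < \<infinity>" if "\<omega> \<in> next_event i (\<Gamma>, \<psi>) g" for \<omega>
      using that by (auto simp: next_event_def is_next_def pending_def meet_def)
    show "(\<lambda>y. stage_value (merge prio \<Gamma> \<psi> g) y - stage_value (\<Gamma>, \<psi>) y) \<in> borel_measurable states_T"
      using s merge_states[OF \<Gamma> g] by (intro borel_measurable_diff measurable_stage_value) (auto simp: s')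
  qed (rule stage_value_merge_swap[OF \<Gamma> g'])
qed

text \<open>The increment is a finite sum over possible stages and junctions, and each term has
  integral zero by the exchange at its own meeting time.\<close>

lemma integral_run_Suc:
  "(\<integral>\<omega>. stage_value (run n prio (m \<omega>) (Suc i)) (XT \<omega>) \<partial>M) = (\<integral>\<omega>. stage_value (run n prio (m \<omega>) i) (XT \<omega>) \<partial>M)"
proof -
  define d where "d s g \<omega> = indicator (next_event i s g) \<omega> *
    (stage_value (merge prio (fst s) (snd s) g) (XT \<omega>) - stage_value s (XT \<omega>))" for s g \<omega>
  have d_int: "integrable M (d s g)" if "s \<in> states n" "g \<in> {2..n}" for s g
  proof -
    have "merge prio (fst s) (snd s) g \<in> states n"
      using that by (intro merge_states) (auto simp: states_def)
    then show ?thesis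
      using that sets_next_event_M unfolding d_def right_diff_distrib
      by (intro Bochner_Integration.integrable_diff integrable_stage_value) auto
  qed
  have D_int: "integrable M (\<lambda>\<omega>. \<Sum>s\<in>states n. \<Sum>g\<in>{2..n}. d s g \<omega>)"
    by (intro Bochner_Integration.integrable_sum d_int)
  have D_0: "(\<integral>\<omega>. (\<Sum>s\<in>states n. \<Sum>g\<in>{2..n}. d s g \<omega>) \<partial>M) = 0"
  proof -
    have "(\<integral>\<omega>. (\<Sum>s\<in>states n. \<Sum>g\<in>{2..n}. d s g \<omega>) \<partial>M) = (\<Sum>s\<in>states n. \<Sum>g\<in>{2..n}. \<integral>\<omega>. d s g \<omega> \<partial>M)"
    proof (subst Bochner_Integration.integral_sum)
      show "integrable M (\<lambda>\<omega>. \<Sum>g\<in>{2..n}. d s g \<omega>)" if "s \<in> states n" for s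
        using that by (intro Bochner_Integration.integrable_sum d_int)
      show "(\<Sum>s\<in>states n. \<integral>\<omega>. (\<Sum>g\<in>{2..n}. d s g \<omega>) \<partial>M) = (\<Sum>s\<in>states n. \<Sum>g\<in>{2..n}. \<integral>\<omega>. d s g \<omega> \<partial>M)"
        by (intro sum.cong refl Bochner_Integration.integral_sum d_int)
    qed
    then show ?thesis using integral_next_event by (simp add: d_def)
  qed
  have "AE \<omega> in M. stage_value (run n prio (m \<omega>) (Suc i)) (XT \<omega>) =
    stage_value (run n prio (m \<omega>) i) (XT \<omega>) + (\<Sum>s\<in>states n. \<Sum>g\<in>{2..n}. d s g \<omega>)"
    using AE_good_path AE_space
  proof eventually_elim
    case (elim \<omega>)
    obtain \<Gamma> \<psi> where r: "run n prio (m \<omega>) i = (\<Gamma>, \<psi>)" by (cases "run n prio (m \<omega>) i")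
    have st: "(\<Gamma>, \<psi>) \<in> states n" using run_invariant[OF prio, of "m \<omega>" i] by (simp add: r)
    then have \<Gamma>: "\<Gamma> \<subseteq> {2..n}" "\<psi> permutes {1..n}" by (auto simp: states_def)
    \<comment> \<open>On a good path, the history up to the next meeting and the actual run agree,
      so at most one of the events occurs.\<close>
    have mem: "\<omega> \<in> next_event i s g \<longleftrightarrow> s = (\<Gamma>, \<psi>) \<and> is_next n prio (m \<omega>) \<Gamma> \<psi> g" for s g
    proof
      assume "\<omega> \<in> next_event i s g"
      then show "s = (\<Gamma>, \<psi>) \<and> is_next n prio (m \<omega>) \<Gamma> \<psi> g"
        using hist_run[of n prio "m \<omega>" _ i s] r by (force simp: next_event_def)
    next
      assume "s = (\<Gamma>, \<psi>) \<and> is_next n prio (m \<omega>) \<Gamma> \<psi> g"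
      then show "\<omega> \<in> next_event i s g"
        using run_hist[OF elim(1) refl prio, of i g] elim(2) by (simp add: next_event_def r)
    qed
    show ?case
    proof (cases "pending n (m \<omega>) \<Gamma> \<psi> = {}")
      case True
      then have "\<omega> \<notin> next_event i s g" for s g by (auto simp: mem is_next_def)
      then have "(\<Sum>s\<in>states n. \<Sum>g\<in>{2..n}. d s g \<omega>) = 0" by (simp add: d_def)
      then show ?thesis using True by (simp add: r step_stuck)
    next
      case False
      then obtain g0 where nx: "is_next n prio (m \<omega>) \<Gamma> \<psi> g0" using \<Gamma> prio is_next_exists by metis
      then have g0: "g0 \<in> {2..n}" by (auto simp: is_next_def pending_def)
      let ?w = "stage_value (merge prio \<Gamma> \<psi> g0) (XT \<omega>) - stage_value (\<Gamma>, \<psi>) (XT \<omega>)"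
      have "d s g \<omega> = (if s = (\<Gamma>, \<psi>) then if g = g0 then ?w else 0 else 0)" for s g
      proof (cases "s = (\<Gamma>, \<psi>) \<and> g = g0")
        case True
        then show ?thesis using mem[of s g] nx by (simp add: d_def)
      next
        case False
        then have "\<omega> \<notin> next_event i s g" using mem[of s g] is_next_unique[OF nx, of g] by blast
        then show ?thesis using False by (auto simp: d_def)
      qed
      then have "(\<Sum>s\<in>states n. \<Sum>g\<in>{2..n}. d s g \<omega>) =
        (\<Sum>s\<in>states n. if s = (\<Gamma>, \<psi>) then \<Sum>g\<in>{2..n}. if g = g0 then ?w else 0 else 0)"
        by (intro sum.cong) auto
      also have "\<dots> = ?w" using st g0 finite_states by simp
      finally show ?thesis using step_next[OF nx] by (simp add: r)
    qed
  qed
  then have "(\<integral>\<omega>. stage_value (run n prio (m \<omega>) (Suc i)) (XT \<omega>) \<partial>M) =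
    (\<integral>\<omega>. stage_value (run n prio (m \<omega>) i) (XT \<omega>) + (\<Sum>s\<in>states n. \<Sum>g\<in>{2..n}. d s g \<omega>) \<partial>M)"
    using integrable_run D_int
    by (intro integral_cong_AE borel_measurable_integrable Bochner_Integration.integrable_add)
  also have "\<dots> = (\<integral>\<omega>. stage_value (run n prio (m \<omega>) i) (XT \<omega>) \<partial>M)"
    using integrable_run D_int D_0 by simp
  finally show ?thesis .
qed

theorem expectation_final:
  "(\<integral>\<omega>. (if fst (run n prio (m \<omega>) n) = G then h (XT \<omega> \<circ> snd (run n prio (m \<omega>) n)) else 0) \<partial>M) =
    (\<Sum>\<rho>\<in>cands {}. inv_sign {} \<rho> * (\<integral>\<omega>. h (XT \<omega> \<circ> \<rho>) \<partial>M))"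
proof -
  let ?r = "\<lambda>\<omega>. run n prio (m \<omega>) n"
  have int_h: "integrable M (\<lambda>\<omega>. h (XT \<omega> \<circ> \<phi>))" if "\<phi> permutes {1..n}" for \<phi>
  proof (rule integrable_const_bound)
    show "AE \<omega> in M. norm (h (XT \<omega> \<circ> \<phi>)) \<le> 1" using h_bound by simp
  qed (rule measurable_compose[OF measurable_XT h_measurable[OF that]])
  have const: "(\<integral>\<omega>. stage_value (run n prio (m \<omega>) i) (XT \<omega>) \<partial>M) = (\<integral>\<omega>. stage_value ({}, id) (XT \<omega>) \<partial>M)" for i
  proof (induction i)
    case (Suc i)
    then show ?case using integral_run_Suc[of i] by simp
  qed (simp only: run_0)
  have "AE \<omega> in M. stage_value (?r \<omega>) (XT \<omega>) = (if fst (?r \<omega>) = G then h (XT \<omega> \<circ> snd (?r \<omega>)) else 0)"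
    using AE_good_path
  proof eventually_elim
    case (elim \<omega>)
    obtain \<Gamma> \<psi> where r: "?r \<omega> = (\<Gamma>, \<psi>)" by (cases "?r \<omega>")
    have \<Gamma>: "\<Gamma> \<subseteq> {2..n}" "\<psi> permutes {1..n}" "located n \<Gamma> \<psi>" "pending n (m \<omega>) \<Gamma> \<psi> = {}"
      using run_invariant[OF prio, of "m \<omega>" n] run_terminal[OF prio, of "m \<omega>"] by (auto simp: r states_def)
    have "strict_mono_on ({1..n} - \<Gamma>) (\<lambda>k. X (\<psi> k) T \<omega>)"
      by (rule terminal_strict_mono[OF elim refl T \<Gamma>])
    moreover have "(XT \<omega> \<circ> \<psi>) k = X (\<psi> k) T \<omega>" if "k \<in> {1..n}" for k
      using permutes_in_image[OF \<Gamma>(2), of k] that by (simp add: XT_def)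
    ultimately have "strict_mono_on ({1..n} - \<Gamma>) (XT \<omega> \<circ> \<psi>)" by (simp add: strict_mono_on_def)
    then show ?case using signed_sum_final[OF _ h_sorted] by (simp add: r stage_value_def)
  qed
  then have "(\<integral>\<omega>. stage_value (?r \<omega>) (XT \<omega>) \<partial>M) =
    (\<integral>\<omega>. (if fst (?r \<omega>) = G then h (XT \<omega> \<circ> snd (?r \<omega>)) else 0) \<partial>M)"
  proof (intro integral_cong_AE)
    show "(\<lambda>\<omega>. stage_value (?r \<omega>) (XT \<omega>)) \<in> borel_measurable M"
      by (rule borel_measurable_integrable[OF integrable_run])
    \<comment> \<open>The stage is random, so measurability is obtained by splitting over the
      finitely many possible stages.\<close>
    have "(\<lambda>\<omega>. \<Sum>s\<in>states n. indicator {\<omega> \<in> space M. ?r \<omega> = s} \<omega> *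
        (if fst s = G then h (XT \<omega> \<circ> snd s) else 0)) \<in> borel_measurable M"
    proof (intro borel_measurable_sum borel_measurable_times borel_measurable_indicator)
      fix s assume "s \<in> states n"
      then have "snd s permutes {1..n}" by (auto simp: states_def)
      then show "(\<lambda>\<omega>. if fst s = G then h (XT \<omega> \<circ> snd s) else 0) \<in> borel_measurable M"
        using borel_measurable_integrable[OF int_h] by (cases "fst s = G") auto
      show "{\<omega> \<in> space M. ?r \<omega> = s} \<in> sets M" using pred_run[OF prio] by (simp add: pred_def)
    qed
    also have "?this \<longleftrightarrow> (\<lambda>\<omega>. if fst (?r \<omega>) = G then h (XT \<omega> \<circ> snd (?r \<omega>)) else 0) \<in> borel_measurable M"
    proof (rule measurable_cong)
      fix \<omega> assume \<omega>: "\<omega> \<in> space M"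
      have "?r \<omega> \<in> states n" using run_invariant[OF prio, of "m \<omega>" n] by simp
      moreover have "(\<Sum>s\<in>states n. indicator {\<omega> \<in> space M. ?r \<omega> = s} \<omega> *
          (if fst s = G then h (XT \<omega> \<circ> snd s) else 0)) =
        (\<Sum>s\<in>states n. if s = ?r \<omega> then (if fst (?r \<omega>) = G then h (XT \<omega> \<circ> snd (?r \<omega>)) else 0) else 0)"
        using \<omega> by (intro sum.cong) (auto simp: indicator_def)
      ultimately show "(\<Sum>s\<in>states n. indicator {\<omega> \<in> space M. ?r \<omega> = s} \<omega> *
          (if fst s = G then h (XT \<omega> \<circ> snd s) else 0)) =
        (if fst (?r \<omega>) = G then h (XT \<omega> \<circ> snd (?r \<omega>)) else 0)"
        using finite_states by simp
    qed
    finally show "(\<lambda>\<omega>. if fst (?r \<omega>) = G then h (XT \<omega> \<circ> snd (?r \<omega>)) else 0) \<in> borel_measurable M" .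
  qed
  moreover have "(\<integral>\<omega>. stage_value ({}, id) (XT \<omega>) \<partial>M) = (\<Sum>\<rho>\<in>cands {}. inv_sign {} \<rho> * (\<integral>\<omega>. h (XT \<omega> \<circ> \<rho>) \<partial>M))"
    unfolding stage_value_def signed_sum_def
    using int_h by (simp add: cands_def)
  ultimately show ?thesis using const[of n] by simp
qed

end

theorem theorem10p2:
  fixes M :: "'w measure" and n :: nat and T :: real and x :: "nat \<Rightarrow> real"
    and Q :: "real \<Rightarrow> real \<Rightarrow> (real \<Rightarrow> real) measure"
    and X :: "nat \<Rightarrow> real \<Rightarrow> 'w \<Rightarrow> real"
    and prio :: "nat \<Rightarrow> nat" and G :: "nat set" and \<epsilon> :: "nat \<Rightarrow> int"
    and A :: "(label \<Rightarrow> real) set"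
  assumes "prob_space M" and "0 \<le> T"
    and "\<And>i j. 1 \<le> i \<Longrightarrow> i \<le> j \<Longrightarrow> j \<le> n \<Longrightarrow> x i \<le> x j"
    and "path_laws T Q"
    and "KM1 M n T Q X" and "KM2 M n T Q x X" and "KM3 M n T X" and "KM4 M n T X"
    and "inj_on prio {1..n}"
    and "G \<subseteq> junctions n" and "\<And>g. g \<in> G \<Longrightarrow> \<epsilon> g \<in> {1, -1}"
    and "admissible n G \<epsilon> A"
  shows "P_int M n T prio X G A =
    (\<Sum>\<pi>\<in>candidates n G \<epsilon>.
       sgn_eps n G \<epsilon> \<pi> *
       measure M {\<omega>\<in>space M. (\<lambda>j\<in>{1..n}. X j T \<omega>) \<in> pulled_back n \<pi> A})"
proof -
  interpret karlin_mcgregor M n T x Q X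
    by (rule karlin_mcgregor.intro[OF assms(1)], rule karlin_mcgregor_axioms.intro) (fact assms(2-8))+
  interpret pattern n G \<epsilon>
    using assms(10,11) by unfold_locales (auto simp: junctions_def)
  \<comment> \<open>Membership in \<open>A\<close>, tested after turning a vector indexed by codes
    into one indexed by roles.\<close>
  define h :: "(nat \<Rightarrow> real) \<Rightarrow> real" where "h z = indicator A (role_positions z)" for z
  have A: "A \<in> sets (\<Pi>\<^sub>M f\<in>roles n G. borel)" using assms(12) by (simp add: admissible_def)
  have meas_roles: "(\<lambda>y. role_positions (y \<circ> \<phi>)) \<in> states_T \<rightarrow>\<^sub>M (\<Pi>\<^sub>M f\<in>roles n G. borel)"
    if "\<phi> permutes {1..n}" for \<phi>
    unfolding role_positions_def comp_apply
    using code_roles permutes_in_image[OF that]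
    by (intro measurable_restrict measurable_component_singleton) blast
  interpret coalescing_system M n T x Q X G \<epsilon> prio h
  proof
    show "inj_on prio {1..n}" by fact
    show "(\<lambda>y. h (y \<circ> \<phi>)) \<in> borel_measurable (\<Pi>\<^sub>M j\<in>{1..n}. borel)" if "\<phi> permutes {1..n}" for \<phi>
      unfolding h_def by (rule measurable_compose[OF meas_roles[OF that] borel_measurable_indicator[OF A]])
    show "\<bar>h z\<bar> \<le> 1" for z by (simp add: h_def indicator_def)
    show "h z = h z'" if "\<And>k. k \<in> {1..n} \<Longrightarrow> z k = z' k" for z z'
    proof -
      have "role_positions z = role_positions z'"
        unfolding role_positions_def by (intro restrict_ext that code_roles)
      then show ?thesis by (simp add: h_def)
    qed
    show "sorted_positions z" if "h z \<noteq> 0" for z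
      using that admissible_sorted[OF assms(12)] by (auto simp: h_def indicator_def split: if_splits)
  qed
  let ?r = "\<lambda>\<omega>. run n prio (m \<omega>) n"
  have lhs: "P_int M n T prio X G A =
    (\<integral>\<omega>. (if fst (?r \<omega>) = G then h (XT \<omega> \<circ> snd (?r \<omega>)) else 0) \<partial>M)"
  proof -
    let ?E = "{\<omega>\<in>space M. realized_ghosts n T prio X \<omega> = G \<and> final_positions n T prio G X \<omega> \<in> A}"
    have "(\<integral>\<omega>. (if fst (?r \<omega>) = G then h (XT \<omega> \<circ> snd (?r \<omega>)) else 0) \<partial>M) = (\<integral>\<omega>. indicator ?E \<omega> \<partial>M)"
    proof (rule Bochner_Integration.integral_cong[OF refl])
      fix \<omega> assume \<omega>: "\<omega> \<in> space M"
      obtain \<Gamma> \<psi> where r: "?r \<omega> = (\<Gamma>, \<psi>)" by (cases "?r \<omega>")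
      have \<psi>: "\<psi> permutes {1..n}" and c: "final_config n T prio X \<omega> = conf n \<Gamma> \<psi>"
        using run_invariant[OF prio, of "m \<omega>" n] by (auto simp: r states_def final_config_def)
      have "realized_ghosts n T prio X \<omega> = \<Gamma>" by (simp add: realized_ghosts_def c dom_conf)
      then show "(if fst (?r \<omega>) = G then h (XT \<omega> \<circ> snd (?r \<omega>)) else 0) = indicator ?E \<omega>"
        using \<omega> conf_positions[OF _ \<psi>, of T prio X \<omega>] c by (auto simp: r h_def XT_def indicator_def)
    qed
    then show ?thesis unfolding P_int_def by (simp add: Int_absorb2 Collect_subset)
  qed
  have summand: "(\<integral>\<omega>. h (XT \<omega> \<circ> \<rho>) \<partial>M) =
    measure M {\<omega>\<in>space M. (\<lambda>j\<in>{1..n}. X j T \<omega>) \<in> pulled_back n (to_cand \<rho>) A}"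
    if "\<rho> permutes {1..n}" for \<rho>
  proof -
    let ?E = "{\<omega>\<in>space M. (\<lambda>j\<in>{1..n}. X j T \<omega>) \<in> pulled_back n (to_cand \<rho>) A}"
    have "(\<integral>\<omega>. h (XT \<omega> \<circ> \<rho>) \<partial>M) = (\<integral>\<omega>. indicator ?E \<omega> \<partial>M)"
      using pulled_back_iff[OF assms(12) that]
      by (intro Bochner_Integration.integral_cong) (auto simp: h_def indicator_def XT_def)
    then show ?thesis by (simp add: Int_absorb2 Collect_subset)
  qed
  have "(\<Sum>\<rho>\<in>cands {}. inv_sign {} \<rho> * (\<integral>\<omega>. h (XT \<omega> \<circ> \<rho>) \<partial>M)) =
    (\<Sum>\<pi>\<in>candidates n G \<epsilon>. sgn_eps n G \<epsilon> \<pi> *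
       measure M {\<omega>\<in>space M. (\<lambda>j\<in>{1..n}. X j T \<omega>) \<in> pulled_back n \<pi> A})"
  \<comment> \<open>At the initial stage, permutations and candidates correspond with equal signs
    and equal events, so the initial expectation becomes the sum over candidates.\<close>
  proof (rule sum.reindex_bij_witness[where i = of_cand and j = to_cand])
    fix \<rho> assume "\<rho> \<in> cands {}"
    then have "\<rho> permutes {1..n}" by (simp add: cands_def)
    then show "sgn_eps n G \<epsilon> (to_cand \<rho>) *
        measure M {\<omega>\<in>space M. (\<lambda>j\<in>{1..n}. X j T \<omega>) \<in> pulled_back n (to_cand \<rho>) A} =
      inv_sign {} \<rho> * (\<integral>\<omega>. h (XT \<omega> \<circ> \<rho>) \<partial>M)"
      by (simp only: sgn_to_cand summand)
  qed (simp_all add: of_to_cand to_of_cand to_cand_candidates of_cand_cands)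
  then show ?thesis using lhs expectation_final by simp
qed

end
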